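(* Consider the time-invariant problem and the DOPP algorithm described in the context. Suppose the network assumptions (N1)–(N3) and the problem assumptions (P1)–(P4) of the context hold. Let $\alpha_0=1,\ \beta_0=1$ and, for $t\ge 1$, $\alpha_t=1/\sqrt t$, $\beta_t=1/t^{\kappa}$, where $\kappa\in(0,1/4)$ is a constant. Let $$\bar x_{i,T}:=\frac1T\sum_{t=1}^T x_{i,t}\ (i\in[N]),\qquad x^*=col(x_1^*,\ldots,x_N^* ):=\arg\min_{x\in\mathcal X}\sum_{i=1}^N f_i(x_i),$$ $$E_T^f:=\frac1T\sum_{t=1}^T\sum_{i=1}^N f_i(x_{i,t})-\sum_{i=1}^N f_i(x_i^* ).$$ Then, for $T\ge4$, $$\sum_{i=1}^N f_i(\bar x_{i,T})-\sum_{i=1}^N f_i(x_i^* )=O_+\big(T^{-\frac12+2\kappa}\big),$$ $$E_T^f=\begin{cases}\Omega(-T^{-\kappa}), & \kappa\in(0,\frac16],\\ \Omega\big(-T^{-\frac14+\frac{\kappa}{2}}\big), & \kappa\in[\frac16,\frac14),\end{cases}$$ $$\Big\|\Big[\sum_{i=1}^N g_i(\bar x_{i,T})\Big]_+\Big\|=\begin{cases}O(T^{-\kappa}), & \kappa\in(0,\frac16],\\ O\big(T^{-\frac14+\frac{\kappa}{2}}\big), & \kappa\in[\frac16,\frac14).\end{cases}$$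
   Context: Notation. $[N]=\{1,\ldots,N\}$; $\|\cdot\|$ is the Euclidean norm (induced norm for matrices); vector (in)equalities are componentwise; $[z]_+$ is the componentwise projection of $z$ onto the nonnegative orthant; $P_S$ is Euclidean projection onto a closed convex set $S$; $col(\cdot)$ stacks column vectors; $\partial h(x)$ is the subdifferential of a convex function $h$ at $x$. For a vector-valued componentwise convex $h:\mathbb R^{n}\to\mathbb R^m$, $\partial h(x)$ denotes the set of $n\times m$ matrices whose columns are subgradients of the components of $h$ at $x$. As functions of $T$: $h_1=O_+(h_2)$ means $h_1\le C h_2$, $h_1=O(h_2)$ means $|h_1|\le C h_2$, and $h_1=\Omega(h_2)$ means $h_1\ge C h_2$, for some constant $C>0$ independent of $T$. Network. There are $N$ agents communicating over directed graphs $\mathcal G_t=(\mathcal V,\mathcal E_t)$, $\mathcal V=[N]$, with nonnegative adjacency matrices $A_t=(a_{ij,t})\in\mathbb R^{N\times N}$, where $a_{ij,t}>0$ if $(j,i)\in\mathcal E_t$ and $a_{ij,t}=0$ otherwise; every node is its own in- and out-neighbor. Assumptions, for all $t\ge0$: (N1) there is a constant $0<a<1$ with $a_{ij,t}\ge a$ whenever $a_{ij,t}>0$, and $a_{ii,t}\ge a$ for all $i$; (N2) $A_t$ is column-stochastic: $\sum_{i=1}^N a_{ij,t}=1$ for all $j\in[N]$; (N3) there is a constant (integer) $Q>0$ such that the graph $(\mathcal V,\cup_{l=0,\ldots,Q-1}\mathcal E_{t+l})$ is strongly connected for all $t\ge1$. Problem (time-invariant). For each $i\in[N]$, $X_i\subset\mathbb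 R^{n_i}$, $f_i:\mathbb R^{n_i}\to\mathbb R$ and $g_i:\mathbb R^{n_i}\to\mathbb R^m$ (the cost functions do not depend on time). Put $X=X_1\times\cdots\times X_N$, $g(x)=\sum_{i=1}^N g_i(x_i)$ for $x=col(x_1,\ldots,x_N)$, and $\mathcal X=\{x\in X: g(x)\le\mathbf 0\}$, assumed nonempty. Assumptions: (P1) all $f_i$ and (componentwise) $g_i$ are convex on $\mathbb R^{n_i}$; (P2) all $X_i$ are convex and compact; (P3) (Slater) there is $x_s$ in the relative interior of $X$ with $g(x_s)\le\mathbf 0$ for those components of $g$ that are linear in $x$, if any, and $g(x_s)<\mathbf 0$ for all other components; (P4) there are $B_f,C_f>0$ such that for all $i\in[N]$, $x,y\in X_i$: $|f_i(x)|\le B_f$, $|f_i(x)-f_i(y)|\le C_f\|x-y\|$, and every subgradient in $\partial f_i(x)$ has norm at most $C_f$. Algorithm DOPP. Initialize $w_{i,0}=1$, $x_{i,0}\in X_i$, $\mu_{i,0}=\mathbf 0$, $y_{i,0}=g_i(x_{i,0})$. For $t=0,1,2,\ldots$ and each $i\in[N]$: $w_{i,t+1}=\sum_j a_{ij,t}w_{j,t}$, $\ \hat\mu_{i,t}=\sum_j a_{ij,t}\mu_{j,t}$, $\ \hat y_{i,t}=\sum_j a_{ij,t}y_{j,t}$, $s_{i,t+1}\in\partial f_i(x_{i,t})+\partial g_i(x_{i,t})\,\hat\mu_{i,t}/w_{i,t+1}$, $x_{i,t+1}=P_{X_i}(x_{i,t}-\alpha_t s_{i,t+1})$, $\mu_{i,t+1}=\big[\hat\mu_{i,t}+\alpha_t\big(\hat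 y_{i,t}/w_{i,t+1}-\beta_t\hat\mu_{i,t}\big)\big]_+$, $y_{i,t+1}=\hat y_{i,t}+g_i(x_{i,t+1})-g_i(x_{i,t})$. *)

theory Defs
  imports "HOL-Analysis.Analysis"
begin

text \<open>
  Modelling conventions.

  The agents are the elements of a finite type \<open>'n\<close>. The decision spaces \<open>\<real>\<^bsup>n\<^sub>i\<^esup>\<close>, whose dimensions
  depend on the agent \<open>i\<close>, are modelled as linear subspaces \<open>V i\<close> (of dimension \<open>n\<^sub>i\<close>) of one
  Euclidean space \<open>'a\<close>. Functions on \<open>\<real>\<^bsup>n\<^sub>i\<^esup>\<close> are HOL functions on \<open>'a\<close> about which nothing
  is assumed outside \<open>V i\<close>; in particular subgradients are vectors of \<open>V i\<close> and are
  tested against points of \<open>V i\<close> only. A stacked vector \<open>col(x\<^sub>1,\<dots>,x\<^sub>N)\<close> is an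
  element of \<open>'a ^ 'n\<close>, whose norm and inner product are those of the orthogonal direct sum.

  Iterates take the time first and the agent second: \<open>x t i\<close> stands for \<open>x\<^sub>i\<^sub>,\<^sub>t\<close>.
\<close>

definition subdifferential :: "'a::euclidean_space set \<Rightarrow> ('a \<Rightarrow> real) \<Rightarrow> 'a \<Rightarrow> 'a set" where
  "subdifferential V h x = {s \<in> V. \<forall>z\<in>V. h x + s \<bullet> (z - x) \<le> h z}"

text \<open>For vector-valued \<open>h\<close>: matrices given by their columns, column \<open>k\<close> being a subgradient of
  component \<open>k\<close>; \<open>cols_mult G \<mu>\<close> is the matrix-vector product of such a matrix with \<open>\<mu>\<close>.\<close>

definition subdifferential_vec ::
    "'a::euclidean_space set \<Rightarrow> ('a \<Rightarrow> real ^ 'm) \<Rightarrow> 'a \<Rightarrow> ('a ^ 'm) set" where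
  "subdifferential_vec V h x = {G. \<forall>k. G $ k \<in> subdifferential V (\<lambda>z. h z $ k) x}"

definition cols_mult :: "'a::euclidean_space ^ 'm \<Rightarrow> real ^ 'm \<Rightarrow> 'a" where
  "cols_mult G \<mu> = (\<Sum>k\<in>UNIV. (\<mu> $ k) *\<^sub>R (G $ k))"

definition pos_part :: "real ^ 'm \<Rightarrow> real ^ 'm" where
  "pos_part z = (\<chi> k. max 0 (z $ k))"

definition prod_set :: "('n \<Rightarrow> 'a set) \<Rightarrow> ('a ^ 'n) set" where
  "prod_set S = {x. \<forall>i. x $ i \<in> S i}"

definition agent_sum :: "('n::finite \<Rightarrow> 'a \<Rightarrow> 'b::comm_monoid_add) \<Rightarrow> 'a ^ 'n \<Rightarrow> 'b" where
  "agent_sum h x = (\<Sum>i\<in>UNIV. h i (x $ i))"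

definition feasible_set :: "('n::finite \<Rightarrow> 'a set) \<Rightarrow> ('n \<Rightarrow> 'a \<Rightarrow> real ^ 'm) \<Rightarrow> ('a ^ 'n) set" where
  "feasible_set X g = {x \<in> prod_set X. agent_sum g x \<le> 0}"

text \<open>``Linear'' constraint components are understood, as usual for Slater's condition, as those of
  the form \<open>c \<bullet> x + b\<close>.\<close>

definition linear_constraint_on :: "'b::euclidean_space set \<Rightarrow> ('b \<Rightarrow> real) \<Rightarrow> bool" where
  "linear_constraint_on S h \<longleftrightarrow> (\<exists>c b. \<forall>x\<in>S. h x = c \<bullet> x + b)"

definition slater ::
    "('n::finite \<Rightarrow> 'a::euclidean_space set) \<Rightarrow> ('n \<Rightarrow> 'a set) \<Rightarrow> ('n \<Rightarrow> 'a \<Rightarrow> real ^ 'm) \<Rightarrow> bool" where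
  "slater V X g \<longleftrightarrow>
    (\<exists>xs \<in> rel_interior (prod_set X). \<forall>k.
       (if linear_constraint_on (prod_set V) (\<lambda>x. agent_sum g x $ k)
        then agent_sum g xs $ k \<le> 0 else agent_sum g xs $ k < 0))"

definition strongly_connected :: "('n \<times> 'n) set \<Rightarrow> bool" where
  "strongly_connected E \<longleftrightarrow> (\<forall>u v. (u, v) \<in> E\<^sup>*)"

text \<open>\<open>A t $ i $ j\<close> is \<open>a\<^sub>i\<^sub>j\<^sub>,\<^sub>t\<close>, the weight of the edge from \<open>j\<close> to \<open>i\<close>.\<close>

definition adjacency_matrices ::
    "(nat \<Rightarrow> ('n \<times> 'n) set) \<Rightarrow> (nat \<Rightarrow> real ^ 'n ^ 'n) \<Rightarrow> bool" where
  "adjacency_matrices E A \<longleftrightarrow>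
    (\<forall>t i. (i, i) \<in> E t) \<and>
    (\<forall>t i j. if (j, i) \<in> E t then A t $ i $ j > 0 else A t $ i $ j = 0)"

definition mix :: "real ^ 'n ^ 'n \<Rightarrow> ('n::finite \<Rightarrow> 'b::real_vector) \<Rightarrow> 'n \<Rightarrow> 'b" where
  "mix M v i = (\<Sum>j\<in>UNIV. (M $ i $ j) *\<^sub>R v j)"

text \<open>\<open>closest_point\<close> is the Euclidean projection for the closed convex nonempty sets \<open>X i\<close>.\<close>

definition dopp_run ::
    "('n::finite \<Rightarrow> 'a::euclidean_space set) \<Rightarrow> ('n \<Rightarrow> 'a set) \<Rightarrow> ('n \<Rightarrow> 'a \<Rightarrow> real) \<Rightarrow>
     ('n \<Rightarrow> 'a \<Rightarrow> real ^ 'm) \<Rightarrow> (nat \<Rightarrow> real ^ 'n ^ 'n) \<Rightarrow> (nat \<Rightarrow> real) \<Rightarrow> (nat \<Rightarrow> real) \<Rightarrow>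
     (nat \<Rightarrow> 'n \<Rightarrow> real) \<Rightarrow> (nat \<Rightarrow> 'n \<Rightarrow> 'a) \<Rightarrow> (nat \<Rightarrow> 'n \<Rightarrow> real ^ 'm) \<Rightarrow>
     (nat \<Rightarrow> 'n \<Rightarrow> real ^ 'm) \<Rightarrow> (nat \<Rightarrow> 'n \<Rightarrow> 'a) \<Rightarrow> bool" where
  "dopp_run V X f g A \<alpha> \<beta> w x \<mu> y s \<longleftrightarrow>
    (\<forall>i. w 0 i = 1 \<and> x 0 i \<in> X i \<and> \<mu> 0 i = 0 \<and> y 0 i = g i (x 0 i)) \<and>
    (\<forall>t i.
       w (Suc t) i = mix (A t) (w t) i \<and>
       (\<exists>u \<in> subdifferential (V i) (f i) (x t i). \<exists>G \<in> subdifferential_vec (V i) (g i) (x t i).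
          s (Suc t) i = u + (1 / w (Suc t) i) *\<^sub>R cols_mult G (mix (A t) (\<mu> t) i)) \<and>
       x (Suc t) i = closest_point (X i) (x t i - \<alpha> t *\<^sub>R s (Suc t) i) \<and>
       \<mu> (Suc t) i =
         pos_part (mix (A t) (\<mu> t) i
           + \<alpha> t *\<^sub>R ((1 / w (Suc t) i) *\<^sub>R mix (A t) (y t) i - \<beta> t *\<^sub>R mix (A t) (\<mu> t) i)) \<and>
       y (Suc t) i = mix (A t) (y t) i + g i (x (Suc t) i) - g i (x t i))"

definition alpha_step :: "nat \<Rightarrow> real" where
  "alpha_step t = (if t = 0 then 1 else 1 / sqrt (real t))"

definition beta_step :: "real \<Rightarrow> nat \<Rightarrow> real" where
  "beta_step \<kappa> t = (if t = 0 then 1 else 1 / real t powr \<kappa>)"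

definition time_average :: "(nat \<Rightarrow> 'n \<Rightarrow> 'b::real_vector) \<Rightarrow> nat \<Rightarrow> 'n \<Rightarrow> 'b" where
  "time_average x T i = (1 / real T) *\<^sub>R (\<Sum>t=1..T. x t i)"

definition cost_error ::
    "('n::finite \<Rightarrow> 'a \<Rightarrow> real) \<Rightarrow> (nat \<Rightarrow> 'n \<Rightarrow> 'a) \<Rightarrow> 'a ^ 'n \<Rightarrow> nat \<Rightarrow> real" where
  "cost_error f x xopt T = (1 / real T) * (\<Sum>t=1..T. \<Sum>i\<in>UNIV. f i (x t i)) - agent_sum f xopt"

text \<open>The order relations \<open>O\<^sub>+\<close>, \<open>O\<close> and \<open>\<Omega>\<close> between functions of \<open>T\<close>, non-asymptotic, for all
  \<open>T \<ge> T0\<close>. In \<open>bigOmega_from\<close> the comparison function may be negative.\<close>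

definition bigO_plus_from :: "nat \<Rightarrow> (nat \<Rightarrow> real) \<Rightarrow> (nat \<Rightarrow> real) \<Rightarrow> bool" where
  "bigO_plus_from T0 h1 h2 \<longleftrightarrow> (\<exists>C>0. \<forall>T\<ge>T0. h1 T \<le> C * h2 T)"

definition bigO_from :: "nat \<Rightarrow> (nat \<Rightarrow> real) \<Rightarrow> (nat \<Rightarrow> real) \<Rightarrow> bool" where
  "bigO_from T0 h1 h2 \<longleftrightarrow> (\<exists>C>0. \<forall>T\<ge>T0. \<bar>h1 T\<bar> \<le> C * h2 T)"

definition bigOmega_from :: "nat \<Rightarrow> (nat \<Rightarrow> real) \<Rightarrow> (nat \<Rightarrow> real) \<Rightarrow> bool" where
  "bigOmega_from T0 h1 h2 \<longleftrightarrow> (\<exists>C>0. \<forall>T\<ge>T0. h1 T \<ge> C * h2 T)"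

end

theory Submission
  imports Defs
begin

text \<open>
  Column-stochastic mixing makes \<open>z i / w i\<close> evolve by convex combinations, so the spread of these
  ratios contracts by a fixed factor over every \<open>N Q\<close> steps, and perturbations of size \<open>t powr (- c)\<close>
  leave a consensus error of the same order. This bounds \<open>y i / w i\<close>; then the regularization gives
  \<open>\<mu> i / w i = O(1 / \<beta> t)\<close> by induction, and the consensus errors are \<open>O(\<alpha> t)\<close> for \<open>\<mu>\<close> and
  \<open>O(\<alpha> t / \<beta> t)\<close> for \<open>y\<close>.

  With these errors, the run is a perturbed primal-dual gradient method for the regularized
  Lagrangian, driven by the average of the \<open>\<mu> i\<close>. Telescoping the distance to
  a feasible point and to a comparison multiplier \<open>\<theta> \<ge> 0\<close> with \<open>norm \<theta> = O(T powr \<kappa>)\<close> gives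
  \<open>F + \<theta> \<bullet> H - N/2 * (norm \<theta>)\<^sup>2 * (\<Sum>\<beta>) \<le> K * T powr (1/2 + 2 \<kappa>)\<close>, where \<open>F\<close> is the accumulated
  cost error and \<open>H\<close> the accumulated constraint value. The choice \<open>\<theta> = 0\<close> bounds \<open>F\<close> from above.
  The maximizing \<open>\<theta>\<close>, the positive part of \<open>H\<close> divided by \<open>N * (\<Sum>\<beta>)\<close>, together with
  \<open>F \<ge> - l \<bullet> H\<close> for a Lagrange multiplier \<open>l\<close> of the problem, is a quadratic inequality for the norm
  of the positive part of \<open>H\<close>.
\<close>

text \<open>No time-independent bound for the multipliers is derived; the estimates carry instead
  the factor \<open>p t = 1 / \<beta> t\<close>, the growth that the regularization permits.
  Circularity is avoided by the order of the bounds: boundedness of \<open>y i / w i\<close> uses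
  only that \<open>g i\<close> is bounded on \<open>X i\<close>; it bounds the multipliers, these
  bound subgradients and primal steps, and only then can the consensus estimate be applied to
  \<open>y\<close> a second time, now with a decaying perturbation. Dividing the one-step inequality
  by the step size makes the telescoping a weighted one. Its last weight \<open>sqrt T\<close>,
  times the squared multiplier scale \<open>(p T)^2\<close>, is the origin of the exponent
  \<open>1/2 + 2 * \<kappa>\<close>. The maximizing \<open>\<theta>\<close> has admissible norm
  because \<open>H\<close> grows at most linearly while the sum of the \<open>\<beta> t\<close> is
  at least \<open>T powr (1 - \<kappa>)\<close>. In the final quadratic inequality the linear
  coefficient yields \<open>T powr (1 - \<kappa>)\<close> and the constant term
  \<open>T powr (3/4 + \<kappa>/2)\<close>; these balance at \<open>\<kappa> = 1/6\<close>, the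
  boundary between the two regimes.\<close>

section \<open>Lagrange multipliers under Slater's condition\<close>

text \<open>For convex \<open>C\<close> this contains the relative interior. Unlike interior points relative to the
  ambient space, its points survive the passage to the sets \<open>{h \<le> 0}\<close> and \<open>{h = 0}\<close>, on which the
  induction over the constraints runs.\<close>

definition alg_core :: "'b::real_vector set \<Rightarrow> 'b set" where
  "alg_core C = {z \<in> C. \<forall>x\<in>C. \<exists>e>0. z + e *\<^sub>R (z - x) \<in> C}"

lemma alg_coreD:
  "z \<in> alg_core C \<Longrightarrow> x \<in> C \<Longrightarrow> \<exists>e>0. z + e *\<^sub>R (z - x) \<in> C"
  by (simp add: alg_core_def)

lemma rel_interior_subset_alg_core:
  fixes C :: "'b::euclidean_space set"
  assumes "convex C" "z \<in> rel_interior C"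
  shows "z \<in> alg_core C"
proof -
  have "C \<noteq> {}" using assms rel_interior_subset by blast
  then have *: "\<forall>x\<in>C. \<exists>e>1. (1 - e) *\<^sub>R x + e *\<^sub>R z \<in> C"
    using convex_rel_interior_iff[OF assms(1)] assms(2) by blast
  have "\<exists>e>0. z + e *\<^sub>R (z - x) \<in> C" if xC: "x \<in> C" for x
  proof -
    obtain e where "e > 1" "(1 - e) *\<^sub>R x + e *\<^sub>R z \<in> C" using bspec[OF * xC] by auto
    then show ?thesis by (intro exI[of _ "e - 1"]) (simp add: algebra_simps)
  qed
  then show ?thesis using assms rel_interior_subset by (auto simp: alg_core_def)
qed

text \<open>Averaging with the fixed point \<open>x1\<close> carries a prolongation past
  \<open>z\<close> to one past the midpoint. It serves to move the Slater point towards a point at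
  which a further constraint is strict.\<close>

lemma alg_core_midpoint:
  assumes C: "convex C" and z: "z \<in> alg_core C" and x1: "x1 \<in> C"
  shows "(1/2) *\<^sub>R z + (1/2) *\<^sub>R x1 \<in> alg_core C"
proof -
  let ?m = "(1/2) *\<^sub>R z + (1/2) *\<^sub>R x1"
  have zC: "z \<in> C" using z by (simp add: alg_core_def)
  have "\<exists>e>0. ?m + e *\<^sub>R (?m - x) \<in> C" if xC: "x \<in> C" for x
  proof -
    obtain d where d: "d > 0" "z + d *\<^sub>R (z - x) \<in> C"
      using alg_coreD[OF z xC] by auto
    \<comment> \<open>For weight \<open>q\<close> on the prolonged point and \<open>1 - q\<close> on
      \<open>x1\<close>, the coefficients of \<open>x\<close> and \<open>z\<close> require
      \<open>e = q * d\<close> and \<open>q * (1 + d) = (1 + e) / 2\<close>, hence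
      \<open>q = 1 / (2 + d)\<close>.\<close>
    define e where "e = d / (2 + d)"
    have e: "e > 0" "e * (2 + d) = d" using d by (auto simp: e_def)
    have p1: "(1/(2+d)) *\<^sub>R (z + d *\<^sub>R (z - x)) + (1 - 1/(2+d)) *\<^sub>R x1 \<in> C"
      using d x1 by (intro convexD[OF C]) auto
    have a: "1 / (2 + d) * (1 + d) = 1 / 2 + e * (1 / 2)"
      "1 / (2 + d) * d = e" "1 - 1 / (2 + d) = 1 / 2 + e * (1/2)"
      using d by (auto simp: e_def field_simps)
    have "(1/(2+d)) *\<^sub>R (z + d *\<^sub>R (z - x)) + (1 - 1/(2+d)) *\<^sub>R x1
      = (1 / (2 + d) * (1 + d)) *\<^sub>R z - (1 / (2 + d) * d) *\<^sub>R x + (1 - 1/(2+d)) *\<^sub>R x1"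
    proof -
      have "p *\<^sub>R (z + d *\<^sub>R (z - x)) = (p * (1 + d)) *\<^sub>R z - (p * d) *\<^sub>R x" for p
        by (simp add: algebra_simps)
      then show ?thesis by simp
    qed
    also have "\<dots> = ?m + e *\<^sub>R (?m - x)"
      unfolding a by (simp add: algebra_simps)
    finally show ?thesis using p1 e(1) by auto
  qed
  moreover have "?m \<in> C" using zC x1 by (intro convexD[OF C]) auto
  ultimately show ?thesis by (auto simp: alg_core_def)
qed

lemma convex_sublevel:
  assumes "convex_on C h"
  shows "convex {x \<in> C. h x \<le> (c::real)}"
proof (rule convexI)
  fix x y and u v :: real
  assume xy: "x \<in> {x \<in> C. h x \<le> c}" "y \<in> {x \<in> C. h x \<le> c}" and uv: "0 \<le> u" "0 \<le> v" "u + v = 1"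
  have "h (u *\<^sub>R x + v *\<^sub>R y) \<le> u * h x + v * h y"
    using assms xy uv by (auto simp: convex_on_def)
  also have "\<dots> \<le> u * c + v * c" using xy uv by (intro add_mono mult_left_mono) auto
  also have "\<dots> = c" using uv by (simp flip: distrib_right)
  finally show "u *\<^sub>R x + v *\<^sub>R y \<in> {x \<in> C. h x \<le> c}"
    using assms xy uv by (auto simp: convex_on_def convex_def)
qed

text \<open>The slack at \<open>z\<close> tolerates any value of \<open>h\<close> at the prolonged
  point once the step is shortened, because convexity bounds \<open>h\<close> by interpolation
  between the two values.\<close>

lemma alg_core_sublevel:
  assumes h: "convex_on C h" and z: "z \<in> alg_core C" "h z < (0::real)"
  shows "z \<in> alg_core {x \<in> C. h x \<le> 0}"
proof -
  have C: "convex C" using h by (simp add: convex_on_def)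
  have zC: "z \<in> C" using z by (simp add: alg_core_def)
  have "\<exists>e>0. z + e *\<^sub>R (z - x) \<in> {x \<in> C. h x \<le> 0}" if xC: "x \<in> C" for x
  proof -
    obtain d where d: "d > 0" "z + d *\<^sub>R (z - x) \<in> C"
      using alg_coreD[OF z(1) xC] by auto
    let ?y = "z + d *\<^sub>R (z - x)"
    \<comment> \<open>Zero of the interpolation between \<open>h z\<close> and the absolute value of
      \<open>h ?y\<close>; the absolute value keeps it in the interval from 0 to 1 whatever the sign
      of \<open>h ?y\<close>.\<close>
    define t where "t = (- h z) / (\<bar>h ?y\<bar> - h z)"
    have t: "0 < t" "t \<le> 1" using z(2) by (auto simp: t_def field_simps)
    have eq: "z + (t * d) *\<^sub>R (z - x) = (1 - t) *\<^sub>R z + t *\<^sub>R ?y"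
      by (simp add: algebra_simps)
    have "(1 - t) *\<^sub>R z + t *\<^sub>R ?y \<in> C"
      using t zC d by (intro convexD[OF C]) auto
    moreover have "h ((1 - t) *\<^sub>R z + t *\<^sub>R ?y) \<le> (1 - t) * h z + t * h ?y"
      using t zC d by (intro convex_onD[OF h]) auto
    moreover have "t * h ?y \<le> t * \<bar>h ?y\<bar>" using t by (intro mult_left_mono) auto
    moreover have "(1 - t) * h z + t * \<bar>h ?y\<bar> = 0"
    proof -
      have "t * (\<bar>h ?y\<bar> - h z) = - h z" using z(2) by (simp add: t_def)
      then show ?thesis by (simp add: algebra_simps)
    qed
    ultimately have "h ((1 - t) *\<^sub>R z + t *\<^sub>R ?y) \<le> 0"
      "(1 - t) *\<^sub>R z + t *\<^sub>R ?y \<in> C" by linarith+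
    then show ?thesis using t d unfolding eq[symmetric]
      by (intro exI[of _ "t * d"]) auto
  qed
  then show ?thesis using zC z(2) by (auto simp: alg_core_def)
qed

text \<open>An affine function vanishing at \<open>x\<close> and \<open>z\<close> vanishes on the
  line through them, so a prolongation inside \<open>C\<close> stays on the level set.\<close>

lemma alg_core_affine_level:
  fixes h :: "'b::euclidean_space \<Rightarrow> real"
  assumes h: "linear_constraint_on C h" and z: "z \<in> alg_core C" "h z = 0"
  shows "z \<in> alg_core {x \<in> C. h x = 0}"
proof -
  obtain c b where cb: "\<And>x. x \<in> C \<Longrightarrow> h x = c \<bullet> x + b"
    using h by (auto simp: linear_constraint_on_def)
  have zC: "z \<in> C" using z by (simp add: alg_core_def)
  have "\<exists>e>0. z + e *\<^sub>R (z - x) \<in> {x \<in> C. h x = 0}" if xC: "x \<in> C" "h x = 0" for x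
  proof -
    obtain d where d: "d > 0" "z + d *\<^sub>R (z - x) \<in> C"
      using alg_coreD[OF z(1) xC(1)] by auto
    have "h (z + d *\<^sub>R (z - x)) = h z + d * (h z - h x)"
      using cb[OF d(2)] cb[OF zC] cb[OF xC(1)] by (simp add: algebra_simps inner_simps)
    then show ?thesis using d xC z(2) by auto
  qed
  then show ?thesis using zC z(2) by (auto simp: alg_core_def)
qed

lemma linear_constraint_on_subset:
  "linear_constraint_on C h \<Longrightarrow> D \<subseteq> C \<Longrightarrow> linear_constraint_on D h"
  by (auto simp: linear_constraint_on_def)

text \<open>One-dimensional separation by completeness of the reals: a multiplier must lie below
  every ratio \<open>\<phi> x / (- h x)\<close> with \<open>h x < 0\<close> and above every
  \<open>- \<phi> y / h y\<close> with \<open>h y > 0\<close>. By \<open>cross\<close> the second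
  family lies below the first, so the infimum of the first works. The parameter \<open>L\<close>
  passes on a sign (\<open>L = 0\<close>) or, for an equality constraint, mere boundedness from
  below.\<close>

lemma multiplier_of_crossing:
  fixes \<phi> h :: "'b \<Rightarrow> real"
  assumes cross: "\<And>x y. x \<in> C \<Longrightarrow> y \<in> C \<Longrightarrow> h x < 0 \<Longrightarrow> 0 < h y \<Longrightarrow> \<phi> y * h x \<le> \<phi> x * h y"
    and zero: "\<And>x. x \<in> C \<Longrightarrow> h x = 0 \<Longrightarrow> 0 \<le> \<phi> x"
    and x0: "x0 \<in> C" "h x0 < 0"
    and lower: "\<And>x. x \<in> C \<Longrightarrow> h x < 0 \<Longrightarrow> L \<le> \<phi> x / (- h x)"
  shows "\<exists>l\<ge>L. \<forall>x\<in>C. 0 \<le> \<phi> x + l * h x"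
proof -
  define R where "R = (\<lambda>x. \<phi> x / (- h x)) ` {x\<in>C. h x < 0}"
  have ne: "R \<noteq> {}" using x0 by (auto simp: R_def)
  have bdd: "bdd_below R" using lower by (auto simp: R_def intro!: bdd_belowI)
  have "0 \<le> \<phi> x + Inf R * h x" if x: "x \<in> C" for x
  proof -
    consider "h x < 0" | "h x = 0" | "h x > 0" by linarith
    then show ?thesis
    proof cases
      case 1
      then have "Inf R \<le> \<phi> x / (- h x)"
        using x bdd by (intro cInf_lower) (auto simp: R_def)
      moreover have "0 < - h x" using 1 by simp
      ultimately have "Inf R * (- h x) \<le> \<phi> x" by (simp only: pos_le_divide_eq)
      then show ?thesis by simp
    next
      case 2 then show ?thesis using zero x by simp
    next
      case 3
      have "- \<phi> x / h x \<le> Inf R"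
      proof (rule cInf_greatest[OF ne])
        fix r assume "r \<in> R"
        then obtain y where y: "y \<in> C" "h y < 0" "r = \<phi> y / (- h y)" by (auto simp: R_def)
        have "- \<phi> x * (- h y) \<le> \<phi> y * h x" using cross[OF y(1) x y(2) 3] by simp
        then have "- \<phi> x * (- h y) / h x \<le> \<phi> y" using 3 by (simp only: pos_divide_le_eq)
        then have "- \<phi> x / h x * (- h y) \<le> \<phi> y" by simp
        moreover have "0 < - h y" using y by simp
        ultimately show "- \<phi> x / h x \<le> r" unfolding y(3) by (simp only: pos_le_divide_eq)
      qed
      then have "- \<phi> x \<le> Inf R * h x" using 3 by (simp only: pos_divide_le_eq)
      then show ?thesis by simp
    qed
  qed
  moreover have "L \<le> Inf R" using ne lower by (intro cInf_greatest) (auto simp: R_def)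
  ultimately show ?thesis by blast
qed

text \<open>The weights are those for which the interpolation between \<open>h x\<close> and
  \<open>h y\<close> vanishes. Convexity of \<open>\<phi>\<close> at that point, multiplied by the
  positive \<open>h y - h x\<close>, is the claim.\<close>

lemma crossing_le:
  fixes \<phi> h :: "'b::real_vector \<Rightarrow> real"
  assumes \<phi>: "convex_on C \<phi>" and xy: "x \<in> C" "y \<in> C" "h x < 0" "0 < h y"
    and nonneg: "0 \<le> \<phi> ((h y / (h y - h x)) *\<^sub>R x + (- h x / (h y - h x)) *\<^sub>R y)"
  shows "\<phi> y * h x \<le> \<phi> x * h y"
proof -
  let ?d = "h y - h x"
  have d: "?d > 0" using xy by simp
  have sum1: "h y / ?d + (- h x / ?d) = 1" using d by (simp add: diff_divide_distrib[symmetric])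
  have "0 \<le> (h y / ?d) * \<phi> x + (- h x / ?d) * \<phi> y"
    using \<phi> xy d sum1 nonneg unfolding convex_on_def
    by (smt (verit, ccfv_threshold) divide_nonneg_nonneg)
  also have "\<dots> = (\<phi> x * h y - \<phi> y * h x) / ?d" by (simp add: diff_divide_distrib mult.commute)
  finally show ?thesis using d by (simp add: zero_le_divide_iff)
qed

text \<open>By convexity \<open>h\<close> is at most 0 at the crossing point, which yields the
  crossing inequality; on the strict side \<open>nonneg\<close> makes all ratios nonnegative, hence
  the sign of the multiplier.\<close>

lemma multiplier_single_strict:
  fixes \<phi> h :: "'b::real_vector \<Rightarrow> real"
  assumes \<phi>: "convex_on C \<phi>" and h: "convex_on C h"
    and nonneg: "\<And>x. x \<in> C \<Longrightarrow> h x \<le> 0 \<Longrightarrow> 0 \<le> \<phi> x"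
    and x0: "x0 \<in> C" "h x0 < 0"
  shows "\<exists>l\<ge>0. \<forall>x\<in>C. 0 \<le> \<phi> x + l * h x"
proof (rule multiplier_of_crossing[of C h \<phi> x0 0, OF _ _ x0])
  fix x y assume xy: "x \<in> C" "y \<in> C" "h x < 0" "0 < h y"
  let ?d = "h y - h x"
  let ?z = "(h y / ?d) *\<^sub>R x + (- h x / ?d) *\<^sub>R y"
  have d: "?d > 0" using xy by simp
  have co: "h y / ?d \<ge> 0" "- h x / ?d \<ge> 0" "h y / ?d + (- h x / ?d) = 1"
    using xy d by (auto simp: diff_divide_distrib[symmetric] divide_nonpos_pos)
  have "?z \<in> C" using h xy co unfolding convex_on_def convex_def by blast
  moreover have "h ?z \<le> (h y / ?d) * h x + (- h x / ?d) * h y"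
    using h xy co unfolding convex_on_def by blast
  moreover have "(h y / ?d) * h x + (- h x / ?d) * h y = 0" by simp
  ultimately have "0 \<le> \<phi> ?z" using nonneg by simp
  then show "\<phi> y * h x \<le> \<phi> x * h y" by (intro crossing_le[OF \<phi> xy])
qed (use nonneg in \<open>auto intro!: divide_nonneg_neg simp: less_imp_le divide_nonneg_neg\<close>)

text \<open>The sign of the multiplier is free, and no sign of the ratios is at hand to bound them
  below. If \<open>h\<close> is not identically 0 on \<open>C\<close>, prolonging past the core
  point \<open>z\<close> reverses the sign of \<open>h\<close>; so both signs occur, and a single
  \<open>q\<close> with \<open>h q > 0\<close> bounds all ratios.\<close>

lemma multiplier_single_equality:
  fixes \<phi> h :: "'b::euclidean_space \<Rightarrow> real"
  assumes \<phi>: "convex_on C \<phi>" and h: "linear_constraint_on C h"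
    and nonneg: "\<And>x. x \<in> C \<Longrightarrow> h x = 0 \<Longrightarrow> 0 \<le> \<phi> x"
    and z: "z \<in> alg_core C" "h z = 0"
  shows "\<exists>l. \<forall>x\<in>C. 0 \<le> \<phi> x + l * h x"
proof (cases "\<forall>x\<in>C. h x = 0")
  case True
  then show ?thesis using nonneg by (intro exI[of _ 0]) auto
next
  case False
  have C: "convex C" using \<phi> by (simp add: convex_on_def)
  obtain c b where cb: "\<And>x. x \<in> C \<Longrightarrow> h x = c \<bullet> x + b"
    using h by (auto simp: linear_constraint_on_def)
  have zC: "z \<in> C" using z by (simp add: alg_core_def)
  obtain x1 where x1: "x1 \<in> C" "h x1 \<noteq> 0" using False by blast
  obtain d where d: "d > 0" "z + d *\<^sub>R (z - x1) \<in> C"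
    using alg_coreD[OF z(1) x1(1)] by auto
  have "h (z + d *\<^sub>R (z - x1)) = h z + d * (h z - h x1)"
    using cb[OF d(2)] cb[OF zC] cb[OF x1(1)] by (simp add: algebra_simps inner_simps)
  then have hz: "h (z + d *\<^sub>R (z - x1)) = - d * h x1" using z(2) by simp
  have "\<exists>p q. p \<in> C \<and> q \<in> C \<and> h p < 0 \<and> 0 < h q"
  proof (cases "h x1 < 0")
    case True then show ?thesis using x1 d hz by (metis mult_neg_neg neg_less_0_iff_less)
  next
    case False then show ?thesis using x1 d hz
      by (metis linorder_neqE_linordered_idom mult_neg_pos neg_less_0_iff_less)
  qed
  then obtain p q where pq: "p \<in> C" "q \<in> C" "h p < 0" "0 < h q" by blast
  have cross: "\<phi> y * h x \<le> \<phi> x * h y" if xy: "x \<in> C" "y \<in> C" "h x < 0" "0 < h y" for x y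
  proof -
    let ?d = "h y - h x"
    let ?z = "(h y / ?d) *\<^sub>R x + (- h x / ?d) *\<^sub>R y"
    have d: "?d > 0" using xy by simp
    have co: "h y / ?d \<ge> 0" "- h x / ?d \<ge> 0" "h y / ?d + (- h x / ?d) = 1"
      using xy d by (auto simp: diff_divide_distrib[symmetric] divide_nonpos_pos)
    have zin: "?z \<in> C" using C xy co unfolding convex_def by blast
    have "h ?z = (h y / ?d) * (c \<bullet> x) + (- h x / ?d) * (c \<bullet> y) + b"
      using cb[OF zin] by (simp add: inner_simps)
    also have "\<dots> = (h y / ?d) * (c \<bullet> x + b) + (- h x / ?d) * (c \<bullet> y + b)"
    proof -
      have "(h y / ?d) * b + (- h x / ?d) * b = b"
        using co(3) by (metis distrib_right mult_1)
      then show ?thesis unfolding distrib_left by linarith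
    qed
    also have "\<dots> = (h y / ?d) * h x + (- h x / ?d) * h y" using cb xy by simp
    also have "\<dots> = 0" by simp
    finally have "0 \<le> \<phi> ?z" using nonneg zin by simp
    then show ?thesis by (intro crossing_le[OF \<phi> xy])
  qed
  have "- \<phi> q / h q \<le> \<phi> x / (- h x)" if "x \<in> C" "h x < 0" for x
    using cross[OF that(1) pq(2) that(2) pq(4)] that pq by (simp add: field_simps)
  then show ?thesis
    using multiplier_of_crossing[of C h \<phi> p "- \<phi> q / h q", OF cross nonneg pq(1,3)] by blast
qed

text \<open>Induction on the number of constraints: one of them is moved into the domain, and its
  multiplier is recovered by a one-constraint lemma. A constraint that is strict at some feasible
  point becomes \<open>h k \<le> 0\<close>. If there is none, all constraints vanish on the feasible
  set, hence are affine by the Slater alternative, and one becomes \<open>h k = 0\<close>; its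
  multiplier may have the wrong sign, which is repaired at the end. Domain, objective and Slater
  point all change on the way, so the induction generalizes over them.\<close>

lemma lagrange_multipliers_exist:
  fixes h :: "'k \<Rightarrow> 'b::euclidean_space \<Rightarrow> real"
  assumes "finite K" "z \<in> alg_core C" "convex_on C \<phi>" "\<And>k. k \<in> K \<Longrightarrow> convex_on C (h k)"
    and "\<And>k. k \<in> K \<Longrightarrow> h k z < 0 \<or> linear_constraint_on C (h k) \<and> h k z \<le> 0"
    and "\<And>x. x \<in> C \<Longrightarrow> (\<And>k. k \<in> K \<Longrightarrow> h k x \<le> 0) \<Longrightarrow> 0 \<le> \<phi> x"
  shows "\<exists>l. (\<forall>k\<in>K. 0 \<le> l k) \<and> (\<forall>x\<in>C. 0 \<le> \<phi> x + (\<Sum>k\<in>K. l k * h k x))"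
  using assms
proof (induction "card K" arbitrary: K C \<phi> z)
  case 0
  then show ?case by simp
next
  case (Suc n)
  note fin = Suc.prems(1) and z = Suc.prems(2) and \<phi> = Suc.prems(3) and hc = Suc.prems(4)
    and hz = Suc.prems(5) and nonneg = Suc.prems(6)
  have zC: "z \<in> C" using z by (simp add: alg_core_def)
  have C: "convex C" using \<phi> by (simp add: convex_on_def)
  have card: "n = card (K - {k})" if "k \<in> K" for k using that Suc.hyps(2) fin by simp
  have extend: "\<exists>l. (\<forall>k\<in>K. 0 \<le> l k) \<and> (\<forall>x\<in>C. 0 \<le> \<phi> x + (\<Sum>k\<in>K. l k * h k x))"
    if k: "k \<in> K" and l: "\<And>j. j \<in> K - {k} \<Longrightarrow> 0 \<le> l j" "0 \<le> e"
      "\<And>x. x \<in> C \<Longrightarrow> 0 \<le> \<phi> x + (\<Sum>j\<in>K - {k}. l j * h j x) + e * h k x" for k l e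
  proof (intro exI conjI ballI)
    fix x assume x: "x \<in> C"
    have "(\<Sum>j\<in>K. (l(k := e)) j * h j x) = e * h k x + (\<Sum>j\<in>K - {k}. (l(k := e)) j * h j x)"
      using fin k by (subst sum.remove[of _ k]) auto
    also have "(\<Sum>j\<in>K - {k}. (l(k := e)) j * h j x) = (\<Sum>j\<in>K - {k}. l j * h j x)"
      by (intro sum.cong) auto
    finally show "0 \<le> \<phi> x + (\<Sum>j\<in>K. (l(k := e)) j * h j x)" using l(3)[OF x] by simp
  qed (use l in auto)
  have conv: "convex_on D (\<lambda>x. \<phi> x + (\<Sum>j\<in>J. l j * h j x))"
    if "D \<subseteq> C" "convex D" "J \<subseteq> K" "\<And>j. j \<in> J \<Longrightarrow> 0 \<le> l j" for D J and l :: "'k \<Rightarrow> real"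
  proof -
    have "finite J" using fin that(3) by (rule finite_subset[rotated])
    then have "convex_on D (\<lambda>x. \<Sum>j\<in>J. l j * h j x)"
      using that(3,4)
    proof (induction J rule: finite_induct)
      case empty then show ?case using that by (simp add: convex_on_def)
    next
      case (insert j J)
      have "j \<in> K" using insert.prems by simp
      then have "convex_on D (h j)"
        by (rule convex_on_subset[OF hc that(1,2)])
      then have "convex_on D (\<lambda>x. l j * h j x)"
        using insert.prems by (intro convex_on_cmul) auto
      moreover have "convex_on D (\<lambda>x. \<Sum>j\<in>J. l j * h j x)"
        using insert.IH insert.prems by simp
      ultimately show ?case using insert.hyps by (simp add: convex_on_add)
    qed
    then show ?thesis using \<phi> that by (auto intro!: convex_on_add intro: convex_on_subset)
  qed
  show ?case
  proof (cases "\<exists>x1\<in>C. (\<forall>j\<in>K. h j x1 \<le> 0) \<and> (\<exists>k\<in>K. h k x1 < 0)")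
    case True
    then obtain x1 k where x1: "x1 \<in> C" "\<And>j. j \<in> K \<Longrightarrow> h j x1 \<le> 0" and k: "k \<in> K" "h k x1 < 0"
      by blast
    \<comment> \<open>The midpoint takes strictness of \<open>h k\<close> from \<open>x1\<close> and
      retains, for every other constraint, the strictness that \<open>z\<close> has.\<close>
    define z' where "z' = (1/2) *\<^sub>R z + (1/2) *\<^sub>R x1"
    have z': "z' \<in> alg_core C" unfolding z'_def by (rule alg_core_midpoint[OF C z x1(1)])
    have hmid: "h j z' \<le> (1/2) * h j z + (1/2) * h j x1" if "j \<in> K" for j
      unfolding z'_def using convex_onD[OF hc[OF that], of "1/2" z x1] zC x1 by simp
    have hz'k: "h k z' < 0" using hmid[OF k(1)] hz[OF k(1)] k(2) by auto
    define D where "D = {x \<in> C. h k x \<le> 0}"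
    have D: "convex D" "D \<subseteq> C"
      unfolding D_def by (auto intro: convex_sublevel[OF hc[OF k(1)]])
    have "\<exists>l. (\<forall>j\<in>K - {k}. 0 \<le> l j) \<and> (\<forall>x\<in>D. 0 \<le> \<phi> x + (\<Sum>j\<in>K - {k}. l j * h j x))"
    proof (rule Suc.hyps(1)[OF card[OF k(1)]])
      show "z' \<in> alg_core D" unfolding D_def by (rule alg_core_sublevel[OF hc[OF k(1)] z' hz'k])
      show "convex_on D \<phi>" "\<And>j. j \<in> K - {k} \<Longrightarrow> convex_on D (h j)"
        using D \<phi> hc by (auto intro: convex_on_subset)
      show "h j z' < 0 \<or> linear_constraint_on D (h j) \<and> h j z' \<le> 0" if "j \<in> K - {k}" for j
      proof -
        have j: "j \<in> K" using that by simp
        show ?thesis using hz[OF j] hmid[OF j] x1(2)[OF j] linear_constraint_on_subset[OF _ D(2)]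
          by fastforce
      qed
      show "0 \<le> \<phi> x" if "x \<in> D" "\<And>j. j \<in> K - {k} \<Longrightarrow> h j x \<le> 0" for x
        using that nonneg unfolding D_def by blast
    qed (use fin in simp)
    then obtain l where l: "\<And>j. j \<in> K - {k} \<Longrightarrow> 0 \<le> l j"
      "\<And>x. x \<in> D \<Longrightarrow> 0 \<le> \<phi> x + (\<Sum>j\<in>K - {k}. l j * h j x)" by blast
    have "\<exists>e\<ge>0. \<forall>x\<in>C. 0 \<le> \<phi> x + (\<Sum>j\<in>K - {k}. l j * h j x) + e * h k x"
      using z' hz'k l C by (intro multiplier_single_strict[OF conv hc[OF k(1)]])
        (auto simp: D_def alg_core_def)
    then show ?thesis using extend[OF k(1)] l(1) by blast
  next
    case False
    then have all0: "h k x = 0" if "x \<in> C" "\<And>j. j \<in> K \<Longrightarrow> h j x \<le> 0" "k \<in> K" for x k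
      using that by force
    have hz0: "h k z = 0" if "k \<in> K" for k
      using all0[OF zC _ that] hz by force
    \<comment> \<open>A constraint that vanishes at the Slater point falls under the affine
      alternative.\<close>
    have lin: "linear_constraint_on C (h k)" if "k \<in> K" for k
      using hz[OF that] hz0[OF that] by simp
    obtain k where k: "k \<in> K" using Suc.hyps(2) by fastforce
    define D where "D = {x \<in> C. h k x = 0}"
    obtain c b where cb: "\<And>x. x \<in> C \<Longrightarrow> h k x = c \<bullet> x + b"
      using lin[OF k] by (auto simp: linear_constraint_on_def)
    have "D = C \<inter> {x. c \<bullet> x = - b}" using cb unfolding D_def by fastforce
    then have D: "convex D" "D \<subseteq> C" using C by (auto intro: convex_Int convex_hyperplane)
    have "\<exists>l. (\<forall>j\<in>K - {k}. 0 \<le> l j) \<and> (\<forall>x\<in>D. 0 \<le> \<phi> x + (\<Sum>j\<in>K - {k}. l j * h j x))"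
    proof (rule Suc.hyps(1)[OF card[OF k]])
      show "z \<in> alg_core D" unfolding D_def by (rule alg_core_affine_level[OF lin[OF k] z hz0[OF k]])
      show "convex_on D \<phi>" "\<And>j. j \<in> K - {k} \<Longrightarrow> convex_on D (h j)"
        using D \<phi> hc by (auto intro: convex_on_subset)
      show "h j z < 0 \<or> linear_constraint_on D (h j) \<and> h j z \<le> 0" if "j \<in> K - {k}" for j
        using that hz0 lin linear_constraint_on_subset[OF _ D(2)] by simp
      show "0 \<le> \<phi> x" if "x \<in> D" "\<And>j. j \<in> K - {k} \<Longrightarrow> h j x \<le> 0" for x
        using that nonneg unfolding D_def by (metis (mono_tags, lifting) DiffI mem_Collect_eq order_refl singletonD)
    qed (use fin in simp)
    then obtain l where l: "\<And>j. j \<in> K - {k} \<Longrightarrow> 0 \<le> l j"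
      "\<And>x. x \<in> D \<Longrightarrow> 0 \<le> \<phi> x + (\<Sum>j\<in>K - {k}. l j * h j x)" by blast
    have "\<exists>e. \<forall>x\<in>C. 0 \<le> \<phi> x + (\<Sum>j\<in>K - {k}. l j * h j x) + e * h k x"
      using l C by (intro multiplier_single_equality[OF conv lin[OF k] _ z hz0[OF k]])
        (auto simp: D_def)
    then obtain e where e: "\<And>x. x \<in> C \<Longrightarrow> 0 \<le> \<phi> x + (\<Sum>j\<in>K - {k}. l j * h j x) + e * h k x"
      by blast
    show ?thesis
    proof (cases "0 \<le> e")
      case True then show ?thesis using extend[OF k] l(1) e by blast
    next
      case False
      \<comment> \<open>\<open>h k\<close> cannot be negative where the other constraints hold, so by the induction hypothesis
        \<open>- h k\<close> is dominated by a nonnegative combination of them.\<close>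
      have "\<exists>q. (\<forall>j\<in>K - {k}. 0 \<le> q j) \<and> (\<forall>x\<in>C. 0 \<le> h k x + (\<Sum>j\<in>K - {k}. q j * h j x))"
      proof (rule Suc.hyps(1)[OF card[OF k] _ z])
        show "convex_on C (h k)" "\<And>j. j \<in> K - {k} \<Longrightarrow> convex_on C (h j)" using hc k by auto
        show "h j z < 0 \<or> linear_constraint_on C (h j) \<and> h j z \<le> 0" if "j \<in> K - {k}" for j
          using that hz by simp
        show "0 \<le> h k x" if "x \<in> C" "\<And>j. j \<in> K - {k} \<Longrightarrow> h j x \<le> 0" for x
        proof (rule ccontr)
          assume "\<not> 0 \<le> h k x"
          then have "h k x = 0" using that k by (intro all0) (auto, metis DiffI linear not_le singletonD)
          then show False using \<open>\<not> 0 \<le> h k x\<close> by simp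
        qed
      qed (use fin in simp)
      then obtain q where q: "\<And>j. j \<in> K - {k} \<Longrightarrow> 0 \<le> q j"
        "\<And>x. x \<in> C \<Longrightarrow> 0 \<le> h k x + (\<Sum>j\<in>K - {k}. q j * h j x)" by blast
      have "0 \<le> \<phi> x + (\<Sum>j\<in>K - {k}. (l j + (- e) * q j) * h j x) + 0 * h k x" if "x \<in> C" for x
      proof -
        have "0 \<le> (- e) * (h k x + (\<Sum>j\<in>K - {k}. q j * h j x))"
          using False q(2)[OF that] by (intro mult_nonneg_nonneg) auto
        also have "\<dots> = - e * h k x + (\<Sum>j\<in>K - {k}. (- e) * q j * h j x)"
          by (simp add: distrib_left sum_distrib_left mult.assoc)
        finally have "0 \<le> - e * h k x + (\<Sum>j\<in>K - {k}. (- e) * q j * h j x)" .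
        moreover have "(\<Sum>j\<in>K - {k}. (l j + (- e) * q j) * h j x)
            = (\<Sum>j\<in>K - {k}. l j * h j x) + (\<Sum>j\<in>K - {k}. (- e) * q j * h j x)"
          unfolding distrib_right sum.distrib ..
        ultimately show ?thesis using e[OF that] by linarith
      qed
      moreover have "0 \<le> l j + (- e) * q j" if "j \<in> K - {k}" for j
        using l(1)[OF that] q(1)[OF that] False mult_nonneg_nonneg[of "- e" "q j"] by simp
      ultimately show ?thesis using extend[OF k, of "\<lambda>j. l j + (- e) * q j" 0] by blast
    qed
  qed
qed

section \<open>The multiplier of the network problem\<close>

lemma convex_on_sum_fun:
  assumes "finite I" "convex C" "\<And>i. i \<in> I \<Longrightarrow> convex_on C (F i)"
  shows "convex_on C (\<lambda>z. \<Sum>i\<in>I. F i z)"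
  using assms(1,3) by (induction I rule: finite_induct) (auto simp: convex_on_const assms(2) intro!: convex_on_add)

lemma convex_prod_set: "(\<And>i. convex (S i)) \<Longrightarrow> convex (prod_set S)"
  unfolding prod_set_def convex_def by simp

lemma convex_on_agent_sum:
  fixes F :: "'n::finite \<Rightarrow> 'a::euclidean_space \<Rightarrow> real"
  assumes "\<And>i. convex_on (S i) (F i)"
  shows "convex_on (prod_set S) (agent_sum F)"
proof -
  have cv: "convex (prod_set S)" using assms by (intro convex_prod_set) (simp add: convex_on_def)
  have "convex_on (prod_set S) (\<lambda>z. F i (z $ i))" for i
    using assms[of i] cv unfolding convex_on_def prod_set_def by simp
  then show ?thesis unfolding agent_sum_def using cv by (intro convex_on_sum_fun) auto
qed

lemma agent_sum_component: "agent_sum g z $ k = agent_sum (\<lambda>i x. g i x $ k) z"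
  by (simp add: agent_sum_def)

text \<open>The general result for the objective \<open>agent_sum f - b\<close> on
  \<open>prod_set X\<close>. Affinity of a constraint, known on \<open>prod_set V\<close>, is
  inherited by the smaller set.\<close>

lemma slater_multiplier:
  fixes V X :: "'n::finite \<Rightarrow> 'a::euclidean_space set" and g :: "'n \<Rightarrow> 'a \<Rightarrow> real ^ 'm::finite"
  assumes sub: "\<And>i. X i \<subseteq> V i" and X: "\<And>i. convex (X i)"
    and f: "\<And>i. convex_on (V i) (f i)" and g: "\<And>i k. convex_on (V i) (\<lambda>z. g i z $ k)"
    and slater: "slater V X g"
    and lower: "\<And>z. z \<in> feasible_set X g \<Longrightarrow> b \<le> agent_sum f z"
  obtains l :: "real ^ 'm" where "\<And>k. 0 \<le> l $ k"
    "\<And>z. z \<in> prod_set X \<Longrightarrow> b \<le> agent_sum f z + l \<bullet> agent_sum g z"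
proof -
  let ?h = "\<lambda>k z. agent_sum g z $ k"
  have cX: "convex (prod_set X)" using X by (rule convex_prod_set)
  have sub': "prod_set X \<subseteq> prod_set V" using sub by (auto simp: prod_set_def)
  obtain z where z: "z \<in> rel_interior (prod_set X)"
    and hz: "\<And>k. if linear_constraint_on (prod_set V) (?h k) then ?h k z \<le> 0 else ?h k z < 0"
    using slater unfolding slater_def by auto
  have "\<exists>l. (\<forall>k\<in>UNIV. 0 \<le> l k) \<and>
      (\<forall>x\<in>prod_set X. 0 \<le> (agent_sum f x + - b) + (\<Sum>k\<in>UNIV. l k * ?h k x))"
  proof (rule lagrange_multipliers_exist)
    show "z \<in> alg_core (prod_set X)" by (rule rel_interior_subset_alg_core[OF cX z])
    show "convex_on (prod_set X) (\<lambda>x. agent_sum f x + - b)"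
      using convex_on_subset[OF f sub X] cX
      by (intro convex_on_add convex_on_agent_sum) (auto simp: convex_on_const)
    show "convex_on (prod_set X) (?h k)" for k
      unfolding agent_sum_component using convex_on_subset[OF g sub X] by (intro convex_on_agent_sum)
    show "?h k z < 0 \<or> linear_constraint_on (prod_set X) (?h k) \<and> ?h k z \<le> 0" for k
      using hz[of k] linear_constraint_on_subset[OF _ sub'] by (auto split: if_splits)
    show "0 \<le> agent_sum f x + - b" if "x \<in> prod_set X" "\<And>k. k \<in> UNIV \<Longrightarrow> ?h k x \<le> 0" for x
      using that lower[of x] by (simp add: feasible_set_def less_eq_vec_def)
  qed simp
  then obtain l where l: "\<And>k. 0 \<le> l k"
    "\<And>x. x \<in> prod_set X \<Longrightarrow> 0 \<le> (agent_sum f x + - b) + (\<Sum>k\<in>UNIV. l k * ?h k x)" by auto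
  have "b \<le> agent_sum f x + (\<chi> k. l k) \<bullet> agent_sum g x" if "x \<in> prod_set X" for x
    using l(2)[OF that] by (simp add: inner_vec_def)
  then show ?thesis using l(1) by (intro that[of "\<chi> k. l k"]) auto
qed

section \<open>Push-sum consensus\<close>

lemma mix_add: "mix M (\<lambda>j. u j + v j) i = mix M u i + mix M v i"
  by (simp add: mix_def scaleR_right_distrib sum.distrib)

lemma mix_diff: "mix M (\<lambda>j. u j - v j) i = mix M u i - mix M v i"
  by (simp add: mix_def scaleR_right_diff_distrib sum_subtractf)

lemma mix_scale: "mix M (\<lambda>j. c *\<^sub>R v j) i = c *\<^sub>R mix M v i"
  by (simp add: mix_def scaleR_sum_right mult.commute)

lemma mix_real_scale: "mix M (\<lambda>j. c * v j :: real) i = c * mix M v i"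
  using mix_scale[of M c v i] by simp

lemma mix_component: "mix M v i $ k = mix M (\<lambda>j. v j $ k) i"
  by (simp add: mix_def)

lemma mix_mono:
  fixes u v :: "'n::finite \<Rightarrow> real"
  shows "(\<And>j. 0 \<le> M $ i $ j) \<Longrightarrow> (\<And>j. u j \<le> v j) \<Longrightarrow> mix M u i \<le> mix M v i"
  unfolding mix_def by (intro sum_mono) (simp add: mult_left_mono)

lemma norm_mix_le:
  "(\<And>j. 0 \<le> M $ i $ j) \<Longrightarrow> norm (mix M v i) \<le> mix M (\<lambda>j. norm (v j)) i"
  unfolding mix_def by (intro order_trans[OF norm_sum] sum_mono) auto

lemma sum_mix:
  assumes "\<And>j. (\<Sum>i\<in>UNIV. M $ i $ j) = 1"
  shows "(\<Sum>i\<in>UNIV. mix M v i) = (\<Sum>j\<in>UNIV. v j)"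
proof -
  have "(\<Sum>i\<in>UNIV. mix M v i) = (\<Sum>j\<in>UNIV. \<Sum>i\<in>UNIV. M $ i $ j *\<^sub>R v j)"
    unfolding mix_def by (rule sum.swap)
  also have "\<dots> = (\<Sum>j\<in>UNIV. (\<Sum>i\<in>UNIV. M $ i $ j) *\<^sub>R v j)" by (simp add: scaleR_sum_left)
  finally show ?thesis using assms by simp
qed

locale push_sum =
  fixes E :: "nat \<Rightarrow> ('n::finite \<times> 'n) set"
    and A :: "nat \<Rightarrow> real ^ 'n ^ 'n" and a :: real and Q :: nat
    and w :: "nat \<Rightarrow> 'n \<Rightarrow> real"
  assumes graph: "adjacency_matrices E A"
    and a_bounds: "0 < a" "a < 1"
    and edge_weight: "\<And>t i j. A t $ i $ j > 0 \<Longrightarrow> A t $ i $ j \<ge> a"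
    and column_sum: "\<And>t j. (\<Sum>i\<in>UNIV. A t $ i $ j) = 1"
    and Q_pos: "Q > 0"
    and connected: "\<And>t. t \<ge> 1 \<Longrightarrow> strongly_connected (\<Union>l\<in>{0..Q - 1}. E (t + l))"
    and w_0: "\<And>i. w 0 i = 1"
    and w_Suc: "\<And>t i. w (Suc t) i = mix (A t) (w t) i"
begin

lemma N_ge_1: "1 \<le> real CARD('n)"
  using zero_less_card_finite[where 'a='n] by linarith

lemma self_loop: "(i, i) \<in> E t"
  and edge_pos: "(j, i) \<in> E t \<Longrightarrow> A t $ i $ j > 0"
  and no_edge: "(j, i) \<notin> E t \<Longrightarrow> A t $ i $ j = 0"
  using graph unfolding adjacency_matrices_def by metis+

lemma A_nonneg: "0 \<le> A t $ i $ j"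
  using edge_pos[of j i t] no_edge[of j i t] by (cases "(j, i) \<in> E t") auto

lemmas sum_mix_A = sum_mix[OF column_sum]

lemma mix_nonneg: "(\<And>j. 0 \<le> v j) \<Longrightarrow> 0 \<le> mix (A t) v i" for v :: "'n \<Rightarrow> real"
  by (simp add: mix_def A_nonneg sum_nonneg)

lemma mix_edge_ge:
  fixes v :: "'n \<Rightarrow> real"
  assumes "\<And>j. 0 \<le> v j" "(j, i) \<in> E t"
  shows "a * v j \<le> mix (A t) v i"
proof -
  have "a * v j \<le> A t $ i $ j * v j"
    using edge_weight[OF edge_pos[OF assms(2)]] assms(1) by (intro mult_right_mono) auto
  also have "\<dots> \<le> (\<Sum>j\<in>UNIV. A t $ i $ j * v j)"
    using assms(1) by (intro member_le_sum) (auto simp: A_nonneg)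
  finally show ?thesis by (simp add: mix_def)
qed

section \<open>Reachability in the time-varying graph and positivity of the weights\<close>

primrec reach :: "nat \<Rightarrow> 'n \<Rightarrow> nat \<Rightarrow> 'n set" where
  "reach t j 0 = {j}"
| "reach t j (Suc k) = {i. \<exists>u\<in>reach t j k. (u, i) \<in> E (t + k)}"

text \<open>The unperturbed mixing iteration started at time \<open>t\<close>. It is linear and
  preserves nonnegativity, and \<open>w\<close> is one of its orbits; it is therefore applied to
  \<open>M * w - z\<close> and \<open>z - m * w\<close>.\<close>

primrec evolve :: "nat \<Rightarrow> ('n \<Rightarrow> real) \<Rightarrow> nat \<Rightarrow> 'n \<Rightarrow> real" where
  "evolve t v 0 = v"
| "evolve t v (Suc k) = mix (A (t + k)) (evolve t v k)"

lemma evolve_nonneg: "(\<And>j. 0 \<le> v j) \<Longrightarrow> 0 \<le> evolve t v k i"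
  by (induction k arbitrary: i) (auto intro: mix_nonneg)

text \<open>Along a path, each step keeps at least the fraction \<open>a\<close> of the mass;
  nonnegativity lets all other contributions be dropped.\<close>

lemma evolve_reach:
  assumes "\<And>j. 0 \<le> v j" "i \<in> reach t j k"
  shows "a ^ k * v j \<le> evolve t v k i"
  using assms(2)
proof (induction k arbitrary: i)
  case (Suc k)
  then obtain u where u: "u \<in> reach t j k" "(u, i) \<in> E (t + k)" by auto
  have "a ^ Suc k * v j \<le> a * evolve t v k u"
    using Suc.IH[OF u(1)] a_bounds by (simp add: mult.assoc)
  also have "\<dots> \<le> evolve t v (Suc k) i"
    using evolve_nonneg[OF assms(1)] u(2) by (auto intro: mix_edge_ge)
  finally show ?case .
qed simp

lemma evolve_linear:
  "evolve t (\<lambda>j. u j + c * v j) k = (\<lambda>i. evolve t u k i + c * evolve t v k i)"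
  by (induction k) (auto simp: mix_add mix_real_scale)

lemma evolve_scale: "evolve t (\<lambda>j. c * v j) k = (\<lambda>i. c * evolve t v k i)"
  by (induction k) (auto simp: mix_real_scale)

lemma evolve_w: "evolve t (w t) k = w (t + k)"
  by (induction k) (auto simp: w_Suc)

lemma reach_mono: "k \<le> l \<Longrightarrow> reach t j k \<subseteq> reach t j l"
  by (rule lift_Suc_mono_le[of "reach t j"]) (auto intro: self_loop)

text \<open>In the union graph of the next \<open>Q\<close> steps some edge leaves the reached set.
  It is present at one time of the window, and the self-loops keep its tail in the reached set until
  then and its head afterwards.\<close>

lemma reach_grows:
  assumes "t \<ge> 1" "reach t j k \<noteq> UNIV"
  shows "card (reach t j k) < card (reach t j (k + Q))"
proof -
  let ?U = "\<Union>l\<in>{0..Q - 1}. E (t + k + l)"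
  obtain v where v: "v \<notin> reach t j k" using assms by blast
  have j: "j \<in> reach t j k" using reach_mono[of 0 k t j] by simp
  have "(j, v) \<in> ?U\<^sup>*" using connected[of "t + k"] assms(1) by (simp add: strongly_connected_def)
  then have "\<exists>p q. p \<in> reach t j k \<and> q \<notin> reach t j k \<and> (p, q) \<in> ?U"
    using v
  proof (induction rule: rtrancl_induct)
    case base then show ?case using j by simp
  next
    case (step y z) then show ?case by blast
  qed
  then obtain p q l where pq: "p \<in> reach t j k" "q \<notin> reach t j k" "l \<le> Q - 1" "(p, q) \<in> E (t + k + l)"
    by auto
  have "p \<in> reach t j (k + l)" using pq(1) reach_mono[of k "k + l" t j] by auto
  then have "q \<in> reach t j (Suc (k + l))" using pq(4) by (auto simp: add.assoc)
  then have "q \<in> reach t j (k + Q)"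
    using reach_mono[of "Suc (k + l)" "k + Q" t j] pq(3) Q_pos by fastforce
  then have "reach t j k \<subset> reach t j (k + Q)"
    using pq(2) reach_mono[of k "k + Q" t j] by auto
  then show ?thesis by (intro psubset_card_mono) auto
qed

lemma B_pos: "(CARD('n) * Q) > 0"
  using Q_pos zero_less_card_finite[where 'a='n] by simp

text \<open>As long as it is not everything, the set has more than \<open>n\<close> elements after
  \<open>n\<close> windows, which is impossible for \<open>n = CARD('n)\<close>. This is the origin
  of the horizon \<open>CARD('n) * Q\<close>.\<close>

lemma reach_all:
  assumes "t \<ge> 1"
  shows "reach t j (CARD('n) * Q) = UNIV"
proof -
  have "reach t j (n * Q) = UNIV \<or> n < card (reach t j (n * Q))" for n
  proof (induction n)
    case (Suc n)
    show ?case
    proof (cases "reach t j (n * Q) = UNIV")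
      case True
      then show ?thesis using reach_mono[of "n * Q" "Suc n * Q" t j] by auto
    next
      case False
      then show ?thesis using Suc reach_grows[OF assms False] by (auto simp: add.commute)
    qed
  qed simp
  from this[of "CARD('n)"] show ?thesis
     by (metis card_mono finite_code not_le top_greatest)
qed

lemma w_sum: "(\<Sum>i\<in>UNIV. w t i) = real CARD('n)"
  by (induction t) (auto simp: w_0 w_Suc sum_mix_A)

lemma w_nonneg: "0 \<le> w t i"
  by (induction t arbitrary: i) (auto simp: w_0 w_Suc intro: mix_nonneg)

lemma w_le: "w t i \<le> real CARD('n)"
proof -
  have "w t i \<le> (\<Sum>i\<in>UNIV. w t i)" by (intro member_le_sum) (auto simp: w_nonneg)
  then show ?thesis by (simp add: w_sum)
qed

text \<open>At early times self-loops alone keep \<open>a ^ t\<close>. Later, the weights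
  \<open>CARD('n) * Q\<close> steps before average to 1, so some agent had weight at least 1, and
  its mass has reached everyone. The split reflects that connectivity is available only from time 1
  on.\<close>

lemma w_lower_bound: "a ^ (CARD('n) * Q + 1) \<le> w t i"
  (is "?r \<le> _")
proof (cases "t \<le> (CARD('n) * Q) + 1")
  case True
  have "i \<in> reach 0 i t" using reach_mono[of 0 t 0 i] by simp
  from evolve_reach[of "w 0", OF w_nonneg this]
  have "a ^ t \<le> w t i" by (simp add: evolve_w w_0)
  moreover have "?r \<le> a ^ t" using True a_bounds by (intro power_decreasing) auto
  ultimately show ?thesis by simp
next
  case False
  define t0 where "t0 = t - (CARD('n) * Q)"
  have t0: "t0 \<ge> 1" "t = t0 + (CARD('n) * Q)" using False by (auto simp: t0_def)
  have "\<exists>j. 1 \<le> w t0 j"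
  proof (rule ccontr)
    assume "\<nexists>j. 1 \<le> w t0 j"
    then have "(\<Sum>j\<in>UNIV. w t0 j) < (\<Sum>j\<in>(UNIV::'n set). 1)"
      by (intro sum_strict_mono) (auto simp: not_le)
    then show False by (simp add: w_sum)
  qed
  then obtain j where j: "1 \<le> w t0 j" by blast
  have "i \<in> reach t0 j (CARD('n) * Q)" using reach_all[OF t0(1)] by simp
  from evolve_reach[of "w t0", OF w_nonneg this]
  have "a ^ (CARD('n) * Q) * w t0 j \<le> w t i" by (simp add: evolve_w t0(2))
  moreover have "a ^ (CARD('n) * Q) * 1 \<le> a ^ (CARD('n) * Q) * w t0 j" using j a_bounds by (intro mult_left_mono) auto
  moreover have "?r \<le> a ^ (CARD('n) * Q)" using a_bounds by (intro power_decreasing) auto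
  ultimately show ?thesis by simp
qed

definition r :: real where "r = Inf (range (\<lambda>(t, i). w t i))"

lemma w_ge: "r \<le> w t i"
  unfolding r_def using w_nonneg by (intro cInf_lower bdd_belowI[of _ 0]) (auto intro!: image_eqI[of _ _ "(t, i)"])

lemma r_bounds: "0 < r" "r \<le> 1"
proof -
  have "a ^ (CARD('n) * Q + 1) \<le> r"
    unfolding r_def using w_lower_bound by (intro cInf_greatest) auto
  then show "0 < r" using a_bounds by (meson less_le_trans zero_less_power)
  show "r \<le> 1" using w_ge[of 0 undefined] by (simp add: w_0)
qed

lemma w_pos: "0 < w t i" using w_ge[of t i] r_bounds by linarith

section \<open>Contraction of the spread of the ratios under perturbations\<close>

lemma norm_ratio_mix_le:
  fixes v :: "'n \<Rightarrow> 'b::real_normed_vector"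
  assumes "\<And>j. norm (v j) \<le> c * w t j"
  shows "norm (mix (A t) v i) \<le> c * w (Suc t) i"
proof -
  have "norm (mix (A t) v i) \<le> mix (A t) (\<lambda>j. norm (v j)) i" by (rule norm_mix_le[OF A_nonneg])
  also have "\<dots> \<le> mix (A t) (\<lambda>j. c * w t j) i" using assms by (intro mix_mono A_nonneg)
  finally show ?thesis by (simp add: mix_real_scale w_Suc)
qed

definition osc :: "(nat \<Rightarrow> 'n \<Rightarrow> real) \<Rightarrow> nat \<Rightarrow> real" where
  "osc z t = Max (range (\<lambda>(i, j). z t i / w t i - z t j / w t j))"

lemma osc_ge: "z t i / w t i - z t j / w t j \<le> osc z t"
  unfolding osc_def by (rule Max_ge) (auto intro!: image_eqI[of _ _ "(i, j)"])

lemma osc_attained: "\<exists>i j. osc z t = z t i / w t i - z t j / w t j"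
proof -
  have "osc z t \<in> range (\<lambda>(i, j). z t i / w t i - z t j / w t j)"
    unfolding osc_def by (rule Max_in) auto
  then show ?thesis by auto
qed

lemma osc_nonneg: "0 \<le> osc z t"
  using osc_ge[of z t i i for i] by simp

text \<open>Unit column sums make mixing nonexpansive for the sum of absolute values over the
  agents, so deviations merely add up, by at most \<open>CARD('n) * p\<close> per step. The maximum
  over the agents could grow, since row sums are not controlled.\<close>

lemma evolve_perturbation:
  assumes "\<And>k i. k < n \<Longrightarrow> \<bar>z (Suc (t + k)) i - mix (A (t + k)) (z (t + k)) i\<bar> \<le> p"
  shows "(\<Sum>i\<in>UNIV. \<bar>z (t + n) i - evolve t (z t) n i\<bar>) \<le> real CARD('n) * real n * p"
  using assms
proof (induction n)
  case (Suc n)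
  have "\<bar>z (t + Suc n) i - evolve t (z t) (Suc n) i\<bar>
      \<le> p + mix (A (t + n)) (\<lambda>j. \<bar>z (t + n) j - evolve t (z t) n j\<bar>) i" for i
  proof -
    have "\<bar>mix (A (t + n)) (\<lambda>j. z (t + n) j - evolve t (z t) n j) i\<bar>
        \<le> mix (A (t + n)) (\<lambda>j. \<bar>z (t + n) j - evolve t (z t) n j\<bar>) i"
      using norm_mix_le[of "A (t + n)" i "\<lambda>j. z (t + n) j - evolve t (z t) n j"] A_nonneg by simp
    moreover have "\<bar>z (Suc (t + n)) i - mix (A (t + n)) (z (t + n)) i\<bar> \<le> p" using Suc.prems by simp
    ultimately show ?thesis unfolding mix_diff by simp
  qed
  then have "(\<Sum>i\<in>UNIV. \<bar>z (t + Suc n) i - evolve t (z t) (Suc n) i\<bar>)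
      \<le> (\<Sum>i\<in>UNIV. p + mix (A (t + n)) (\<lambda>j. \<bar>z (t + n) j - evolve t (z t) n j\<bar>) i)"
    by (intro sum_mono)
  also have "\<dots> = real CARD('n) * p + (\<Sum>i\<in>UNIV. \<bar>z (t + n) i - evolve t (z t) n i\<bar>)"
    by (simp add: sum.distrib sum_mix_A)
  also have "\<dots> \<le> real CARD('n) * p + real CARD('n) * real n * p" using Suc by simp
  finally show ?case by (simp add: algebra_simps)
qed simp

text \<open>Minorization argument. \<open>z - m * w\<close> is nonnegative and at least
  \<open>(M - m) * r\<close> at the maximizing agent \<open>i1\<close>; after the horizon the
  fraction \<open>a ^ (CARD('n) * Q)\<close> of it is present everywhere, and division by
  \<open>w \<le> CARD('n)\<close> gives the rise of the lower end. The upper end \<open>M\<close> is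
  preserved, and the perturbation shifts either end by at most \<open>?D / r\<close>.\<close>

lemma osc_contraction:
  assumes t: "t \<ge> 1"
    and p: "\<And>k i. k < (CARD('n) * Q) \<Longrightarrow> \<bar>z (Suc (t + k)) i - mix (A (t + k)) (z (t + k)) i\<bar> \<le> p"
  shows "osc z (t + CARD('n) * Q) \<le> (1 - a ^ (CARD('n) * Q) * r / real CARD('n)) * osc z t + 2 * (real CARD('n) * real (CARD('n) * Q) * p / r)"
proof -
  let ?D = "real CARD('n) * real (CARD('n) * Q) * p"
  obtain i1 i0 where osc: "osc z t = z t i1 / w t i1 - z t i0 / w t i0" using osc_attained by blast
  define M m where "M = z t i1 / w t i1" and "m = z t i0 / w t i0"
  have M: "z t j \<le> M * w t j" for j
    using osc_ge[of z t j i0] w_pos[of t j] by (simp add: osc M_def m_def pos_divide_le_eq)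
  have m: "m * w t j \<le> z t j" for j
    using osc_ge[of z t i1 j] w_pos[of t j] by (simp add: osc M_def m_def pos_le_divide_eq)
  have mM: "0 \<le> M - m" using osc_nonneg[of z t] by (simp add: osc M_def m_def)
  have D0: "0 \<le> ?D" using p[of 0] B_pos N_ge_1 by (metis abs_ge_zero add_increasing mult_nonneg_nonneg of_nat_0_le_iff order_trans)
  have dev: "\<bar>z (t + CARD('n) * Q) i - evolve t (z t) (CARD('n) * Q) i\<bar> \<le> ?D" for i
  proof -
    have "\<bar>z (t + CARD('n) * Q) i - evolve t (z t) (CARD('n) * Q) i\<bar> \<le> (\<Sum>i\<in>UNIV. \<bar>z (t + CARD('n) * Q) i - evolve t (z t) (CARD('n) * Q) i\<bar>)"
      by (intro member_le_sum) auto
    then show ?thesis using evolve_perturbation[of "CARD('n) * Q" z t p, OF p] by linarith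
  qed
  have wB: "r \<le> w (t + CARD('n) * Q) i" "0 < w (t + CARD('n) * Q) i" "w (t + CARD('n) * Q) i \<le> real CARD('n)" for i
    using w_ge w_pos w_le by auto
  have D_le: "?D \<le> (?D / r) * w (t + CARD('n) * Q) i" for i
    using mult_left_mono[OF wB(1)[of i], of "?D / r"] D0 r_bounds by simp
  have upper: "z (t + CARD('n) * Q) i / w (t + CARD('n) * Q) i \<le> M + ?D / r" for i
  proof -
    have "0 \<le> evolve t (\<lambda>j. M * w t j + (- 1) * z t j) (CARD('n) * Q) i" using M by (intro evolve_nonneg) simp
    moreover have "evolve t (\<lambda>j. M * w t j + (- 1) * z t j) (CARD('n) * Q) i
        = M * w (t + CARD('n) * Q) i - evolve t (z t) (CARD('n) * Q) i"
      unfolding evolve_linear evolve_scale by (simp add: evolve_w)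
    ultimately have "z (t + CARD('n) * Q) i \<le> (M + ?D / r) * w (t + CARD('n) * Q) i"
      using dev[of i] D_le[of i] by (simp add: distrib_right)
    then show ?thesis using wB by (simp add: pos_divide_le_eq)
  qed
  have lower: "m + a ^ (CARD('n) * Q) * r / real CARD('n) * (M - m) - ?D / r \<le> z (t + CARD('n) * Q) i / w (t + CARD('n) * Q) i" for i
  proof -
    define G where "G = a ^ (CARD('n) * Q) * r / real CARD('n) * (M - m)"
    define W where "W = w (t + CARD('n) * Q) i"
    have "i \<in> reach t i1 (CARD('n) * Q)" using reach_all[OF t] by simp
    then have "a ^ (CARD('n) * Q) * (z t i1 + (- m) * w t i1) \<le> evolve t (\<lambda>j. z t j + (- m) * w t j) (CARD('n) * Q) i"
      using m by (intro evolve_reach[of "\<lambda>j. z t j + (- m) * w t j"]) auto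
    moreover have "z t i1 + (- m) * w t i1 = (M - m) * w t i1"
      using w_pos[of t i1] by (simp add: M_def algebra_simps)
    ultimately have "a ^ (CARD('n) * Q) * ((M - m) * w t i1) \<le> evolve t (z t) (CARD('n) * Q) i - m * w (t + CARD('n) * Q) i"
      unfolding evolve_linear by (simp add: evolve_w)
    moreover have "a ^ (CARD('n) * Q) * ((M - m) * r) \<le> a ^ (CARD('n) * Q) * ((M - m) * w t i1)"
      using mM w_ge a_bounds by (intro mult_left_mono) auto
    moreover have "G * W \<le> G * real CARD('n)"
      unfolding G_def W_def using mM a_bounds r_bounds wB by (intro mult_left_mono) auto
    moreover have "G * real CARD('n) = a ^ (CARD('n) * Q) * ((M - m) * r)"
      using N_ge_1 by (simp add: G_def)
    moreover have "(m + G - ?D / r) * W = m * W + G * W - ?D / r * W"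
      by (simp only: distrib_right left_diff_distrib)
    ultimately have "(m + G - ?D / r) * W \<le> z (t + CARD('n) * Q) i"
      using dev[of i] D_le[of i] unfolding W_def[symmetric] G_def[symmetric] by linarith
    then show ?thesis using wB unfolding G_def W_def by (simp only: pos_le_divide_eq)
  qed
  obtain j1 j0 where osc': "osc z (t + CARD('n) * Q) = z (t + CARD('n) * Q) j1 / w (t + CARD('n) * Q) j1 - z (t + CARD('n) * Q) j0 / w (t + CARD('n) * Q) j0"
    using osc_attained by blast
  have "osc z (t + CARD('n) * Q) \<le> M + ?D / r - (m + a ^ (CARD('n) * Q) * r / real CARD('n) * (M - m) - ?D / r)"
    unfolding osc' by (rule diff_mono[OF upper lower])
  also have "\<dots> = (1 - a ^ (CARD('n) * Q) * r / real CARD('n)) * (M - m) + 2 * (?D / r)" by (simp add: algebra_simps)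
  finally show ?thesis by (simp add: osc M_def m_def)
qed

text \<open>Both quantities are averages of the ratios \<open>z t j / w t j\<close>, with weights
  \<open>A t $ i $ j * w t j\<close> and \<open>w t j\<close> whose totals are
  \<open>w (Suc t) i\<close> and \<open>CARD('n)\<close>. Hence the network average is a legitimate
  centre for the consensus error.\<close>

lemma ratio_mix_between:
  assumes "\<And>j. l * w t j \<le> z t j" "\<And>j. z t j \<le> u * w t j"
  shows "l \<le> mix (A t) (z t) i / w (Suc t) i" "mix (A t) (z t) i / w (Suc t) i \<le> u"
    "l \<le> (\<Sum>j\<in>UNIV. z t j) / real CARD('n)" "(\<Sum>j\<in>UNIV. z t j) / real CARD('n) \<le> u"
proof -
  have "mix (A t) (\<lambda>j. l * w t j) i \<le> mix (A t) (z t) i" "mix (A t) (z t) i \<le> mix (A t) (\<lambda>j. u * w t j) i"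
    using assms by (auto intro: mix_mono A_nonneg)
  then show "l \<le> mix (A t) (z t) i / w (Suc t) i" "mix (A t) (z t) i / w (Suc t) i \<le> u"
    using w_pos[of "Suc t" i] by (auto simp: mix_real_scale w_Suc[symmetric] pos_le_divide_eq pos_divide_le_eq)
  have "(\<Sum>j\<in>UNIV. l * w t j) \<le> (\<Sum>j\<in>UNIV. z t j)" "(\<Sum>j\<in>UNIV. z t j) \<le> (\<Sum>j\<in>UNIV. u * w t j)"
    using assms by (auto intro: sum_mono)
  then show "l \<le> (\<Sum>j\<in>UNIV. z t j) / real CARD('n)" "(\<Sum>j\<in>UNIV. z t j) / real CARD('n) \<le> u"
    using N_ge_1 by (auto simp: sum_distrib_left[symmetric] w_sum pos_le_divide_eq pos_divide_le_eq)
qed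

lemma consensus_error_le_osc:
  "\<bar>mix (A t) (z t) i / w (Suc t) i - (\<Sum>j\<in>UNIV. z t j) / real CARD('n)\<bar> \<le> osc z t"
proof -
  obtain i1 i0 where osc: "osc z t = z t i1 / w t i1 - z t i0 / w t i0" using osc_attained by blast
  define M m where "M = z t i1 / w t i1" and "m = z t i0 / w t i0"
  have M: "z t j \<le> M * w t j" for j
    using osc_ge[of z t j i0] w_pos[of t j] by (simp add: osc M_def m_def pos_divide_le_eq)
  have m: "m * w t j \<le> z t j" for j
    using osc_ge[of z t i1 j] w_pos[of t j] by (simp add: osc M_def m_def pos_le_divide_eq)
  from ratio_mix_between(1,2)[of m t z M i, OF m M] ratio_mix_between(3,4)[of m t z M, OF m M] osc show ?thesis unfolding M_def m_def by linarith
qed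

end

text \<open>A power of \<open>t\<close> decays more slowly than any geometric sequence: over a fixed
  delay \<open>B\<close> it loses a factor tending to 1, eventually at least
  \<open>1 - \<theta> / 2\<close>. The contraction gains \<open>1 - \<theta>\<close>, and the
  remaining \<open>\<theta> / 2\<close> absorbs the forcing term.\<close>

lemma delayed_contraction_decay:
  fixes S :: "nat \<Rightarrow> real"
  assumes c: "0 \<le> c" and B: "0 < B" and \<theta>: "0 < \<theta>" "\<theta> \<le> 1"
    and step: "\<And>t. t \<ge> 1 \<Longrightarrow> S (t + B) \<le> (1 - \<theta>) * S t + K * real t powr (- c)"
  shows "\<exists>C\<ge>0. \<forall>t\<ge>1. S t \<le> C * real t powr (- c)"
proof -
  let ?p = "\<lambda>t. real t powr (- c)"
  have "((\<lambda>t. (1 + real B / real t) powr (- c)) \<longlongrightarrow> (1 + 0) powr (- c)) sequentially"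
    by (intro tendsto_intros lim_const_over_n) auto
  then have "\<forall>\<^sub>F t in sequentially. 1 - \<theta> / 2 < (1 + real B / real t) powr (- c)"
    using \<theta> by (intro order_tendstoD) auto
  then obtain t1 where t1: "\<And>t. t \<ge> t1 \<Longrightarrow> 1 - \<theta> / 2 < (1 + real B / real t) powr (- c)"
    unfolding eventually_sequentially by blast
  define t0 where "t0 = max 1 t1"
  have ratio: "(1 - \<theta> / 2) * ?p t \<le> ?p (t + B)" if "t \<ge> t0" for t
  proof -
    have t: "t \<ge> t1" "real t > 0" using that by (auto simp: t0_def)
    have "?p (t + B) = ((1 + real B / real t) * real t) powr (- c)"
      using t by (simp add: distrib_right add.commute)
    also have "\<dots> = (1 + real B / real t) powr (- c) * ?p t" using t by (subst powr_mult) auto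
    also have "\<dots> \<ge> (1 - \<theta> / 2) * ?p t" using t1[OF t(1)] by (intro mult_right_mono) auto
    finally show ?thesis .
  qed
  \<comment> \<open>The first entry yields \<open>K \<le> C * \<theta> / 2\<close> for the
    recursion; the sum crudely bounds the finitely many ratios before the recursion can
    start.\<close>
  define C where "C = max (2 * \<bar>K\<bar> / \<theta>) (\<Sum>t\<in>{1..<t0 + B}. \<bar>S t\<bar> / ?p t)"
  have CK': "2 * \<bar>K\<bar> / \<theta> \<le> C" by (simp add: C_def)
  moreover have "0 \<le> 2 * \<bar>K\<bar> / \<theta>" using \<theta> by simp
  ultimately have C0: "0 \<le> C" by linarith
  have CK: "\<bar>K\<bar> \<le> C * \<theta> / 2" using CK' \<theta> by (simp add: pos_divide_le_eq)
  have "S t \<le> C * ?p t" if "t \<ge> 1" for t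
    using that
  proof (induction t rule: less_induct)
    case (less t)
    have pt: "?p t > 0" using less.prems by simp
    show ?case
    proof (cases "t < t0 + B")
      case True
      have "\<bar>S t\<bar> / ?p t \<le> (\<Sum>t\<in>{1..<t0 + B}. \<bar>S t\<bar> / ?p t)"
        using True less.prems by (intro member_le_sum[of t "{1..<t0 + B}" "\<lambda>t. \<bar>S t\<bar> / ?p t"]) auto
      then have "\<bar>S t\<bar> / ?p t \<le> C" by (simp add: C_def)
      then show ?thesis using pt by (simp add: pos_divide_le_eq)
    next
      case False
      define u where "u = t - B"
      have u: "t = u + B" "u \<ge> t0" "u < t" "u \<ge> 1" using False B by (auto simp: u_def t0_def)
      have "S t \<le> (1 - \<theta>) * S u + K * ?p u" using step[OF u(4)] u(1) by simp
      also have "\<dots> \<le> (1 - \<theta>) * (C * ?p u) + (C * \<theta> / 2) * ?p u"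
        using less.IH[OF u(3,4)] \<theta> CK by (intro add_mono mult_left_mono mult_right_mono) auto
      also have "\<dots> = C * ((1 - \<theta> / 2) * ?p u)" by (simp add: algebra_simps)
      also have "\<dots> \<le> C * ?p t" using ratio[OF u(2)] C0 u(1) by (intro mult_left_mono) auto
      finally show ?thesis .
    qed
  qed
  then show ?thesis using C0 by blast
qed

context push_sum
begin

lemma consensus_rate_real:
  fixes z :: "nat \<Rightarrow> 'n \<Rightarrow> real"
  assumes c: "0 \<le> c"
    and pert: "\<And>t i. t \<ge> 1 \<Longrightarrow> \<bar>z (Suc t) i - mix (A t) (z t) i\<bar> \<le> K * real t powr (- c)"
  shows "\<exists>C\<ge>0. \<forall>t\<ge>1. \<forall>i. \<bar>mix (A t) (z t) i / w (Suc t) i - (\<Sum>j\<in>UNIV. z t j) / real CARD('n)\<bar>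
    \<le> C * real t powr (- c)"
proof -
  let ?K = "2 * (real CARD('n) * real (CARD('n) * Q) / r) * K"
  have K0: "0 \<le> K" using pert[of 1 undefined] by (simp add: order_trans[OF abs_ge_zero])
  have "osc z (t + CARD('n) * Q) \<le> (1 - a ^ (CARD('n) * Q) * r / real CARD('n)) * osc z t + ?K * real t powr (- c)" if t: "t \<ge> 1" for t
  proof -
    have "\<bar>z (Suc (t + k)) i - mix (A (t + k)) (z (t + k)) i\<bar> \<le> K * real t powr (- c)" for k i
    proof -
      have "real (t + k) powr (- c) \<le> real t powr (- c)"
        using t c by (intro powr_mono2') auto
      then show ?thesis using pert[of "t + k" i] t K0
        by (meson le_add1 mult_left_mono order_trans)
    qed
    then show ?thesis using osc_contraction[OF t, of z "K * real t powr (- c)"] by (simp add: mult_ac)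
  qed
  moreover have "0 < a ^ (CARD('n) * Q) * r / real CARD('n)" "a ^ (CARD('n) * Q) * r / real CARD('n) \<le> 1"
  proof -
    have "a ^ (CARD('n) * Q) * r \<le> 1" using a_bounds r_bounds by (intro mult_le_one power_le_one) auto
    then show "a ^ (CARD('n) * Q) * r / real CARD('n) \<le> 1" 
      using order_trans[OF _ N_ge_1] by (simp add: divide_le_eq_1)
    show "0 < a ^ (CARD('n) * Q) * r / real CARD('n)" using a_bounds r_bounds N_ge_1 by simp
  qed
  ultimately obtain C where C: "C \<ge> 0" "\<And>t. t \<ge> 1 \<Longrightarrow> osc z t \<le> C * real t powr (- c)"
    using delayed_contraction_decay[OF c B_pos, of "a ^ (CARD('n) * Q) * r / real CARD('n)" "osc z" ?K] by blast
  then show ?thesis by (meson consensus_error_le_osc order_trans)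
qed

lemma consensus_rate:
  fixes z :: "nat \<Rightarrow> 'n \<Rightarrow> real ^ 'm::finite"
  assumes c: "0 \<le> c"
    and pert: "\<And>t i. t \<ge> 1 \<Longrightarrow> norm (z (Suc t) i - mix (A t) (z t) i) \<le> K * real t powr (- c)"
  shows "\<exists>C\<ge>0. \<forall>t\<ge>1. \<forall>i. norm ((1 / w (Suc t) i) *\<^sub>R mix (A t) (z t) i - (1 / real CARD('n)) *\<^sub>R (\<Sum>j\<in>UNIV. z t j))
    \<le> C * real t powr (- c)"
proof -
  let ?d = "\<lambda>t i k. mix (A t) (\<lambda>j. z t j $ k) i / w (Suc t) i - (\<Sum>j\<in>UNIV. z t j $ k) / real CARD('n)"
  have "\<exists>C\<ge>0. \<forall>t\<ge>1. \<forall>i. \<bar>?d t i k\<bar> \<le> C * real t powr (- c)" for k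
  proof (rule consensus_rate_real[OF c])
    fix t :: nat and i assume "t \<ge> 1"
    have "\<bar>(z (Suc t) i - mix (A t) (z t) i) $ k\<bar> \<le> norm (z (Suc t) i - mix (A t) (z t) i)"
      by (rule component_le_norm_cart)
    then show "\<bar>z (Suc t) i $ k - mix (A t) (\<lambda>j. z t j $ k) i\<bar> \<le> K * real t powr (- c)"
      using pert[OF \<open>t \<ge> 1\<close>, of i] by (simp add: mix_component)
  qed
  then obtain C where C: "\<And>k. C k \<ge> 0" "\<And>k t i. t \<ge> 1 \<Longrightarrow> \<bar>?d t i k\<bar> \<le> C k * real t powr (- c)"
    by metis
  have "norm ((1 / w (Suc t) i) *\<^sub>R mix (A t) (z t) i - (1 / real CARD('n)) *\<^sub>R (\<Sum>j\<in>UNIV. z t j))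
      \<le> (\<Sum>k\<in>UNIV. C k) * real t powr (- c)" if "t \<ge> 1" for t i
  proof -
    have "norm ((1 / w (Suc t) i) *\<^sub>R mix (A t) (z t) i - (1 / real CARD('n)) *\<^sub>R (\<Sum>j\<in>UNIV. z t j))
        \<le> (\<Sum>k\<in>UNIV. \<bar>?d t i k\<bar>)"
      by (rule order_trans[OF norm_le_l1_cart]) (simp add: mix_component)
    also have "\<dots> \<le> (\<Sum>k\<in>UNIV. C k * real t powr (- c))" using C(2) that by (intro sum_mono)
    finally show ?thesis by (simp add: sum_distrib_right)
  qed
  then show ?thesis using C(1) by (intro exI[of _ "\<Sum>k\<in>UNIV. C k"]) (simp add: sum_nonneg)
qed

end

section \<open>Convexity and positive parts\<close>

text \<open>Composing \<open>h\<close> with a linear projection onto \<open>V\<close> extends it to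
  a convex function on the whole space, where continuity holds.\<close>

lemma convex_on_subspace_continuous:
  fixes V :: "'a::euclidean_space set" and h :: "'a \<Rightarrow> real"
  assumes V: "subspace V" and h: "convex_on V h"
  shows "continuous_on V h"
proof -
  obtain P :: "'a \<Rightarrow> 'a" where P: "range P \<subseteq> V" "linear P" "\<And>v. v \<in> V \<Longrightarrow> P v = v"
    using linear_exists_left_inverse_on[OF linear_id V] by (auto simp: id_def)
  have "convex_on UNIV (\<lambda>v. h (P v))"
    using h P(1) unfolding convex_on_def linear_add[OF P(2)] linear_scale[OF P(2)]
    by (auto simp: image_subset_iff)
  then have "continuous_on UNIV (\<lambda>v. h (P v))" by (rule convex_on_continuous[OF open_UNIV])
  then have "continuous_on V (\<lambda>v. h (P v))" by (rule continuous_on_subset) simp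
  then show ?thesis using P(3) by (simp cong: continuous_on_cong)
qed

text \<open>A subgradient tested one unit away in its own direction has norm at most a difference of
  two values of \<open>h\<close>. So a bound for \<open>h\<close> on \<open>S'\<close>, the unit
  neighbourhood of \<open>S\<close> within \<open>V\<close>, suffices; values on \<open>S\<close>
  alone would not control subgradients at its boundary.\<close>

lemma convex_on_subspace_bounds:
  fixes V :: "'a::euclidean_space set" and h :: "'a \<Rightarrow> real"
  assumes V: "subspace V" and h: "convex_on V h" and S: "compact S" "S \<subseteq> V"
  shows "\<exists>c\<ge>0. \<forall>z\<in>S. \<bar>h z\<bar> \<le> c \<and> (\<forall>u\<in>subdifferential V h z. norm u \<le> c)"
proof -
  define S' where "S' = {x + u |x u. x \<in> S \<and> u \<in> cball 0 1 \<inter> V}"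
  have "compact S'" unfolding S'_def
    using S by (intro compact_sums compact_Int_closed closed_subspace[OF V]) auto
  moreover have sub: "S' \<subseteq> V" using S(2) V by (auto simp: S'_def intro: subspace_add)
  ultimately have "compact (h ` S')"
    using convex_on_subspace_continuous[OF V h] continuous_on_subset compact_continuous_image by blast
  then obtain c where c: "\<And>z. z \<in> S' \<Longrightarrow> \<bar>h z\<bar> \<le> c"
    using compact_imp_bounded bounded_iff by (metis image_eqI real_norm_def)
  have SS': "z \<in> S'" if "z \<in> S" for z
    unfolding S'_def using that subspace_0[OF V] by (intro CollectI exI[of _ z] exI[of _ 0]) auto
  have "norm u \<le> 2 * c" if z: "z \<in> S" and u: "u \<in> subdifferential V h z" for z u
  proof (cases "u = 0")
    case True then show ?thesis using c[OF SS'[OF z]] by simp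
  next
    case False
    let ?e = "(1 / norm u) *\<^sub>R u"
    have uV: "u \<in> V" using u by (simp add: subdifferential_def)
    then have "z + ?e \<in> S'" unfolding S'_def using z False V subspace_scale[OF V uV]
      by (intro CollectI exI[of _ z] exI[of _ ?e]) auto
    then have "\<bar>h (z + ?e)\<bar> \<le> c" "z + ?e \<in> V" using c sub by auto
    moreover have "h z + u \<bullet> (z + ?e - z) \<le> h (z + ?e)"
      using u \<open>z + ?e \<in> V\<close> unfolding subdifferential_def by blast
    moreover have "u \<bullet> ?e = norm u" using False by (simp add: dot_square_norm power2_eq_square)
    ultimately show ?thesis using c[OF SS'[OF z]] by simp
  qed
  moreover have "\<bar>h z\<bar> \<le> 2 * max c 0" if "z \<in> S" for z using c[OF SS'[OF that]] by simp
  ultimately show ?thesis by (intro exI[of _ "2 * max c 0"]) fastforce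
qed

lemma pos_part_component: "pos_part z $ k = max 0 (z $ k)"
  by (simp add: pos_part_def)

lemma pos_part_nonneg: "0 \<le> pos_part z $ k"
  by (simp add: pos_part_def)

lemma norm_pos_part_le: "norm (pos_part z) \<le> norm z"
  by (rule norm_le_componentwise_cart) (simp add: pos_part_component)

lemma norm_pos_part_mono:
  assumes "\<And>k. u $ k \<le> v $ k"
  shows "norm (pos_part u) \<le> norm (pos_part v)"
  using assms by (intro norm_le_componentwise_cart) (auto simp: pos_part_component max_def intro: order_trans)

lemma norm_pos_part_add_diff_le:
  assumes "\<And>k. 0 \<le> v $ k"
  shows "norm (pos_part (v + d) - v) \<le> norm d"
proof (rule norm_le_componentwise_cart)
  fix k show "norm ((pos_part (v + d) - v) $ k) \<le> norm (d $ k)"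
    using assms[of k] by (auto simp: pos_part_component)
qed

lemma pos_part_inner_self: "pos_part z \<bullet> z = (norm (pos_part z))\<^sup>2"
  unfolding power2_norm_eq_inner inner_vec_def
  by (intro sum.cong) (auto simp: pos_part_component max_def)

lemma inner_le_norm_pos_part:
  assumes "\<And>k. 0 \<le> l $ k"
  shows "l \<bullet> z \<le> norm l * norm (pos_part z)"
proof -
  have "l \<bullet> z \<le> l \<bullet> pos_part z"
    unfolding inner_vec_def using assms by (intro sum_mono) (simp add: pos_part_component mult_left_mono)
  also have "\<dots> \<le> norm l * norm (pos_part z)" by (rule norm_cauchy_schwarz)
  finally show ?thesis .
qed

text \<open>When the projection is active, both its correction and \<open>m\<close> are bounded by the increment, so
  their product is of second order.\<close>

lemma pos_part_step_inner:
  assumes m: "\<And>k. 0 \<le> m $ k" and \<theta>: "\<And>k. 0 \<le> \<theta> $ k" and w: "0 < w"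
  shows "(pos_part (m + d) - m) \<bullet> ((1 / w) *\<^sub>R m - \<theta>) \<le> d \<bullet> ((1 / w) *\<^sub>R m - \<theta>) + (norm d)\<^sup>2 / w"
proof -
  have "(max 0 (m $ k + d $ k) - m $ k) * (m $ k / w - \<theta> $ k)
      \<le> d $ k * (m $ k / w - \<theta> $ k) + (d $ k)\<^sup>2 / w" for k
  proof (cases "0 \<le> m $ k + d $ k")
    case True then show ?thesis using w by simp
  next
    case False
    define c where "c = - m $ k - d $ k"
    have c: "0 \<le> c" "c \<le> - d $ k" "m $ k \<le> - d $ k" using False m[of k] by (auto simp: c_def)
    have "c * m $ k \<le> (- d $ k) * (- d $ k)" using c m by (intro mult_mono) auto
    then have "c * (m $ k / w) \<le> (d $ k)\<^sup>2 / w"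
      using w by (simp add: power2_eq_square divide_right_mono)
    moreover have "0 \<le> c * \<theta> $ k" using c \<theta> by simp
    ultimately have "c * (m $ k / w - \<theta> $ k) \<le> (d $ k)\<^sup>2 / w" by (simp add: right_diff_distrib)
    moreover have "(max 0 (m $ k + d $ k) - m $ k) * (m $ k / w - \<theta> $ k)
        = d $ k * (m $ k / w - \<theta> $ k) + c * (m $ k / w - \<theta> $ k)"
      using False by (simp add: c_def algebra_simps)
    ultimately show ?thesis by linarith
  qed
  then have "(\<Sum>k\<in>UNIV. (max 0 (m $ k + d $ k) - m $ k) * (m $ k / w - \<theta> $ k))
      \<le> (\<Sum>k\<in>UNIV. d $ k * (m $ k / w - \<theta> $ k) + (d $ k)\<^sup>2 / w)" by (intro sum_mono)
  moreover have "(norm d)\<^sup>2 / w = (\<Sum>k\<in>UNIV. (d $ k)\<^sup>2 / w)"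
    unfolding power2_norm_eq_inner inner_vec_def by (simp add: power2_eq_square sum_divide_distrib)
  ultimately show ?thesis by (simp add: inner_vec_def pos_part_component sum.distrib)
qed

section \<open>Sums of powers and summation by parts\<close>

lemma sum_powr_le:
  assumes c: "0 \<le> c" "c < 1"
  shows "(\<Sum>t=1..T. real t powr (- c)) \<le> real T powr (1 - c) / (1 - c)"
proof (induction T)
  case 0 then show ?case using c by simp
next
  case (Suc T)
  \<comment> \<open>Comparison with the increment of \<open>t powr (1 - c)\<close> by the mean value
    theorem; \<open>T = 0\<close> is separate because this power need not be differentiable at
    0.\<close>
  have "real (Suc T) powr (- c) * (1 - c) \<le> real (Suc T) powr (1 - c) - real T powr (1 - c)"
  proof (cases "T = 0")
    case True then show ?thesis using c by simp
  next
    case False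
    have "\<exists>z. real T < z \<and> z < real (Suc T) \<and>
        real (Suc T) powr (1 - c) - real T powr (1 - c) = (real (Suc T) - real T) * ((1 - c) * z powr (- c))"
      using False by (intro MVT2) (auto intro!: derivative_eq_intros)
    then obtain z where z: "real T < z" "z < real (Suc T)"
      "real (Suc T) powr (1 - c) - real T powr (1 - c) = (1 - c) * z powr (- c)" by auto
    have "real (Suc T) powr (- c) \<le> z powr (- c)" using z c by (intro powr_mono2') auto
    then show ?thesis using z(3) c by (simp add: mult.commute mult_left_mono)
  qed
  then have "real (Suc T) powr (- c) \<le> (real (Suc T) powr (1 - c) - real T powr (1 - c)) / (1 - c)"
    using c by (simp add: pos_le_divide_eq)
  then show ?case using Suc by (simp add: diff_divide_distrib)
qed

text \<open>Summation by parts with nondecreasing weights. Keeping \<open>c T * D (Suc T)\<close> on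
  the left closes the induction; \<open>M\<close> bounds \<open>D\<close> only up to time
  \<open>T\<close>, so this last term is discarded by its sign.\<close>

lemma weighted_telescoping:
  fixes D c :: "nat \<Rightarrow> real"
  assumes D: "\<And>t. t \<in> {1..T} \<Longrightarrow> D t \<le> M" and D0: "\<And>t. 0 \<le> D t"
    and c: "\<And>t. 0 \<le> c t" "\<And>t. c t \<le> c (Suc t)" and T: "1 \<le> T"
  shows "(\<Sum>t=1..T. c t * (D t - D (Suc t))) \<le> c T * M"
proof -
  have "(\<Sum>t=1..T. c t * (D t - D (Suc t))) + c T * D (Suc T) \<le> c T * M"
    using T D
  proof (induction T rule: nat_induct_at_least)
    case base
    then show ?case using c(1)[of 1] by (simp add: right_diff_distrib mult_left_mono)
  next
    case (Suc T)
    have "(c (Suc T) - c T) * D (Suc T) \<le> (c (Suc T) - c T) * M"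
      using Suc.prems[of "Suc T"] c(2)[of T] by (intro mult_left_mono) auto
    then show ?case using Suc.IH Suc.prems by (simp add: algebra_simps)
  qed
  moreover have "0 \<le> c T * D (Suc T)" using c(1) D0 by simp
  ultimately show ?thesis by linarith
qed

lemma quadratic_inequality_bound:
  fixes G a b :: real
  assumes "G\<^sup>2 \<le> a * G + b" "0 \<le> a" "0 \<le> b"
  shows "G \<le> a + sqrt b"
proof (rule ccontr)
  assume "\<not> G \<le> a + sqrt b"
  then have G: "sqrt b < G - a" "sqrt b \<le> G" using assms by (auto simp: not_le)
  have "b = sqrt b * sqrt b" using assms by simp
  also have "\<dots> \<le> sqrt b * G" using G assms by (intro mult_left_mono) auto
  also have "\<dots> < (G - a) * G" if "0 < G" using G that by simp
  finally have "b < (G - a) * G" if "0 < G" using that by simp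
  moreover have "0 < G" using \<open>\<not> G \<le> a + sqrt b\<close> assms(2,3) real_sqrt_ge_zero[of b] by linarith
  ultimately show False using assms(1) by (simp add: power2_eq_square algebra_simps)
qed

section \<open>Primal-dual estimates along a run\<close>

locale dopp = push_sum E A a Q w
  for E :: "nat \<Rightarrow> ('n::finite \<times> 'n) set" and A :: "nat \<Rightarrow> real ^ 'n ^ 'n" and a Q w +
  fixes V X :: "'n \<Rightarrow> 'a::euclidean_space set"
    and f :: "'n \<Rightarrow> 'a \<Rightarrow> real" and g :: "'n \<Rightarrow> 'a \<Rightarrow> real ^ 'm::finite"
    and Cf \<kappa> :: real
    and x s :: "nat \<Rightarrow> 'n \<Rightarrow> 'a" and \<mu> y :: "nat \<Rightarrow> 'n \<Rightarrow> real ^ 'm"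
  assumes spaces: "\<And>i. subspace (V i)" "\<And>i. X i \<subseteq> V i"
    and f_convex: "\<And>i. convex_on (V i) (f i)" and g_convex: "\<And>i k. convex_on (V i) (\<lambda>z. g i z $ k)"
    and X: "\<And>i. convex (X i)" "\<And>i. compact (X i)"
    and Cf: "Cf > 0" "\<And>i z u. z \<in> X i \<Longrightarrow> u \<in> subdifferential (V i) (f i) z \<Longrightarrow> norm u \<le> Cf"
    and kappa: "0 < \<kappa>" "\<kappa> < 1 / 4"
    and run: "dopp_run V X f g A alpha_step (beta_step \<kappa>) w x \<mu> y s"
begin

text \<open>The inverse of \<open>beta_step \<kappa> t\<close> for \<open>t \<ge> 1\<close>. At time
  0 they disagree (\<open>p 0 = 0\<close>, while the regularization parameter is 1); the estimates
  start at time 1.\<close>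

definition p :: "nat \<Rightarrow> real" where "p t = real t powr \<kappa>"

abbreviation \<alpha> where "\<alpha> \<equiv> alpha_step"
abbreviation \<beta> where "\<beta> \<equiv> beta_step \<kappa>"

lemma alpha_powr: "t \<ge> 1 \<Longrightarrow> \<alpha> t = real t powr (- (1/2))"
  by (simp add: alpha_step_def powr_half_sqrt powr_minus_divide)

lemma beta_eq: "t \<ge> 1 \<Longrightarrow> \<beta> t = 1 / p t"
  by (simp add: beta_step_def p_def)

lemma beta_powr: "t \<ge> 1 \<Longrightarrow> \<beta> t = real t powr (- \<kappa>)"
  by (simp add: beta_step_def powr_minus_divide)

lemma p_ge_1: "t \<ge> 1 \<Longrightarrow> 1 \<le> p t"
  using kappa by (simp add: p_def ge_one_powr_ge_zero)

lemma p_mono: "t \<le> u \<Longrightarrow> p t \<le> p u"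
  using kappa by (simp add: p_def powr_mono2)

lemma p_alpha_powr: "t \<ge> 1 \<Longrightarrow> p t * \<alpha> t = real t powr (- (1/2 - \<kappa>))"
  by (simp add: alpha_powr p_def powr_add[symmetric])

lemma alpha_bounds: "0 < \<alpha> t" "\<alpha> t \<le> 1"
  by (auto simp: alpha_step_def)

lemma beta_bounds: "0 < \<beta> t" "\<beta> t \<le> 1"
  using p_ge_1[of t] kappa by (cases "t = 0"; auto simp: beta_step_def p_def)+

text \<open>Push-sum ratios: \<open>\<nu> t i\<close> is agent \<open>i\<close>'s estimate of the
  average multiplier, and \<open>\<eta> t i\<close> below that of the average constraint
  value.\<close>

definition \<nu> :: "nat \<Rightarrow> 'n \<Rightarrow> real ^ 'm" where
  "\<nu> t i = (1 / w (Suc t) i) *\<^sub>R mix (A t) (\<mu> t) i"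

definition \<eta> :: "nat \<Rightarrow> 'n \<Rightarrow> real ^ 'm" where
  "\<eta> t i = (1 / w (Suc t) i) *\<^sub>R mix (A t) (y t) i"

definition \<mu>_avg :: "nat \<Rightarrow> real ^ 'm" where
  "\<mu>_avg t = (1 / real CARD('n)) *\<^sub>R (\<Sum>i\<in>UNIV. \<mu> t i)"

definition cost :: "nat \<Rightarrow> real" where "cost t = (\<Sum>i\<in>UNIV. f i (x t i))"

definition constr :: "nat \<Rightarrow> real ^ 'm" where "constr t = (\<Sum>i\<in>UNIV. g i (x t i))"

lemma mix_mu_eq: "mix (A t) (\<mu> t) i = w (Suc t) i *\<^sub>R \<nu> t i"
  using w_pos[of "Suc t" i] by (simp add: \<nu>_def)

lemma init: "x 0 i \<in> X i" "\<mu> 0 i = 0" "y 0 i = g i (x 0 i)"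
  using run by (auto simp: dopp_run_def)

lemma x_Suc: "x (Suc t) i = closest_point (X i) (x t i - \<alpha> t *\<^sub>R s (Suc t) i)"
  using run by (auto simp: dopp_run_def)

lemma mu_Suc: "\<mu> (Suc t) i = pos_part (mix (A t) (\<mu> t) i + \<alpha> t *\<^sub>R (\<eta> t i - \<beta> t *\<^sub>R mix (A t) (\<mu> t) i))"
  using run unfolding dopp_run_def \<eta>_def by blast

lemma y_Suc: "y (Suc t) i = mix (A t) (y t) i + g i (x (Suc t) i) - g i (x t i)"
  using run unfolding dopp_run_def by blast

lemma s_Suc: "\<exists>u\<in>subdifferential (V i) (f i) (x t i). \<exists>G\<in>subdifferential_vec (V i) (g i) (x t i).
    s (Suc t) i = u + (\<Sum>k\<in>UNIV. \<nu> t i $ k *\<^sub>R G $ k)"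
proof -
  have "(1 / w (Suc t) i) *\<^sub>R cols_mult G (mix (A t) (\<mu> t) i) = (\<Sum>k\<in>UNIV. \<nu> t i $ k *\<^sub>R G $ k)"
    for G :: "'a ^ 'm" by (simp add: cols_mult_def \<nu>_def scaleR_sum_right)
  moreover have "\<exists>u\<in>subdifferential (V i) (f i) (x t i). \<exists>G\<in>subdifferential_vec (V i) (g i) (x t i).
      s (Suc t) i = u + (1 / w (Suc t) i) *\<^sub>R cols_mult G (mix (A t) (\<mu> t) i)"
    using run unfolding dopp_run_def by blast
  ultimately show ?thesis by simp
qed

lemma X_nonempty: "X i \<noteq> {}" using init(1) by blast

lemma x_in: "x t i \<in> X i"
proof (cases t)
  case (Suc u)
  show ?thesis unfolding Suc x_Suc
    using closest_point_in_set[OF compact_imp_closed[OF X(2)] X_nonempty] .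
qed (simp add: init)

lemma mu_nonneg: "0 \<le> \<mu> t i $ k"
  by (cases t) (auto simp: init mu_Suc pos_part_nonneg)

lemma mix_mu_nonneg: "0 \<le> mix (A t) (\<mu> t) i $ k"
  by (simp add: mix_component mix_nonneg mu_nonneg)

lemma nu_nonneg: "0 \<le> \<nu> t i $ k"
  using w_pos[of "Suc t" i] mix_mu_nonneg[of t i k] by (simp add: \<nu>_def)

lemma mu_avg_nonneg: "0 \<le> \<mu>_avg t $ k"
  by (simp add: \<mu>_avg_def sum_nonneg mu_nonneg)

text \<open>Tracking invariant: mixing preserves totals, and the corrections telescope from
  \<open>y 0 i = g i (x 0 i)\<close>. It turns consensus of \<open>y\<close> into an estimate of the
  true constraint value.\<close>

lemma y_sum: "(\<Sum>i\<in>UNIV. y t i) = constr t"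
  by (induction t) (auto simp: init constr_def y_Suc sum.distrib sum_subtractf sum_mix_A)

section \<open>Bounds along the run\<close>

lemma g_bounds:
  "\<exists>c\<ge>0. \<forall>i. \<forall>z\<in>X i. norm (g i z) \<le> c \<and>
    (\<forall>G\<in>subdifferential_vec (V i) (g i) z. \<forall>k. norm (G $ k) \<le> c)"
proof -
  have "\<exists>c\<ge>0. \<forall>z\<in>X i. \<bar>g i z $ k\<bar> \<le> c \<and> (\<forall>u\<in>subdifferential (V i) (\<lambda>z. g i z $ k) z. norm u \<le> c)"
    for i k by (rule convex_on_subspace_bounds[OF spaces(1) g_convex X(2) spaces(2)])
  then obtain c where c: "\<And>i k. 0 \<le> c i k" "\<And>i k z. z \<in> X i \<Longrightarrow> \<bar>g i z $ k\<bar> \<le> c i k"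
    "\<And>i k z u. z \<in> X i \<Longrightarrow> u \<in> subdifferential (V i) (\<lambda>z. g i z $ k) z \<Longrightarrow> norm u \<le> c i k"
    by metis
  define b where "b i = (\<Sum>k\<in>UNIV. c i k)" for i
  have b: "0 \<le> b i" "c i k \<le> b i" for i k
    using c(1) by (auto simp: b_def intro: sum_nonneg member_le_sum)
  have bs: "b i \<le> (\<Sum>i\<in>UNIV. b i)" for i using b(1) by (auto intro: member_le_sum)
  have "norm (g i z) \<le> (\<Sum>i\<in>UNIV. b i)" if "z \<in> X i" for i z
  proof -
    have "norm (g i z) \<le> (\<Sum>k\<in>UNIV. \<bar>g i z $ k\<bar>)" by (rule norm_le_l1_cart)
    also have "\<dots> \<le> b i" unfolding b_def using c(2)[OF that] by (intro sum_mono)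
    finally show ?thesis using bs order_trans by blast
  qed
  moreover have "norm (G $ k) \<le> (\<Sum>i\<in>UNIV. b i)"
    if "z \<in> X i" "G \<in> subdifferential_vec (V i) (g i) z" for i z k and G :: "'a ^ 'm"
    using c(3)[OF that(1), of "G $ k" k] that(2) b(2)[of i k] bs[of i]
    by (fastforce simp: subdifferential_vec_def)
  moreover have "0 \<le> (\<Sum>i\<in>UNIV. b i)" using b(1) by (simp add: sum_nonneg)
  ultimately show ?thesis by blast
qed

text \<open>Subgradients of \<open>g i\<close> are available at all iterates, since the run uses them, which gives
  the Lipschitz estimate along the run.\<close>

lemma g_lipschitz_run: "\<exists>c\<ge>0. \<forall>t i. norm (g i (x (Suc t) i) - g i (x t i)) \<le> c * norm (x (Suc t) i - x t i)"
proof -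
  obtain c where c: "c \<ge> 0" "\<And>i z G k. z \<in> X i \<Longrightarrow> G \<in> subdifferential_vec (V i) (g i) z \<Longrightarrow> norm (G $ k) \<le> c"
    using g_bounds by metis
  have one: "g i (x t i) $ k - g i (x u i) $ k \<le> c * norm (x t i - x u i)" for t u i k
  proof -
    obtain G where G: "G \<in> subdifferential_vec (V i) (g i) (x t i)" using s_Suc by blast
    have "x u i \<in> V i" using x_in spaces(2) by blast
    then have "g i (x t i) $ k + G $ k \<bullet> (x u i - x t i) \<le> g i (x u i) $ k"
      using G by (auto simp: subdifferential_vec_def subdifferential_def)
    moreover have "- (G $ k \<bullet> (x u i - x t i)) \<le> norm (G $ k) * norm (x u i - x t i)"
      using norm_cauchy_schwarz[of "- (G $ k)" "x u i - x t i"] by simp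
    moreover have "norm (G $ k) * norm (x u i - x t i) \<le> c * norm (x u i - x t i)"
      using c(2)[OF x_in G] by (intro mult_right_mono) auto
    ultimately show ?thesis by (simp add: norm_minus_commute)
  qed
  have "norm (g i (x (Suc t) i) - g i (x t i)) \<le> (real CARD('m) * c) * norm (x (Suc t) i - x t i)" for t i
  proof -
    have "norm (g i (x (Suc t) i) - g i (x t i)) \<le> (\<Sum>k\<in>UNIV. \<bar>(g i (x (Suc t) i) - g i (x t i)) $ k\<bar>)"
      by (rule norm_le_l1_cart)
    also have "\<dots> \<le> (\<Sum>k\<in>(UNIV::'m set). c * norm (x (Suc t) i - x t i))"
      using one[of i "Suc t" _ t] one[of i t _ "Suc t"]
      by (intro sum_mono) (auto simp: abs_le_iff norm_minus_commute)
    finally show ?thesis by simp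
  qed
  then show ?thesis using c(1) by (intro exI[of _ "real CARD('m) * c"]) auto
qed

text \<open>Exponent 0 in \<open>consensus_rate\<close>: the increments of \<open>y\<close> are so
  far only known to be bounded, as \<open>g i\<close> is on \<open>X i\<close>. No bound for the
  multipliers enters, which breaks the circle between the bounds for \<open>\<mu>\<close> and for
  the steps of \<open>x\<close>.\<close>

lemma eta_bounded: "\<exists>c\<ge>0. \<forall>t\<ge>1. \<forall>i. norm (\<eta> t i) \<le> c"
proof -
  obtain c where c: "c \<ge> 0" "\<And>i z. z \<in> X i \<Longrightarrow> norm (g i z) \<le> c" using g_bounds by metis
  have "norm (y (Suc t) i - mix (A t) (y t) i) \<le> 2 * c * real t powr (- 0)" if "t \<ge> 1" for t i
  proof -
    have "norm (y (Suc t) i - mix (A t) (y t) i) \<le> norm (g i (x (Suc t) i)) + norm (g i (x t i))"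
      using norm_triangle_ineq4[of "g i (x (Suc t) i)" "g i (x t i)"] by (simp add: y_Suc)
    then show ?thesis using c(2)[OF x_in, of i t] c(2)[OF x_in, of i "Suc t"] that by simp
  qed
  from consensus_rate[OF _ this] obtain C where C: "C \<ge> 0"
    "\<And>t i. t \<ge> 1 \<Longrightarrow> norm (\<eta> t i - (1 / real CARD('n)) *\<^sub>R constr t) \<le> C * real t powr (- 0)"
    unfolding y_sum \<eta>_def by auto
  have "norm (\<eta> t i) \<le> C + c" if "t \<ge> 1" for t i
  proof -
    have "norm (constr t) \<le> (\<Sum>i\<in>(UNIV::'n set). c)"
      unfolding constr_def using c(2)[OF x_in] by (intro sum_norm_le)
    then have "norm ((1 / real CARD('n)) *\<^sub>R constr t) \<le> c"
      using N_ge_1 by (simp add: field_simps)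
    moreover have "norm (\<eta> t i - (1 / real CARD('n)) *\<^sub>R constr t) \<le> C" using C(2)[OF that, of i] that by simp
    ultimately show ?thesis
      using norm_triangle_sub[of "\<eta> t i" "(1 / real CARD('n)) *\<^sub>R constr t"] by linarith
  qed
  then show ?thesis using C(1) c(1) by (intro exI[of _ "C + c"]) auto
qed

text \<open>Damping and drift balance at the scale \<open>p t\<close>. Since
  \<open>\<beta> t * p t = 1\<close>, the factor \<open>1 - \<alpha> t * \<beta> t\<close> lowers
  the bound \<open>c * p t * w\<close> by \<open>\<alpha> t * c * w\<close>, and
  \<open>\<alpha> t * \<eta> t i\<close> adds at most \<open>\<alpha> t * b\<close>, which is no
  more because \<open>b \<le> c * r\<close> and \<open>r \<le> w\<close>. Measuring against
  \<open>w\<close> makes the bound stable under mixing.\<close>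

lemma mu_bound: "\<exists>c\<ge>0. \<forall>t\<ge>1. \<forall>i. norm (\<mu> t i) \<le> c * p t * w t i"
proof -
  obtain b where b: "b \<ge> 0" "\<And>t i. t \<ge> 1 \<Longrightarrow> norm (\<eta> t i) \<le> b" using eta_bounded by blast
  \<comment> \<open>The first entry supplies \<open>b \<le> c * r\<close>; the second starts the
    induction at time 1, where \<open>p\<close> is 1.\<close>
  define c where "c = max (b / r) (\<Sum>i\<in>UNIV. norm (\<mu> 1 i) / r)"
  have cb: "b \<le> c * r" using r_bounds by (simp add: c_def pos_divide_le_eq[symmetric])
  have c0: "0 \<le> c" using b(1) r_bounds by (simp add: c_def le_max_iff_disj)
  have "norm (\<mu> t i) \<le> c * p t * w t i" if "t \<ge> 1" for t i
    using that
  proof (induction t arbitrary: i rule: nat_induct_at_least)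
    case base
    have "norm (\<mu> 1 i) / r \<le> (\<Sum>i\<in>UNIV. norm (\<mu> 1 i) / r)"
      using r_bounds by (intro member_le_sum[of i UNIV "\<lambda>i. norm (\<mu> 1 i) / r"]) auto
    then have "norm (\<mu> 1 i) / r \<le> c" by (simp add: c_def)
    then have "norm (\<mu> 1 i) \<le> c * r" using r_bounds by (simp add: pos_divide_le_eq)
    also have "\<dots> \<le> c * w 1 i" using c0 w_ge by (intro mult_left_mono)
    finally show ?case by (simp add: p_def)
  next
    case (Suc t)
    let ?m = "mix (A t) (\<mu> t) i" and ?w = "w (Suc t) i"
    have p: "1 \<le> p t" "p t \<le> p (Suc t)" using p_ge_1 p_mono Suc.hyps by auto
    have m: "norm ?m \<le> c * p t * ?w"
      by (rule norm_ratio_mix_le) (use Suc.IH in \<open>simp add: mult_ac\<close>)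
    have ab: "0 \<le> 1 - \<alpha> t * \<beta> t" using alpha_bounds beta_bounds by (simp add: mult_le_one less_imp_le)
    have "norm (\<mu> (Suc t) i) \<le> norm ((1 - \<alpha> t * \<beta> t) *\<^sub>R ?m + \<alpha> t *\<^sub>R \<eta> t i)"
      unfolding mu_Suc by (rule order_trans[OF norm_pos_part_le]) (simp add: algebra_simps)
    also have "\<dots> \<le> (1 - \<alpha> t * \<beta> t) * norm ?m + \<alpha> t * norm (\<eta> t i)"
      using ab alpha_bounds[of t] by (intro order_trans[OF norm_triangle_ineq]) simp
    also have "\<dots> \<le> (1 - \<alpha> t * \<beta> t) * (c * p t * ?w) + \<alpha> t * (c * r)"
      using ab alpha_bounds[of t] m b(2)[OF Suc.hyps, of i] cb
      by (intro add_mono mult_left_mono) auto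
    also have "\<alpha> t * (c * r) \<le> \<alpha> t * (c * ?w)"
      using c0 w_ge alpha_bounds[of t] by (intro mult_left_mono) auto
    also have "(1 - \<alpha> t * \<beta> t) * (c * p t * ?w) + \<alpha> t * (c * ?w) = c * p t * ?w"
      using p beta_eq[OF Suc.hyps] by (simp add: algebra_simps)
    also have "\<dots> \<le> c * p (Suc t) * ?w"
      using c0 p w_nonneg by (intro mult_right_mono mult_left_mono) auto
    finally show ?case by simp
  qed
  then show ?thesis using c0 by blast
qed

lemma nu_bound: "\<exists>c\<ge>0. \<forall>t\<ge>1. \<forall>i. norm (\<nu> t i) \<le> c * p t"
proof -
  obtain c where c: "c \<ge> 0" "\<And>t i. t \<ge> 1 \<Longrightarrow> norm (\<mu> t i) \<le> c * p t * w t i" using mu_bound by blast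
  have "norm (\<nu> t i) \<le> c * p t" if "t \<ge> 1" for t i
  proof -
    have "norm (mix (A t) (\<mu> t) i) \<le> c * p t * w (Suc t) i" by (rule norm_ratio_mix_le) (rule c(2)[OF that])
    then show ?thesis using w_pos[of "Suc t" i] by (simp add: \<nu>_def pos_divide_le_eq)
  qed
  then show ?thesis using c(1) by blast
qed

lemma mu_avg_bound: "\<exists>c\<ge>0. \<forall>t\<ge>1. norm (\<mu>_avg t) \<le> c * p t"
proof -
  obtain c where c: "c \<ge> 0" "\<And>t i. t \<ge> 1 \<Longrightarrow> norm (\<mu> t i) \<le> c * p t * w t i" using mu_bound by blast
  have "norm (\<mu>_avg t) \<le> c * p t" if "t \<ge> 1" for t
  proof -
    have "norm (\<Sum>i\<in>UNIV. \<mu> t i) \<le> (\<Sum>i\<in>UNIV. c * p t * w t i)" using c(2)[OF that] by (intro sum_norm_le)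
    also have "\<dots> = c * p t * real CARD('n)" by (simp add: sum_distrib_left[symmetric] w_sum)
    finally show ?thesis using N_ge_1 by (simp add: \<mu>_avg_def pos_divide_le_eq)
  qed
  then show ?thesis using c(1) by blast
qed

lemma s_bound: "\<exists>c\<ge>0. \<forall>t\<ge>1. \<forall>i. norm (s (Suc t) i) \<le> c * p t"
proof -
  obtain b where b: "b \<ge> 0" "\<And>i z G k. z \<in> X i \<Longrightarrow> G \<in> subdifferential_vec (V i) (g i) z \<Longrightarrow> norm (G $ k) \<le> b"
    using g_bounds by metis
  obtain c where c: "c \<ge> 0" "\<And>t i. t \<ge> 1 \<Longrightarrow> norm (\<nu> t i) \<le> c * p t" using nu_bound by blast
  have "norm (s (Suc t) i) \<le> (Cf + real CARD('m) * (c * b)) * p t" if t: "t \<ge> 1" for t i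
  proof -
    obtain u G where u: "u \<in> subdifferential (V i) (f i) (x t i)"
      and G: "G \<in> subdifferential_vec (V i) (g i) (x t i)"
      and s: "s (Suc t) i = u + (\<Sum>k\<in>UNIV. \<nu> t i $ k *\<^sub>R G $ k)" using s_Suc by blast
    have "norm (\<nu> t i $ k *\<^sub>R G $ k) \<le> (c * p t) * b" for k
      using component_le_norm_cart[of "\<nu> t i" k] c(2)[OF t, of i] b(2)[OF x_in G, of k]
      by (auto intro!: mult_mono)
    then have "norm (\<Sum>k\<in>UNIV. \<nu> t i $ k *\<^sub>R G $ k) \<le> (\<Sum>k\<in>(UNIV::'m set). (c * p t) * b)"
      by (intro sum_norm_le)
    moreover have "norm u \<le> Cf * p t"
      using mult_mono[OF Cf(2)[OF x_in u] p_ge_1[OF t]] Cf(1) by simp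
    ultimately show ?thesis
      unfolding s using norm_triangle_ineq[of u "\<Sum>k\<in>UNIV. \<nu> t i $ k *\<^sub>R G $ k"] by (simp add: algebra_simps)
  qed
  then show ?thesis using b(1) c(1) Cf(1) by (intro exI[of _ "Cf + real CARD('m) * (c * b)"]) auto
qed

lemma x_step_bound: "\<exists>c\<ge>0. \<forall>t\<ge>1. \<forall>i. norm (x (Suc t) i - x t i) \<le> c * (p t * \<alpha> t)"
proof -
  obtain c where c: "c \<ge> 0" "\<And>t i. t \<ge> 1 \<Longrightarrow> norm (s (Suc t) i) \<le> c * p t" using s_bound by blast
  have "norm (x (Suc t) i - x t i) \<le> c * (p t * \<alpha> t)" if t: "t \<ge> 1" for t i
  proof -
    have "dist (closest_point (X i) (x t i - \<alpha> t *\<^sub>R s (Suc t) i)) (closest_point (X i) (x t i))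
        \<le> dist (x t i - \<alpha> t *\<^sub>R s (Suc t) i) (x t i)"
      using X X_nonempty compact_imp_closed by (intro closest_point_lipschitz) auto
    then have "norm (x (Suc t) i - x t i) \<le> \<alpha> t * norm (s (Suc t) i)"
      using alpha_bounds[of t] by (simp add: x_Suc closest_point_self[OF x_in] dist_norm)
    also have "\<dots> \<le> \<alpha> t * (c * p t)" using c(2)[OF t] alpha_bounds[of t] by (intro mult_left_mono) auto
    finally show ?thesis by (simp add: mult_ac)
  qed
  then show ?thesis using c(1) by blast
qed

text \<open>The growth \<open>p t\<close> of the multipliers is cancelled by
  \<open>\<beta> t\<close>. Hence the dual increments, and with them the consensus error of the
  multipliers, are of order \<open>\<alpha> t\<close> without a factor \<open>p t\<close>.\<close>

lemma dual_increment_bound: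
  "\<exists>c\<ge>0. \<forall>t\<ge>1. \<forall>i. norm (\<eta> t i - \<beta> t *\<^sub>R mix (A t) (\<mu> t) i) \<le> c"
proof -
  obtain b where b: "b \<ge> 0" "\<And>t i. t \<ge> 1 \<Longrightarrow> norm (\<eta> t i) \<le> b" using eta_bounded by blast
  obtain c where c: "c \<ge> 0" "\<And>t i. t \<ge> 1 \<Longrightarrow> norm (\<nu> t i) \<le> c * p t" using nu_bound by blast
  have "norm (\<eta> t i - \<beta> t *\<^sub>R mix (A t) (\<mu> t) i) \<le> b + c * real CARD('n)" if t: "t \<ge> 1" for t i
  proof -
    have p: "p t > 0" using p_ge_1[OF t] by linarith
    have "norm (\<beta> t *\<^sub>R mix (A t) (\<mu> t) i) = (1 / p t) * (w (Suc t) i * norm (\<nu> t i))"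
      using w_nonneg p by (simp add: mix_mu_eq beta_eq[OF t])
    also have "\<dots> \<le> (1 / p t) * (real CARD('n) * (c * p t))"
      using w_le w_nonneg c(2)[OF t, of i] p by (intro mult_left_mono mult_mono) auto
    also have "\<dots> = c * real CARD('n)" using p by simp
    finally show ?thesis
      using b(2)[OF t, of i] norm_triangle_ineq4[of "\<eta> t i" "\<beta> t *\<^sub>R mix (A t) (\<mu> t) i"] by linarith
  qed
  then show ?thesis using b(1) c(1) by (intro exI[of _ "b + c * real CARD('n)"]) auto
qed

section \<open>Consensus errors of the multiplier and constraint estimates\<close>

lemma nu_consensus: "\<exists>c\<ge>0. \<forall>t\<ge>1. \<forall>i. norm (\<nu> t i - \<mu>_avg t) \<le> c * \<alpha> t"
proof -
  obtain c where c: "c \<ge> 0" "\<And>t i. t \<ge> 1 \<Longrightarrow> norm (\<eta> t i - \<beta> t *\<^sub>R mix (A t) (\<mu> t) i) \<le> c"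
    using dual_increment_bound by blast
  have "norm (\<mu> (Suc t) i - mix (A t) (\<mu> t) i) \<le> c * real t powr (- (1/2))" if t: "t \<ge> 1" for t i
  proof -
    have "norm (\<mu> (Suc t) i - mix (A t) (\<mu> t) i) \<le> norm (\<alpha> t *\<^sub>R (\<eta> t i - \<beta> t *\<^sub>R mix (A t) (\<mu> t) i))"
      unfolding mu_Suc by (rule norm_pos_part_add_diff_le[OF mix_mu_nonneg])
    also have "\<dots> \<le> \<alpha> t * c" using c(2)[OF t] alpha_bounds[of t] by (simp add: mult_left_mono)
    finally show ?thesis by (simp add: alpha_powr[OF t] mult.commute)
  qed
  from consensus_rate[OF _ this] show ?thesis unfolding \<nu>_def \<mu>_avg_def by (auto simp: alpha_powr)
qed

text \<open>Second use of the consensus estimate for \<open>y\<close>: the perturbation is now the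
  change of \<open>g i\<close> along a primal step, decaying with exponent
  \<open>1/2 - \<kappa>\<close>.\<close>

lemma eta_consensus:
  "\<exists>c\<ge>0. \<forall>t\<ge>1. \<forall>i. norm (\<eta> t i - (1 / real CARD('n)) *\<^sub>R constr t) \<le> c * (p t * \<alpha> t)"
proof -
  obtain b where b: "b \<ge> 0" "\<And>t i. norm (g i (x (Suc t) i) - g i (x t i)) \<le> b * norm (x (Suc t) i - x t i)"
    using g_lipschitz_run by blast
  obtain c where c: "c \<ge> 0" "\<And>t i. t \<ge> 1 \<Longrightarrow> norm (x (Suc t) i - x t i) \<le> c * (p t * \<alpha> t)"
    using x_step_bound by blast
  have "norm (y (Suc t) i - mix (A t) (y t) i) \<le> (b * c) * real t powr (- (1/2 - \<kappa>))" if t: "t \<ge> 1" for t i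
  proof -
    have "norm (y (Suc t) i - mix (A t) (y t) i) \<le> b * norm (x (Suc t) i - x t i)"
      using b(2)[of i t] by (simp add: y_Suc)
    also have "\<dots> \<le> b * (c * (p t * \<alpha> t))" using c(2)[OF t] b(1) by (intro mult_left_mono) auto
    finally show ?thesis by (simp add: p_alpha_powr[OF t] mult.assoc)
  qed
  from consensus_rate[OF _ this] kappa show ?thesis unfolding \<eta>_def y_sum by (auto simp: p_alpha_powr)
qed


section \<open>One-step inequalities for the primal and dual distances\<close>

definition primal_dist :: "'a ^ 'n \<Rightarrow> nat \<Rightarrow> real" where
  "primal_dist z t = (\<Sum>i\<in>UNIV. (norm (x t i - z $ i))\<^sup>2)"

text \<open>As \<open>\<nu> t i\<close> is nonnegative, the combination of subgradients in
  \<open>s (Suc t) i\<close> is a subgradient of \<open>f i\<close> plus the constraint weighted by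
  the fixed vector \<open>\<nu> t i\<close>.\<close>

lemma subgradient_step:
  assumes z: "z \<in> X i"
  shows "f i (x t i) - f i z + \<nu> t i \<bullet> (g i (x t i) - g i z) \<le> s (Suc t) i \<bullet> (x t i - z)"
proof -
  obtain u G where u: "u \<in> subdifferential (V i) (f i) (x t i)"
    and G: "G \<in> subdifferential_vec (V i) (g i) (x t i)"
    and s: "s (Suc t) i = u + (\<Sum>k\<in>UNIV. \<nu> t i $ k *\<^sub>R G $ k)" using s_Suc by blast
  have zV: "z \<in> V i" using z spaces(2) by blast
  have "f i (x t i) + u \<bullet> (z - x t i) \<le> f i z" using u zV unfolding subdifferential_def by blast
  then have 1: "f i (x t i) - f i z \<le> u \<bullet> (x t i - z)" by (simp add: inner_diff_right)
  have "\<nu> t i $ k * (g i (x t i) $ k - g i z $ k) \<le> \<nu> t i $ k * (G $ k \<bullet> (x t i - z))" for k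
  proof -
    have "g i (x t i) $ k + G $ k \<bullet> (z - x t i) \<le> g i z $ k"
      using G zV unfolding subdifferential_def subdifferential_vec_def by blast
    then show ?thesis by (intro mult_left_mono nu_nonneg) (simp add: inner_diff_right)
  qed
  then have "\<nu> t i \<bullet> (g i (x t i) - g i z) \<le> (\<Sum>k\<in>UNIV. \<nu> t i $ k * (G $ k \<bullet> (x t i - z)))"
    unfolding inner_vec_def by (auto intro: sum_mono)
  with 1 show ?thesis unfolding s by (simp add: inner_add_left inner_sum_left)
qed

lemma primal_step_agent:
  assumes z: "z \<in> X i"
  shows "2 * \<alpha> t * (f i (x t i) - f i z + \<nu> t i \<bullet> (g i (x t i) - g i z))
    \<le> (norm (x t i - z))\<^sup>2 - (norm (x (Suc t) i - z))\<^sup>2 + (\<alpha> t)\<^sup>2 * (norm (s (Suc t) i))\<^sup>2"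
proof -
  have "dist (closest_point (X i) (x t i - \<alpha> t *\<^sub>R s (Suc t) i)) (closest_point (X i) z)
      \<le> dist (x t i - \<alpha> t *\<^sub>R s (Suc t) i) z"
    using X X_nonempty compact_imp_closed by (intro closest_point_lipschitz) auto
  then have "norm (x (Suc t) i - z) \<le> norm ((x t i - z) - \<alpha> t *\<^sub>R s (Suc t) i)"
    using z by (simp add: x_Suc closest_point_self dist_norm algebra_simps)
  then have "(norm (x (Suc t) i - z))\<^sup>2 \<le> (norm ((x t i - z) - \<alpha> t *\<^sub>R s (Suc t) i))\<^sup>2"
    by (intro power_mono) auto
  also have "\<dots> = (norm (x t i - z))\<^sup>2 - 2 * \<alpha> t * (s (Suc t) i \<bullet> (x t i - z)) + (\<alpha> t)\<^sup>2 * (norm (s (Suc t) i))\<^sup>2"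
    unfolding power2_norm_eq_inner
    by (simp add: inner_diff_left inner_diff_right inner_commute power2_eq_square)
  finally have "2 * \<alpha> t * (s (Suc t) i \<bullet> (x t i - z))
      \<le> (norm (x t i - z))\<^sup>2 - (norm (x (Suc t) i - z))\<^sup>2 + (\<alpha> t)\<^sup>2 * (norm (s (Suc t) i))\<^sup>2" by simp
  moreover have "2 * \<alpha> t * (f i (x t i) - f i z + \<nu> t i \<bullet> (g i (x t i) - g i z))
      \<le> 2 * \<alpha> t * (s (Suc t) i \<bullet> (x t i - z))"
    using alpha_bounds[of t] by (intro mult_left_mono subgradient_step z) auto
  ultimately show ?thesis by linarith
qed

text \<open>Each agent uses its own multiplier, but the sum over the agents collapses to
  \<open>constr\<close> only for a common one. Replacing \<open>\<nu> t i\<close> by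
  \<open>\<mu>_avg t\<close> costs \<open>\<alpha> t\<close> times a consensus error of order
  \<open>\<alpha> t\<close>, which fits into the second-order term.\<close>

lemma primal_step:
  "\<exists>K\<ge>0. \<forall>t\<ge>1. \<forall>z\<in>prod_set X.
    2 * \<alpha> t * (cost t - agent_sum f z + \<mu>_avg t \<bullet> (constr t - agent_sum g z))
    \<le> primal_dist z t - primal_dist z (Suc t) + K * (p t * \<alpha> t)\<^sup>2"
proof -
  obtain b where b: "b \<ge> 0" "\<And>i z. z \<in> X i \<Longrightarrow> norm (g i z) \<le> b" using g_bounds by metis
  obtain c where c: "c \<ge> 0" "\<And>t i. t \<ge> 1 \<Longrightarrow> norm (s (Suc t) i) \<le> c * p t" using s_bound by blast
  obtain e where e: "e \<ge> 0" "\<And>t i. t \<ge> 1 \<Longrightarrow> norm (\<nu> t i - \<mu>_avg t) \<le> e * \<alpha> t" using nu_consensus by blast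
  have "2 * \<alpha> t * (cost t - agent_sum f z + \<mu>_avg t \<bullet> (constr t - agent_sum g z))
      \<le> primal_dist z t - primal_dist z (Suc t) + (real CARD('n) * (c\<^sup>2 + 4 * e * b)) * (p t * \<alpha> t)\<^sup>2"
    if t: "t \<ge> 1" and z: "z \<in> prod_set X" for t z
  proof -
    have p: "1 \<le> p t" by (rule p_ge_1[OF t])
    have zi: "z $ i \<in> X i" for i using z by (simp add: prod_set_def)
    have agent: "2 * \<alpha> t * (f i (x t i) - f i (z $ i) + \<mu>_avg t \<bullet> (g i (x t i) - g i (z $ i)))
        \<le> (norm (x t i - z $ i))\<^sup>2 - (norm (x (Suc t) i - z $ i))\<^sup>2 + (c\<^sup>2 + 4 * e * b) * (p t * \<alpha> t)\<^sup>2" for i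
    proof -
      have "(norm (s (Suc t) i))\<^sup>2 \<le> (c * p t)\<^sup>2" by (intro power_mono c(2)[OF t]) auto
      then have 1: "(\<alpha> t)\<^sup>2 * (norm (s (Suc t) i))\<^sup>2 \<le> c\<^sup>2 * (p t * \<alpha> t)\<^sup>2"
        using mult_left_mono[of "(norm (s (Suc t) i))\<^sup>2" "(c * p t)\<^sup>2" "(\<alpha> t)\<^sup>2"]
        by (simp add: power_mult_distrib mult_ac)
      have "(\<mu>_avg t - \<nu> t i) \<bullet> (g i (x t i) - g i (z $ i))
          \<le> norm (\<mu>_avg t - \<nu> t i) * norm (g i (x t i) - g i (z $ i))" by (rule norm_cauchy_schwarz)
      also have "\<dots> \<le> (e * \<alpha> t) * (b + b)"
      proof (intro mult_mono)
        show "norm (g i (x t i) - g i (z $ i)) \<le> b + b"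
          using norm_triangle_ineq4[of "g i (x t i)" "g i (z $ i)"] b(2)[OF x_in, of i t] b(2)[OF zi, of i] by linarith
      qed (use e(1) e(2)[OF t, of i] alpha_bounds[of t] in \<open>auto simp: norm_minus_commute\<close>)
      finally have "2 * \<alpha> t * ((\<mu>_avg t - \<nu> t i) \<bullet> (g i (x t i) - g i (z $ i))) \<le> 2 * \<alpha> t * ((e * \<alpha> t) * (b + b))"
        using alpha_bounds[of t] by (intro mult_left_mono) auto
      also have "\<dots> = 4 * e * b * (1 * \<alpha> t)\<^sup>2" by (simp add: power2_eq_square)
      also have "\<dots> \<le> 4 * e * b * (p t * \<alpha> t)\<^sup>2"
        using e(1) b(1) p alpha_bounds[of t] by (intro mult_left_mono power_mono mult_right_mono) auto
      finally have 2: "2 * \<alpha> t * ((\<mu>_avg t - \<nu> t i) \<bullet> (g i (x t i) - g i (z $ i))) \<le> 4 * e * b * (p t * \<alpha> t)\<^sup>2" .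
      have split: "2 * \<alpha> t * (f i (x t i) - f i (z $ i) + \<mu>_avg t \<bullet> (g i (x t i) - g i (z $ i)))
          = 2 * \<alpha> t * (f i (x t i) - f i (z $ i) + \<nu> t i \<bullet> (g i (x t i) - g i (z $ i)))
            + 2 * \<alpha> t * ((\<mu>_avg t - \<nu> t i) \<bullet> (g i (x t i) - g i (z $ i)))"
        by (simp add: inner_diff_left algebra_simps)
      show ?thesis
        unfolding split distrib_right using primal_step_agent[OF zi, of t i] 1 2 by linarith
    qed
    have "2 * \<alpha> t * (cost t - agent_sum f z + \<mu>_avg t \<bullet> (constr t - agent_sum g z))
        = (\<Sum>i\<in>UNIV. 2 * \<alpha> t * (f i (x t i) - f i (z $ i) + \<mu>_avg t \<bullet> (g i (x t i) - g i (z $ i))))"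
      by (simp add: cost_def constr_def agent_sum_def sum.distrib sum_subtractf
          inner_sum_right inner_diff_right sum_distrib_left[symmetric])
    also have "\<dots> \<le> (\<Sum>i\<in>UNIV. (norm (x t i - z $ i))\<^sup>2 - (norm (x (Suc t) i - z $ i))\<^sup>2
        + (c\<^sup>2 + 4 * e * b) * (p t * \<alpha> t)\<^sup>2)" using agent by (intro sum_mono)
    also have "\<dots> = primal_dist z t - primal_dist z (Suc t) + (real CARD('n) * (c\<^sup>2 + 4 * e * b)) * (p t * \<alpha> t)\<^sup>2"
      by (simp add: primal_dist_def sum.distrib sum_subtractf)
    finally show ?thesis .
  qed
  then show ?thesis using b(1) e(1) by (intro exI[of _ "real CARD('n) * (c\<^sup>2 + 4 * e * b)"]) auto
qed

lemma mu_avg_Suc: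
  "\<mu>_avg (Suc t) = \<mu>_avg t + (1 / real CARD('n)) *\<^sub>R (\<Sum>i\<in>UNIV. \<mu> (Suc t) i - mix (A t) (\<mu> t) i)"
  by (simp add: \<mu>_avg_def sum_subtractf sum_mix_A algebra_simps)

text \<open>The weights \<open>w (Suc t) i\<close> in the regularization term add up to the number of agents, so
  summing over \<open>i\<close> yields a single ascent step of the averaged multiplier.\<close>

lemma dual_step_agent:
  "\<exists>K\<ge>0. \<forall>t\<ge>1. \<forall>\<theta> i. (\<forall>k. 0 \<le> \<theta> $ k) \<longrightarrow>
    (\<mu> (Suc t) i - mix (A t) (\<mu> t) i) \<bullet> (\<mu>_avg t - \<theta>)
    \<le> \<alpha> t * (((1 / real CARD('n)) *\<^sub>R constr t - (\<beta> t * w (Suc t) i) *\<^sub>R \<mu>_avg t) \<bullet> (\<mu>_avg t - \<theta>))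
      + K * (\<alpha> t)\<^sup>2 * p t * (p t + norm \<theta>)"
proof -
  obtain c where c: "c \<ge> 0" "\<And>t i. t \<ge> 1 \<Longrightarrow> norm (\<eta> t i - \<beta> t *\<^sub>R mix (A t) (\<mu> t) i) \<le> c"
    using dual_increment_bound by blast
  obtain e where e: "e \<ge> 0" "\<And>t i. t \<ge> 1 \<Longrightarrow> norm (\<nu> t i - \<mu>_avg t) \<le> e * \<alpha> t" using nu_consensus by blast
  obtain h where h: "h \<ge> 0"
    "\<And>t i. t \<ge> 1 \<Longrightarrow> norm (\<eta> t i - (1 / real CARD('n)) *\<^sub>R constr t) \<le> h * (p t * \<alpha> t)"
    using eta_consensus by blast
  obtain q where q: "q \<ge> 0" "\<And>t. t \<ge> 1 \<Longrightarrow> norm (\<mu>_avg t) \<le> q * p t" using mu_avg_bound by blast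
  \<comment> \<open>\<open>c * e\<close> occurs twice, for exchanging \<open>\<nu>\<close> and
    \<open>\<mu>_avg\<close> against the actual increment \<open>\<epsilon>\<close> and against the
    unclipped direction \<open>?u\<close>; \<open>c^2 / r\<close> is the clipping error; the last
    product bounds the deviation of \<open>?u\<close> from the ideal direction
    \<open>?v\<close>.\<close>
  define K where "K = 2 * (c * e) + c\<^sup>2 / r + (h + real CARD('n) * e) * (q + 1)"
  have K0: "0 \<le> K" using c(1) e(1) h(1) q(1) r_bounds by (simp add: K_def)
  have "(\<mu> (Suc t) i - mix (A t) (\<mu> t) i) \<bullet> (\<mu>_avg t - \<theta>)
    \<le> \<alpha> t * (((1 / real CARD('n)) *\<^sub>R constr t - (\<beta> t * w (Suc t) i) *\<^sub>R \<mu>_avg t) \<bullet> (\<mu>_avg t - \<theta>))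
      + K * (\<alpha> t)\<^sup>2 * p t * (p t + norm \<theta>)"
    if t: "t \<ge> 1" and \<theta>: "\<And>k. 0 \<le> \<theta> $ k" for t \<theta> i
  proof -
    let ?w = "w (Suc t) i" and ?m = "mix (A t) (\<mu> t) i"
    let ?u = "\<eta> t i - \<beta> t *\<^sub>R ?m" and ?gb = "(1 / real CARD('n)) *\<^sub>R constr t"
    let ?v = "?gb - (\<beta> t * ?w) *\<^sub>R \<mu>_avg t"
    have p: "1 \<le> p t" by (rule p_ge_1[OF t])
    have al: "0 < \<alpha> t" "\<alpha> t \<le> 1" using alpha_bounds by auto
    have wb: "r \<le> ?w" "0 < ?w" "?w \<le> real CARD('n)" using w_ge w_pos w_le by auto
    have u: "norm ?u \<le> c" by (rule c(2)[OF t])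
    define \<epsilon> where "\<epsilon> = \<mu> (Suc t) i - ?m"
    have \<epsilon>: "norm \<epsilon> \<le> \<alpha> t * c"
    proof -
      have "norm \<epsilon> \<le> norm (\<alpha> t *\<^sub>R ?u)"
        unfolding \<epsilon>_def mu_Suc by (rule norm_pos_part_add_diff_le[OF mix_mu_nonneg])
      also have "\<dots> \<le> \<alpha> t * c" using u al by (simp add: mult_left_mono)
      finally show ?thesis .
    qed
    have 1: "\<epsilon> \<bullet> (\<mu>_avg t - \<nu> t i) \<le> c * e * (\<alpha> t)\<^sup>2"
    proof -
      have "\<epsilon> \<bullet> (\<mu>_avg t - \<nu> t i) \<le> norm \<epsilon> * norm (\<mu>_avg t - \<nu> t i)" by (rule norm_cauchy_schwarz)
      also have "\<dots> \<le> (\<alpha> t * c) * (e * \<alpha> t)"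
        using \<epsilon> e(2)[OF t, of i] al c(1) by (intro mult_mono) (auto simp: norm_minus_commute)
      finally show ?thesis by (simp add: power2_eq_square mult_ac)
    qed
    \<comment> \<open>Taken at \<open>\<nu> t i\<close>, the vector before the increment divided by
      its weight, as \<open>pos_part_step_inner\<close> requires; the passage to
      \<open>\<mu>_avg t\<close> is estimate \<open>1\<close>.\<close>
    have "\<epsilon> \<bullet> (\<nu> t i - \<theta>) \<le> (\<alpha> t *\<^sub>R ?u) \<bullet> (\<nu> t i - \<theta>) + (norm (\<alpha> t *\<^sub>R ?u))\<^sup>2 / ?w"
      unfolding \<epsilon>_def mu_Suc \<nu>_def by (rule pos_part_step_inner[OF mix_mu_nonneg \<theta> wb(2)])
    moreover have "(norm (\<alpha> t *\<^sub>R ?u))\<^sup>2 / ?w \<le> c\<^sup>2 / r * (\<alpha> t)\<^sup>2"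
    proof -
      have "(norm (\<alpha> t *\<^sub>R ?u))\<^sup>2 \<le> (\<alpha> t * c)\<^sup>2" using u al by (intro power_mono) (auto simp: mult_left_mono)
      then have "(norm (\<alpha> t *\<^sub>R ?u))\<^sup>2 / ?w \<le> (\<alpha> t * c)\<^sup>2 / r"
        using wb r_bounds by (intro frac_le) auto
      then show ?thesis by (simp add: power_mult_distrib mult.commute)
    qed
    ultimately have 2: "\<epsilon> \<bullet> (\<nu> t i - \<theta>) \<le> \<alpha> t * (?u \<bullet> (\<nu> t i - \<theta>)) + c\<^sup>2 / r * (\<alpha> t)\<^sup>2" by simp
    have 3: "?u \<bullet> (\<nu> t i - \<mu>_avg t) \<le> c * e * \<alpha> t"
    proof -
      have "?u \<bullet> (\<nu> t i - \<mu>_avg t) \<le> norm ?u * norm (\<nu> t i - \<mu>_avg t)" by (rule norm_cauchy_schwarz)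
      also have "\<dots> \<le> c * (e * \<alpha> t)" using u e(2)[OF t, of i] c(1) by (intro mult_mono) auto
      finally show ?thesis by (simp add: mult_ac)
    qed
    have 4: "(?u - ?v) \<bullet> (\<mu>_avg t - \<theta>) \<le> (h + real CARD('n) * e) * (q + 1) * (\<alpha> t * p t * (p t + norm \<theta>))"
    proof -
      have "?u - ?v = (\<eta> t i - ?gb) - (\<beta> t * ?w) *\<^sub>R (\<nu> t i - \<mu>_avg t)"
        by (simp add: mix_mu_eq algebra_simps)
      then have "norm (?u - ?v) \<le> norm (\<eta> t i - ?gb) + norm ((\<beta> t * ?w) *\<^sub>R (\<nu> t i - \<mu>_avg t))"
        by (metis norm_triangle_ineq4)
      also have "norm ((\<beta> t * ?w) *\<^sub>R (\<nu> t i - \<mu>_avg t)) = (\<beta> t * ?w) * norm (\<nu> t i - \<mu>_avg t)"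
        using beta_bounds[of t] wb by simp
      also have "\<dots> \<le> (1 * real CARD('n)) * (e * \<alpha> t)"
        using beta_bounds[of t] wb e(2)[OF t, of i] by (intro mult_mono) auto
      also have "\<dots> \<le> real CARD('n) * e * (p t * \<alpha> t)"
        using mult_left_mono[of "1 * \<alpha> t" "p t * \<alpha> t" "real CARD('n) * e"] p al e(1) by (simp add: mult_ac)
      also have "norm (\<eta> t i - ?gb) \<le> h * (p t * \<alpha> t)" by (rule h(2)[OF t])
      finally have a: "norm (?u - ?v) \<le> (h + real CARD('n) * e) * (p t * \<alpha> t)"
        by (simp add: distrib_right)
      have "norm (\<mu>_avg t - \<theta>) \<le> q * p t + norm \<theta>"
        using norm_triangle_ineq4[of "\<mu>_avg t" \<theta>] q(2)[OF t] by linarith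
      also have "\<dots> \<le> (q + 1) * (p t + norm \<theta>)"
        using q(1) p by (simp add: algebra_simps)
      finally have b: "norm (\<mu>_avg t - \<theta>) \<le> (q + 1) * (p t + norm \<theta>)" .
      have "(?u - ?v) \<bullet> (\<mu>_avg t - \<theta>) \<le> norm (?u - ?v) * norm (\<mu>_avg t - \<theta>)" by (rule norm_cauchy_schwarz)
      also have "\<dots> \<le> ((h + real CARD('n) * e) * (p t * \<alpha> t)) * ((q + 1) * (p t + norm \<theta>))"
        using a b h(1) e(1) p al by (intro mult_mono) auto
      finally show ?thesis by (simp add: mult_ac)
    qed
    have "?u \<bullet> (\<nu> t i - \<theta>) = ?v \<bullet> (\<mu>_avg t - \<theta>) + ?u \<bullet> (\<nu> t i - \<mu>_avg t) + (?u - ?v) \<bullet> (\<mu>_avg t - \<theta>)"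
      by (simp only: inner_diff_left inner_diff_right)
    also have "\<dots> \<le> ?v \<bullet> (\<mu>_avg t - \<theta>) + c * e * \<alpha> t
        + (h + real CARD('n) * e) * (q + 1) * (\<alpha> t * p t * (p t + norm \<theta>))"
      using 3 4 by linarith
    finally have "\<alpha> t * (?u \<bullet> (\<nu> t i - \<theta>)) \<le> \<alpha> t * (?v \<bullet> (\<mu>_avg t - \<theta>) + c * e * \<alpha> t
        + (h + real CARD('n) * e) * (q + 1) * (\<alpha> t * p t * (p t + norm \<theta>)))"
      using al by (intro mult_left_mono) auto
    moreover have "\<epsilon> \<bullet> (\<mu>_avg t - \<theta>) = \<epsilon> \<bullet> (\<nu> t i - \<theta>) + \<epsilon> \<bullet> (\<mu>_avg t - \<nu> t i)"
      by (simp add: inner_diff_right)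
    ultimately have "\<epsilon> \<bullet> (\<mu>_avg t - \<theta>) \<le> \<alpha> t * (?v \<bullet> (\<mu>_avg t - \<theta>))
        + (2 * (c * e) + c\<^sup>2 / r) * (\<alpha> t)\<^sup>2
        + (h + real CARD('n) * e) * (q + 1) * ((\<alpha> t)\<^sup>2 * p t * (p t + norm \<theta>))"
      using 1 2 by (simp add: distrib_left distrib_right power2_eq_square mult_ac)
    moreover have "(2 * (c * e) + c\<^sup>2 / r) * (\<alpha> t)\<^sup>2 \<le> (2 * (c * e) + c\<^sup>2 / r) * ((\<alpha> t)\<^sup>2 * p t * (p t + norm \<theta>))"
    proof -
      have "1 \<le> p t * (p t + norm \<theta>)"
        using p mult_mono[of 1 "p t" 1 "p t + norm \<theta>"] by (simp add: add_increasing2)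
      then have "(\<alpha> t)\<^sup>2 * 1 \<le> (\<alpha> t)\<^sup>2 * (p t * (p t + norm \<theta>))" by (intro mult_left_mono) auto
      then show ?thesis using c(1) e(1) r_bounds by (intro mult_left_mono) (auto simp: mult.assoc)
    qed
    moreover have "K * (\<alpha> t)\<^sup>2 * p t * (p t + norm \<theta>)
        = (2 * (c * e) + c\<^sup>2 / r) * ((\<alpha> t)\<^sup>2 * p t * (p t + norm \<theta>))
          + (h + real CARD('n) * e) * (q + 1) * ((\<alpha> t)\<^sup>2 * p t * (p t + norm \<theta>))"
      unfolding K_def by (simp only: distrib_right mult.assoc)
    ultimately show ?thesis unfolding \<epsilon>_def by linarith
  qed
  then show ?thesis using K0 by blast
qed

text \<open>Mixing preserves totals, so the average moves by the mean of the agents' increments.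
  Expanding the square, \<open>dual_step_agent\<close> bounds the cross term, and the remaining
  square is of order \<open>(\<alpha> t)^2\<close> because clipping does not enlarge an
  increment.\<close>

lemma dual_step:
  "\<exists>K\<ge>0. \<forall>t\<ge>1. \<forall>\<theta>. (\<forall>k. 0 \<le> \<theta> $ k) \<longrightarrow>
    real CARD('n) * (norm (\<mu>_avg (Suc t) - \<theta>))\<^sup>2
    \<le> real CARD('n) * (norm (\<mu>_avg t - \<theta>))\<^sup>2
      + 2 * \<alpha> t * ((constr t - (real CARD('n) * \<beta> t) *\<^sub>R \<mu>_avg t) \<bullet> (\<mu>_avg t - \<theta>))
      + K * (\<alpha> t)\<^sup>2 * p t * (p t + norm \<theta>)"
proof -
  let ?n = "real CARD('n)"
  obtain c where c: "c \<ge> 0" "\<And>t i. t \<ge> 1 \<Longrightarrow> norm (\<eta> t i - \<beta> t *\<^sub>R mix (A t) (\<mu> t) i) \<le> c"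
    using dual_increment_bound by blast
  obtain K where K: "K \<ge> 0" "\<And>t \<theta> i. t \<ge> 1 \<Longrightarrow> (\<And>k. 0 \<le> \<theta> $ k) \<Longrightarrow>
    (\<mu> (Suc t) i - mix (A t) (\<mu> t) i) \<bullet> (\<mu>_avg t - \<theta>)
    \<le> \<alpha> t * (((1 / real CARD('n)) *\<^sub>R constr t - (\<beta> t * w (Suc t) i) *\<^sub>R \<mu>_avg t) \<bullet> (\<mu>_avg t - \<theta>))
      + K * (\<alpha> t)\<^sup>2 * p t * (p t + norm \<theta>)" using dual_step_agent by metis
  have "?n * (norm (\<mu>_avg (Suc t) - \<theta>))\<^sup>2
      \<le> ?n * (norm (\<mu>_avg t - \<theta>))\<^sup>2
        + 2 * \<alpha> t * ((constr t - (?n * \<beta> t) *\<^sub>R \<mu>_avg t) \<bullet> (\<mu>_avg t - \<theta>))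
        + (2 * ?n * K + ?n * c\<^sup>2) * (\<alpha> t)\<^sup>2 * p t * (p t + norm \<theta>)"
    if t: "t \<ge> 1" and \<theta>: "\<And>k. 0 \<le> \<theta> $ k" for t \<theta>
  proof -
    have p: "1 \<le> p t" by (rule p_ge_1[OF t])
    have al: "0 < \<alpha> t" using alpha_bounds by auto
    have n: "?n > 0" using N_ge_1 by linarith
    define \<epsilon> where "\<epsilon> i = \<mu> (Suc t) i - mix (A t) (\<mu> t) i" for i
    let ?S = "\<Sum>i\<in>UNIV. \<epsilon> i" and ?P = "p t * (p t + norm \<theta>)"
    have "norm (\<epsilon> i) \<le> \<alpha> t * c" for i
    proof -
      have "norm (\<epsilon> i) \<le> norm (\<alpha> t *\<^sub>R (\<eta> t i - \<beta> t *\<^sub>R mix (A t) (\<mu> t) i))"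
        unfolding \<epsilon>_def mu_Suc by (rule norm_pos_part_add_diff_le[OF mix_mu_nonneg])
      also have "\<dots> \<le> \<alpha> t * c" using c(2)[OF t] al by (simp add: mult_left_mono)
      finally show ?thesis .
    qed
    then have "norm ?S \<le> (\<Sum>i\<in>(UNIV::'n set). \<alpha> t * c)" by (intro sum_norm_le)
    then have "(norm ?S)\<^sup>2 \<le> (?n * (\<alpha> t * c))\<^sup>2" by (intro power_mono) auto
    then have "(1 / ?n) * (norm ?S)\<^sup>2 \<le> (1 / ?n) * (?n * (\<alpha> t * c))\<^sup>2" by (intro mult_left_mono) auto
    also have "\<dots> = ?n * c\<^sup>2 * ((\<alpha> t)\<^sup>2 * 1)" using n by (simp add: power2_eq_square)
    also have "\<dots> \<le> ?n * c\<^sup>2 * ((\<alpha> t)\<^sup>2 * ?P)"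
      using p mult_mono[of 1 "p t" 1 "p t + norm \<theta>"] by (intro mult_left_mono) (auto simp: add_increasing2)
    finally have sq: "(1 / ?n) * (norm ?S)\<^sup>2 \<le> ?n * c\<^sup>2 * ((\<alpha> t)\<^sup>2 * ?P)" .
    have "?S \<bullet> (\<mu>_avg t - \<theta>) = (\<Sum>i\<in>UNIV. \<epsilon> i \<bullet> (\<mu>_avg t - \<theta>))" by (rule inner_sum_left)
    also have "\<dots> \<le> (\<Sum>i\<in>UNIV. \<alpha> t * (((1 / ?n) *\<^sub>R constr t - (\<beta> t * w (Suc t) i) *\<^sub>R \<mu>_avg t) \<bullet> (\<mu>_avg t - \<theta>))
        + K * (\<alpha> t)\<^sup>2 * p t * (p t + norm \<theta>))"
      unfolding \<epsilon>_def using K(2)[OF t \<theta>] by (intro sum_mono)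
    also have "\<dots> = \<alpha> t * ((\<Sum>i\<in>UNIV. (1 / ?n) *\<^sub>R constr t - (\<beta> t * w (Suc t) i) *\<^sub>R \<mu>_avg t) \<bullet> (\<mu>_avg t - \<theta>))
        + ?n * (K * (\<alpha> t)\<^sup>2 * ?P)"
      by (simp add: sum.distrib inner_sum_left sum_distrib_left mult.assoc)
    also have "(\<Sum>i\<in>UNIV. (1 / ?n) *\<^sub>R constr t - (\<beta> t * w (Suc t) i) *\<^sub>R \<mu>_avg t)
        = constr t - (?n * \<beta> t) *\<^sub>R \<mu>_avg t"
    proof -
      have "(\<Sum>i\<in>UNIV. (\<beta> t * w (Suc t) i) *\<^sub>R \<mu>_avg t) = (\<beta> t * (\<Sum>i\<in>UNIV. w (Suc t) i)) *\<^sub>R \<mu>_avg t"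
        by (simp add: scaleR_sum_left[symmetric] sum_distrib_left)
      then show ?thesis using n by (simp add: sum_subtractf sum_constant_scaleR w_sum mult.commute del: sum_constant)
    qed
    finally have lin: "?S \<bullet> (\<mu>_avg t - \<theta>)
        \<le> \<alpha> t * ((constr t - (?n * \<beta> t) *\<^sub>R \<mu>_avg t) \<bullet> (\<mu>_avg t - \<theta>)) + ?n * (K * (\<alpha> t)\<^sup>2 * ?P)" .
    have expand: "(norm (v + c *\<^sub>R u))\<^sup>2 = (norm v)\<^sup>2 + 2 * c * (u \<bullet> v) + c\<^sup>2 * (norm u)\<^sup>2"
      for u v :: "real ^ 'm" and c
      unfolding power2_norm_eq_inner
      by (simp add: inner_add_left inner_add_right inner_commute power2_eq_square)
    have "\<mu>_avg (Suc t) - \<theta> = (\<mu>_avg t - \<theta>) + (1 / ?n) *\<^sub>R ?S" unfolding mu_avg_Suc \<epsilon>_def by simp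
    then have "(norm (\<mu>_avg (Suc t) - \<theta>))\<^sup>2
        = (norm (\<mu>_avg t - \<theta>))\<^sup>2 + 2 * (1 / ?n) * (?S \<bullet> (\<mu>_avg t - \<theta>)) + (1 / ?n)\<^sup>2 * (norm ?S)\<^sup>2"
      by (simp only: expand)
    then have "?n * (norm (\<mu>_avg (Suc t) - \<theta>))\<^sup>2
        = ?n * (norm (\<mu>_avg t - \<theta>))\<^sup>2 + 2 * (?S \<bullet> (\<mu>_avg t - \<theta>)) + (1 / ?n) * (norm ?S)\<^sup>2"
      using n by (simp add: distrib_left power2_eq_square)
    with lin sq show ?thesis by (simp add: distrib_right mult.assoc)
  qed
  then show ?thesis using K(1) by (intro exI[of _ "2 * ?n * K + ?n * c\<^sup>2"]) auto
qed

text \<open>The factor \<open>CARD('n)\<close> offsets the \<open>1 / CARD('n)\<close> of the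
  averaged update: primal and dual cross terms then both carry \<open>2 * \<alpha> t\<close>, so
  that \<open>\<mu>_avg t \<bullet> constr t\<close> cancels and
  \<open>\<theta> \<bullet> constr t\<close> remains.\<close>

definition lyapunov :: "'a ^ 'n \<Rightarrow> real ^ 'm \<Rightarrow> nat \<Rightarrow> real" where
  "lyapunov z \<theta> t = primal_dist z t + real CARD('n) * (norm (\<mu>_avg t - \<theta>))\<^sup>2"

text \<open>Feasibility of \<open>z\<close> and \<open>\<mu>_avg \<ge> 0\<close> allow
  \<open>\<mu>_avg t \<bullet> agent_sum g z\<close> to be dropped; completing the square in the
  regularization leaves only \<open>(norm \<theta>)^2\<close>. Multiplication by
  \<open>sqrt t\<close>, the inverse of \<open>\<alpha> t\<close>, frees the objective from the step
  size, as the plain time average demands.\<close>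

lemma lyapunov_step:
  "\<exists>K\<ge>0. \<forall>t\<ge>1. \<forall>z\<in>feasible_set X g. \<forall>\<theta>. (\<forall>k. 0 \<le> \<theta> $ k) \<longrightarrow>
    2 * (cost t - agent_sum f z + \<theta> \<bullet> constr t - (real CARD('n) / 2 * \<beta> t) * (norm \<theta>)\<^sup>2)
    \<le> sqrt (real t) * (lyapunov z \<theta> t - lyapunov z \<theta> (Suc t)) + K * \<alpha> t * p t * (p t + norm \<theta>)"
proof -
  let ?n = "real CARD('n)"
  obtain K1 where K1: "K1 \<ge> 0" "\<And>t z. t \<ge> 1 \<Longrightarrow> z \<in> prod_set X \<Longrightarrow>
    2 * \<alpha> t * (cost t - agent_sum f z + \<mu>_avg t \<bullet> (constr t - agent_sum g z))
    \<le> primal_dist z t - primal_dist z (Suc t) + K1 * (p t * \<alpha> t)\<^sup>2" using primal_step by metis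
  obtain K2 where K2: "K2 \<ge> 0" "\<And>t \<theta>. t \<ge> 1 \<Longrightarrow> (\<And>k. 0 \<le> \<theta> $ k) \<Longrightarrow>
    ?n * (norm (\<mu>_avg (Suc t) - \<theta>))\<^sup>2 \<le> ?n * (norm (\<mu>_avg t - \<theta>))\<^sup>2
      + 2 * \<alpha> t * ((constr t - (?n * \<beta> t) *\<^sub>R \<mu>_avg t) \<bullet> (\<mu>_avg t - \<theta>))
      + K2 * (\<alpha> t)\<^sup>2 * p t * (p t + norm \<theta>)" using dual_step by metis
  have "2 * (cost t - agent_sum f z + \<theta> \<bullet> constr t - (?n / 2 * \<beta> t) * (norm \<theta>)\<^sup>2)
    \<le> sqrt (real t) * (lyapunov z \<theta> t - lyapunov z \<theta> (Suc t)) + (K1 + K2) * \<alpha> t * p t * (p t + norm \<theta>)"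
    if t: "t \<ge> 1" and z: "z \<in> feasible_set X g" and \<theta>: "\<And>k. 0 \<le> \<theta> $ k" for t z \<theta>
  proof -
    have p: "1 \<le> p t" by (rule p_ge_1[OF t])
    have al: "0 < \<alpha> t" using alpha_bounds by auto
    have be: "0 < \<beta> t" using beta_bounds by auto
    let ?m = "\<mu>_avg t" and ?L = "cost t - agent_sum f z + \<theta> \<bullet> constr t - (?n / 2 * \<beta> t) * (norm \<theta>)\<^sup>2"
    have zX: "z \<in> prod_set X" and gz: "agent_sum g z \<le> 0" using z by (auto simp: feasible_set_def)
    have 1: "?m \<bullet> agent_sum g z \<le> 0"
      unfolding inner_vec_def using gz mu_avg_nonneg
      by (intro sum_nonpos) (simp add: mult_nonneg_nonpos less_eq_vec_def)
    have 2: "(norm ?m)\<^sup>2 - (norm \<theta>)\<^sup>2 \<le> 2 * (?m \<bullet> (?m - \<theta>))"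
      using inner_ge_zero[of "?m - \<theta>"] unfolding power2_norm_eq_inner
      by (simp add: inner_diff_left inner_diff_right inner_commute)
    have "(?n / 2 * \<beta> t) * ((norm ?m)\<^sup>2 - (norm \<theta>)\<^sup>2) \<le> (?n / 2 * \<beta> t) * (2 * (?m \<bullet> (?m - \<theta>)))"
      by (intro mult_left_mono[OF 2]) (use be in auto)
    moreover have "0 \<le> (?n / 2 * \<beta> t) * (norm ?m)\<^sup>2" using be by simp
    ultimately have 3: "- ((?n / 2 * \<beta> t) * (norm \<theta>)\<^sup>2) \<le> ?n * \<beta> t * (?m \<bullet> (?m - \<theta>))"
      by (simp add: right_diff_distrib)
    have "?L \<le> (cost t - agent_sum f z + ?m \<bullet> (constr t - agent_sum g z))
        - (constr t - (?n * \<beta> t) *\<^sub>R ?m) \<bullet> (?m - \<theta>)"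
      using 1 3 by (simp add: inner_diff_left inner_diff_right inner_commute right_diff_distrib)
    then have "2 * \<alpha> t * ?L \<le> 2 * \<alpha> t * ((cost t - agent_sum f z + ?m \<bullet> (constr t - agent_sum g z))
        - (constr t - (?n * \<beta> t) *\<^sub>R ?m) \<bullet> (?m - \<theta>))"
      using al by (intro mult_left_mono) auto
    also have "\<dots> \<le> lyapunov z \<theta> t - lyapunov z \<theta> (Suc t) + K1 * (p t * \<alpha> t)\<^sup>2
        + K2 * (\<alpha> t)\<^sup>2 * p t * (p t + norm \<theta>)"
      using K1(2)[OF t zX] K2(2)[OF t, of \<theta>, OF \<theta>] by (simp add: lyapunov_def right_diff_distrib)
    also have "K1 * (p t * \<alpha> t)\<^sup>2 \<le> K1 * (\<alpha> t)\<^sup>2 * p t * (p t + norm \<theta>)"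
    proof -
      have "(p t * \<alpha> t)\<^sup>2 \<le> (\<alpha> t)\<^sup>2 * p t * (p t + norm \<theta>)"
        using p al by (simp add: power2_eq_square algebra_simps)
      then have "K1 * (p t * \<alpha> t)\<^sup>2 \<le> K1 * ((\<alpha> t)\<^sup>2 * p t * (p t + norm \<theta>))"
        using K1(1) by (rule mult_left_mono)
      then show ?thesis by (simp only: mult.assoc)
    qed
    finally have "2 * \<alpha> t * ?L \<le> lyapunov z \<theta> t - lyapunov z \<theta> (Suc t)
        + (K1 + K2) * (\<alpha> t)\<^sup>2 * p t * (p t + norm \<theta>)" by (simp add: distrib_right)
    then have "sqrt (real t) * (2 * \<alpha> t * ?L) \<le> sqrt (real t) * (lyapunov z \<theta> t - lyapunov z \<theta> (Suc t)
        + (K1 + K2) * (\<alpha> t)\<^sup>2 * p t * (p t + norm \<theta>))" by (intro mult_left_mono) auto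
    moreover have sa: "sqrt (real t) * \<alpha> t = 1" using t by (simp add: alpha_step_def)
    have "sqrt (real t) * (2 * \<alpha> t * ?L) = 2 * ((sqrt (real t) * \<alpha> t) * ?L)" by (simp only: mult_ac)
    moreover have "sqrt (real t) * ((K1 + K2) * (\<alpha> t)\<^sup>2 * p t * (p t + norm \<theta>))
        = (sqrt (real t) * \<alpha> t) * ((K1 + K2) * \<alpha> t * p t * (p t + norm \<theta>))"
      by (simp only: power2_eq_square mult_ac)
    ultimately show ?thesis unfolding sa distrib_left[of "sqrt (real t)"] by simp
  qed
  then show ?thesis using K1(1) K2(1) by (intro exI[of _ "K1 + K2"]) auto
qed

end

section \<open>Rates\<close>

context dopp
begin

definition rate :: "nat \<Rightarrow> real" where "rate T = real T powr (1/2 + 2 * \<kappa>)"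

lemma rate_eq: "T \<ge> 1 \<Longrightarrow> sqrt (real T) * (p T)\<^sup>2 = rate T"
proof -
  assume "T \<ge> 1"
  have "(p T)\<^sup>2 = real T powr (2 * \<kappa>)" by (simp add: p_def power2_eq_square flip: powr_add)
  then show ?thesis by (simp only: rate_def powr_add powr_half_sqrt[OF of_nat_0_le_iff])
qed

lemma powr_divide_self: "T \<ge> 1 \<Longrightarrow> real T powr c / real T = real T powr (c - 1)"
  by (simp add: powr_diff)

lemma primal_dist_bound:
  assumes z: "z \<in> prod_set X"
  shows "\<exists>c\<ge>0. \<forall>t. primal_dist z t \<le> c"
proof -
  have "\<exists>b. \<forall>v\<in>X i. norm v \<le> b" for i using compact_imp_bounded[OF X(2)] bounded_iff by blast
  then obtain b where b: "\<And>i v. v \<in> X i \<Longrightarrow> norm v \<le> b i" by metis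
  have "primal_dist z t \<le> (\<Sum>i\<in>UNIV. (b i + b i)\<^sup>2)" for t
    unfolding primal_dist_def
  proof (intro sum_mono power_mono)
    fix i
    have "norm (x t i) \<le> b i" "norm (z $ i) \<le> b i" using b x_in z by (auto simp: prod_set_def)
    then show "norm (x t i - z $ i) \<le> b i + b i"
      using norm_triangle_ineq4[of "x t i" "z $ i"] by linarith
  qed auto
  then show ?thesis by (intro exI[of _ "\<Sum>i\<in>UNIV. (b i + b i)\<^sup>2"]) (auto intro: sum_nonneg)
qed

lemma lyapunov_nonneg: "0 \<le> lyapunov z \<theta> t"
  by (auto simp: lyapunov_def primal_dist_def intro!: add_nonneg_nonneg sum_nonneg)

lemma sum_alpha_le: "(\<Sum>t=1..T. \<alpha> t) \<le> 2 * sqrt (real T)"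
proof -
  have "(\<Sum>t=1..T. \<alpha> t) = (\<Sum>t=1..T. real t powr (- (1/2)))" by (intro sum.cong) (auto simp: alpha_powr)
  also have "\<dots> \<le> real T powr (1 - 1/2) / (1 - 1/2)" by (rule sum_powr_le) auto
  finally show ?thesis by (simp add: powr_half_sqrt)
qed

lemma sum_beta_bounds:
  "real T powr (1 - \<kappa>) \<le> (\<Sum>t=1..T. \<beta> t)" "(\<Sum>t=1..T. \<beta> t) \<le> 2 * real T powr (1 - \<kappa>)"
proof -
  have eq: "(\<Sum>t=1..T. \<beta> t) = (\<Sum>t=1..T. real t powr (- \<kappa>))" by (intro sum.cong) (auto simp: beta_powr)
  have "real T powr (- \<kappa>) \<le> real t powr (- \<kappa>)" if "t \<in> {1..T}" for t
    using that kappa by (intro powr_mono2') auto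
  then have "(\<Sum>t\<in>{1..T}. real T powr (- \<kappa>)) \<le> (\<Sum>t=1..T. \<beta> t)" unfolding eq by (rule sum_mono)
  moreover have "(\<Sum>t\<in>{1..T}. real T powr (- \<kappa>)) = real T powr (1 - \<kappa>)"
    by (cases "T = 0") (auto simp: powr_diff powr_minus_divide)
  ultimately show "real T powr (1 - \<kappa>) \<le> (\<Sum>t=1..T. \<beta> t)" by simp
  have "(\<Sum>t=1..T. \<beta> t) \<le> real T powr (1 - \<kappa>) / (1 - \<kappa>)"
    unfolding eq using kappa by (intro sum_powr_le) auto
  also have "\<dots> \<le> real T powr (1 - \<kappa>) / (1/2)" using kappa by (intro divide_left_mono) auto
  finally show "(\<Sum>t=1..T. \<beta> t) \<le> 2 * real T powr (1 - \<kappa>)" by simp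
qed

text \<open>\<open>K\<close> does not depend on \<open>\<theta>\<close>, so the comparison
  multiplier may be chosen afterwards, depending on \<open>T\<close> and on the accumulated
  constraints. Its permitted size is that of \<open>\<mu>_avg\<close> itself, so it affects the
  bound \<open>M * (p T)^2\<close> of \<open>lyapunov\<close> only through the constant.\<close>

lemma regret_bound:
  assumes z: "z \<in> feasible_set X g" and L: "0 \<le> L"
  shows "\<exists>K\<ge>0. \<forall>T\<ge>1. \<forall>\<theta>. (\<forall>k. 0 \<le> \<theta> $ k) \<longrightarrow> norm \<theta> \<le> L * p T \<longrightarrow>
    (\<Sum>t=1..T. cost t - agent_sum f z) + \<theta> \<bullet> (\<Sum>t=1..T. constr t)
      - real CARD('n) / 2 * (norm \<theta>)\<^sup>2 * (\<Sum>t=1..T. \<beta> t) \<le> K * rate T"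
proof -
  let ?n = "real CARD('n)"
  obtain K where K: "K \<ge> 0" "\<And>t \<theta>. t \<ge> 1 \<Longrightarrow> (\<And>k. 0 \<le> \<theta> $ k) \<Longrightarrow>
    2 * (cost t - agent_sum f z + \<theta> \<bullet> constr t - (?n / 2 * \<beta> t) * (norm \<theta>)\<^sup>2)
    \<le> sqrt (real t) * (lyapunov z \<theta> t - lyapunov z \<theta> (Suc t)) + K * \<alpha> t * p t * (p t + norm \<theta>)"
    using lyapunov_step z by metis
  have zX: "z \<in> prod_set X" using z by (simp add: feasible_set_def)
  obtain \<delta> where \<delta>: "\<delta> \<ge> 0" "\<And>t. primal_dist z t \<le> \<delta>" using primal_dist_bound[OF zX] by blast
  obtain q where q: "q \<ge> 0" "\<And>t. t \<ge> 1 \<Longrightarrow> norm (\<mu>_avg t) \<le> q * p t" using mu_avg_bound by blast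
  define M where "M = \<delta> + ?n * (q + L)\<^sup>2"
  define K' where "K' = (M + 2 * (K * (1 + L))) / 2"
  have "(\<Sum>t=1..T. cost t - agent_sum f z) + \<theta> \<bullet> (\<Sum>t=1..T. constr t)
      - ?n / 2 * (norm \<theta>)\<^sup>2 * (\<Sum>t=1..T. \<beta> t) \<le> K' * rate T"
    if T: "T \<ge> 1" and \<theta>: "\<And>k. 0 \<le> \<theta> $ k" "norm \<theta> \<le> L * p T" for T \<theta>
  proof -
    have pT: "1 \<le> p T" by (rule p_ge_1[OF T])
    have D: "lyapunov z \<theta> t \<le> M * (p T)\<^sup>2" if t: "t \<in> {1..T}" for t
    proof -
      have "norm (\<mu>_avg t) \<le> q * p T"
        using q(2)[of t] t mult_left_mono[OF p_mono[of t T] q(1)] by force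
      then have "norm (\<mu>_avg t - \<theta>) \<le> (q + L) * p T"
        using norm_triangle_ineq4[of "\<mu>_avg t" \<theta>] \<theta>(2) by (simp add: distrib_right)
      then have "(norm (\<mu>_avg t - \<theta>))\<^sup>2 \<le> ((q + L) * p T)\<^sup>2" by (intro power_mono) auto
      then have "?n * (norm (\<mu>_avg t - \<theta>))\<^sup>2 \<le> ?n * ((q + L) * p T)\<^sup>2" by (intro mult_left_mono) auto
      moreover have "\<delta> * 1 \<le> \<delta> * (p T)\<^sup>2" using \<delta>(1) pT by (intro mult_left_mono) auto
      moreover have "M * (p T)\<^sup>2 = \<delta> * (p T)\<^sup>2 + ?n * ((q + L) * p T)\<^sup>2"
        by (simp only: M_def distrib_right[of \<delta>] power_mult_distrib mult.assoc)
      ultimately show ?thesis using \<delta>(2)[of t] unfolding lyapunov_def by linarith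
    qed
    have tele: "(\<Sum>t=1..T. sqrt (real t) * (lyapunov z \<theta> t - lyapunov z \<theta> (Suc t))) \<le> sqrt (real T) * (M * (p T)\<^sup>2)"
      by (rule weighted_telescoping[OF D lyapunov_nonneg _ _ T]) auto
    have "K * \<alpha> t * p t * (p t + norm \<theta>) \<le> \<alpha> t * (K * (1 + L) * (p T)\<^sup>2)" if t: "t \<in> {1..T}" for t
    proof -
      have p: "1 \<le> p t" "p t \<le> p T" using t p_ge_1[of t] p_mono[of t T] by auto
      have "p t * (p t + norm \<theta>) \<le> p T * (p T + L * p T)" using p \<theta>(2) by (intro mult_mono add_mono) auto
      then have "\<alpha> t * K * (p t * (p t + norm \<theta>)) \<le> \<alpha> t * K * (p T * (p T + L * p T))"
        using alpha_bounds[of t] K(1) by (intro mult_left_mono) auto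
      then show ?thesis by (simp add: power2_eq_square algebra_simps)
    qed
    then have "(\<Sum>t=1..T. K * \<alpha> t * p t * (p t + norm \<theta>)) \<le> (\<Sum>t=1..T. \<alpha> t * (K * (1 + L) * (p T)\<^sup>2))"
      by (rule sum_mono)
    also have "\<dots> = (\<Sum>t=1..T. \<alpha> t) * (K * (1 + L) * (p T)\<^sup>2)" by (rule sum_distrib_right[symmetric])
    also have "\<dots> \<le> (2 * sqrt (real T)) * (K * (1 + L) * (p T)\<^sup>2)"
      using K(1) L by (intro mult_right_mono sum_alpha_le) auto
    finally have err: "(\<Sum>t=1..T. K * \<alpha> t * p t * (p t + norm \<theta>))
        \<le> (2 * sqrt (real T)) * (K * (1 + L) * (p T)\<^sup>2)" .
    have "2 * ((\<Sum>t=1..T. cost t - agent_sum f z) + \<theta> \<bullet> (\<Sum>t=1..T. constr t)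
        - ?n / 2 * (norm \<theta>)\<^sup>2 * (\<Sum>t=1..T. \<beta> t))
      = (\<Sum>t=1..T. 2 * (cost t - agent_sum f z + \<theta> \<bullet> constr t - (?n / 2 * \<beta> t) * (norm \<theta>)\<^sup>2))"
    proof -
      have "?n / 2 * (norm \<theta>)\<^sup>2 * (\<Sum>t=1..T. \<beta> t) = (\<Sum>t=1..T. (?n / 2 * \<beta> t) * (norm \<theta>)\<^sup>2)"
        unfolding sum_distrib_left by (intro sum.cong) auto
      then show ?thesis
        by (simp only: sum_distrib_left[symmetric] sum.distrib sum_subtractf inner_sum_right)
    qed
    also have "\<dots> \<le> (\<Sum>t=1..T. sqrt (real t) * (lyapunov z \<theta> t - lyapunov z \<theta> (Suc t))
        + K * \<alpha> t * p t * (p t + norm \<theta>))" using K(2)[OF _ \<theta>(1)] by (intro sum_mono) auto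
    also have "\<dots> \<le> sqrt (real T) * (M * (p T)\<^sup>2) + (2 * sqrt (real T)) * (K * (1 + L) * (p T)\<^sup>2)"
      unfolding sum.distrib using tele err by linarith
    also have "\<dots> = 2 * (K' * rate T)"
      unfolding K'_def rate_eq[OF T, symmetric] by (simp add: distrib_right algebra_simps)
    finally show ?thesis by simp
  qed
  moreover have "0 \<le> K'" using \<delta>(1) K(1) L by (simp add: K'_def M_def)
  ultimately show ?thesis by blast
qed

text \<open>The multiplier inequality is applied at every iterate: iterates lie in
  \<open>prod_set X\<close> but need not be feasible, so the cost error may be negative, though by
  no more than \<open>norm l\<close> times the violation.\<close>

lemma constr_sum_bound:
  assumes z: "z \<in> feasible_set X g" and l: "\<And>k. 0 \<le> l $ k"
    "\<And>v. v \<in> prod_set X \<Longrightarrow> agent_sum f z \<le> agent_sum f v + l \<bullet> agent_sum g v"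
  shows "\<exists>C\<ge>0. \<forall>T\<ge>1. norm (pos_part (\<Sum>t=1..T. constr t))
    \<le> C * (real T powr (1 - \<kappa>) + real T powr (3/4 + \<kappa>/2))"
    and "T \<ge> 1 \<Longrightarrow> - (norm l * norm (pos_part (\<Sum>t=1..T. constr t))) \<le> (\<Sum>t=1..T. cost t - agent_sum f z)"
proof -
  let ?n = "real CARD('n)" and ?H = "\<lambda>T. \<Sum>t=1..T. constr t"
  have lower: "- (norm l * norm (pos_part (?H T))) \<le> (\<Sum>t=1..T. cost t - agent_sum f z)" for T
  proof -
    have "- (l \<bullet> constr t) \<le> cost t - agent_sum f z" for t
    proof -
      have "(\<chi> i. x t i) \<in> prod_set X" using x_in by (simp add: prod_set_def)
      from l(2)[OF this] show ?thesis by (simp add: agent_sum_def cost_def constr_def)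
    qed
    then have "(\<Sum>t=1..T. - (l \<bullet> constr t)) \<le> (\<Sum>t=1..T. cost t - agent_sum f z)" by (intro sum_mono)
    moreover have "(\<Sum>t=1..T. - (l \<bullet> constr t)) = - (l \<bullet> ?H T)" by (simp add: sum_negf inner_sum_right)
    ultimately show ?thesis using inner_le_norm_pos_part[of l "?H T", OF l(1)] by linarith
  qed
  then show "- (norm l * norm (pos_part (?H T))) \<le> (\<Sum>t=1..T. cost t - agent_sum f z)" if "T \<ge> 1" .
  obtain b where b: "b \<ge> 0" "\<And>i v. v \<in> X i \<Longrightarrow> norm (g i v) \<le> b" using g_bounds by metis
  have constr_norm: "norm (constr t) \<le> ?n * b" for t
  proof -
    have "norm (constr t) \<le> (\<Sum>i\<in>(UNIV::'n set). b)"
      unfolding constr_def using b(2)[OF x_in] by (intro sum_norm_le)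
    then show ?thesis by simp
  qed
  obtain K where K: "K \<ge> 0" "\<And>T \<theta>. T \<ge> 1 \<Longrightarrow> (\<And>k. 0 \<le> \<theta> $ k) \<Longrightarrow> norm \<theta> \<le> b * p T \<Longrightarrow>
    (\<Sum>t=1..T. cost t - agent_sum f z) + \<theta> \<bullet> ?H T - ?n / 2 * (norm \<theta>)\<^sup>2 * (\<Sum>t=1..T. \<beta> t) \<le> K * rate T"
    using regret_bound[OF z b(1)] by metis
  \<comment> \<open>With \<open>S \<le> 2 * P\<close> the inequality reads \<open>G^2 \<le> (4 * ?n
    * norm l * P) * G + 4 * ?n * K * (P * rate T)\<close>; the two constants survive, the second
    under the root.\<close>
  define C where "C = max (4 * ?n * norm l) (sqrt (4 * ?n * K))"
  have C0: "0 \<le> C" by (simp add: C_def le_max_iff_disj)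
  have "norm (pos_part (?H T)) \<le> C * (real T powr (1 - \<kappa>) + real T powr (3/4 + \<kappa>/2))" if T: "T \<ge> 1" for T
  proof -
    define G where "G = norm (pos_part (?H T))"
    define S where "S = (\<Sum>t=1..T. \<beta> t)"
    define P where "P = real T powr (1 - \<kappa>)"
    have G0: "0 \<le> G" by (simp add: G_def)
    have P: "0 < P" using T by (simp add: P_def)
    have S12: "P \<le> S" "S \<le> 2 * P" using sum_beta_bounds[of T] by (auto simp: S_def P_def)
    have S: "P \<le> S" "S \<le> 2 * P" "0 < S" using S12 less_le_trans[OF P S12(1)] by auto
    have n: "0 < ?n" using N_ge_1 by linarith
    \<comment> \<open>For the multiple \<open>c\<close> of the positive part, the gain
      \<open>c * G^2\<close> minus the penalty \<open>?n * S * c^2 * G^2 / 2\<close> is largest at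
      this value, where it equals \<open>c * G^2 / 2\<close>.\<close>
    define c where "c = 1 / (?n * S)"
    have c: "0 < c" "c * (?n * S) = 1" using n S by (auto simp: c_def)
    let ?\<theta> = "c *\<^sub>R pos_part (?H T)"
    have "norm ?\<theta> \<le> b * p T"
    proof -
      have "G \<le> norm (?H T)" unfolding G_def by (rule norm_pos_part_le)
      also have "\<dots> \<le> (\<Sum>t\<in>{1..T}. ?n * b)" using constr_norm by (intro sum_norm_le)
      finally have "G \<le> real T * (?n * b)" by simp
      \<comment> \<open>This splitting converts the linear growth of the accumulated constraints
        into the size \<open>b * p T\<close>, for which \<open>regret_bound\<close> was
        instantiated.\<close>
      moreover have "real T = P * p T" using T by (simp add: P_def p_def flip: powr_add)
      ultimately have "G \<le> (b * p T) * (?n * P)" by (simp add: mult_ac)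
      also have "\<dots> \<le> (b * p T) * (?n * S)"
        using b(1) p_ge_1[OF T] S n by (intro mult_left_mono) auto
      finally have "c * G \<le> c * ((b * p T) * (?n * S))" using c by (intro mult_left_mono) auto
      also have "\<dots> = (c * (?n * S)) * (b * p T)" by (simp only: mult_ac)
      finally show ?thesis using c by (simp add: G_def)
    qed
    then have "(\<Sum>t=1..T. cost t - agent_sum f z) + ?\<theta> \<bullet> ?H T - ?n / 2 * (norm ?\<theta>)\<^sup>2 * S \<le> K * rate T"
      unfolding S_def using c pos_part_nonneg[of "?H T"] by (intro K(2)[OF T]) (simp_all add: less_imp_le)
    moreover have "?\<theta> \<bullet> ?H T = c * G\<^sup>2" by (simp add: pos_part_inner_self G_def)
    moreover have "?n / 2 * (norm ?\<theta>)\<^sup>2 * S = (c * (?n * S)) * (c * G\<^sup>2 / 2)"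
      by (simp add: G_def power2_eq_square)
    ultimately have "c * G\<^sup>2 \<le> 2 * (norm l * G + K * rate T)"
      using lower[of T] c by (simp add: G_def)
    then have "(?n * S) * (c * G\<^sup>2) \<le> (?n * S) * (2 * (norm l * G + K * rate T))"
      using n S by (intro mult_left_mono) auto
    moreover have "(?n * S) * (c * G\<^sup>2) = (c * (?n * S)) * G\<^sup>2" by (simp only: mult_ac)
    ultimately have "G\<^sup>2 \<le> (?n * S) * (2 * (norm l * G + K * rate T))" using c by simp
    also have "\<dots> \<le> (?n * (2 * P)) * (2 * (norm l * G + K * rate T))"
      using n S G0 K(1) by (intro mult_right_mono mult_left_mono) (auto simp: rate_def)
    also have "\<dots> = (4 * ?n * norm l * P) * G + 4 * ?n * K * (P * rate T)" by (simp add: algebra_simps)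
    finally have "G \<le> 4 * ?n * norm l * P + sqrt (4 * ?n * K * (P * rate T))"
      using n P K(1) by (intro quadratic_inequality_bound) (auto simp: rate_def)
    also have "sqrt (4 * ?n * K * (P * rate T)) = sqrt (4 * ?n * K) * real T powr (3/4 + \<kappa>/2)"
    proof -
      have "P * rate T = real T powr (3/2 + \<kappa>)" using T by (simp add: P_def rate_def flip: powr_add)
      moreover have "sqrt (real T powr (3/2 + \<kappa>)) = real T powr (3/4 + \<kappa>/2)"
        unfolding powr_half_sqrt[OF powr_ge_zero, symmetric] powr_powr
        by (rule arg_cong[of _ _ "(powr) (real T)"]) simp
      ultimately show ?thesis by (simp add: real_sqrt_mult)
    qed
    also have "4 * ?n * norm l * P + sqrt (4 * ?n * K) * real T powr (3/4 + \<kappa>/2)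
        \<le> C * P + C * real T powr (3/4 + \<kappa>/2)"
      using P by (intro add_mono mult_right_mono) (auto simp: C_def)
    finally show ?thesis by (simp add: G_def P_def distrib_left)
  qed
  then show "\<exists>C\<ge>0. \<forall>T\<ge>1. norm (pos_part (?H T)) \<le> C * (real T powr (1 - \<kappa>) + real T powr (3/4 + \<kappa>/2))"
    using C0 by blast
qed

section \<open>From accumulated quantities to time averages\<close>

lemma convex_time_average_le:
  assumes h: "convex_on (V i) h" and T: "T \<ge> 1"
  shows "h (time_average x T i) \<le> (1 / real T) * (\<Sum>t=1..T. h (x t i))"
proof -
  have "h (\<Sum>t\<in>{1..T}. (1 / real T) *\<^sub>R x t i) \<le> (\<Sum>t\<in>{1..T}. (1 / real T) * h (x t i))"
    using T subsetD[OF spaces(2) x_in] by (intro convex_on_sum[OF _ _ h]) auto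
  then show ?thesis unfolding time_average_def scaleR_sum_right sum_distrib_left .
qed

lemma average_cost_le:
  assumes T: "T \<ge> 1"
  shows "(\<Sum>i\<in>UNIV. f i (time_average x T i)) \<le> (1 / real T) * (\<Sum>t=1..T. cost t)"
proof -
  have "(\<Sum>i\<in>UNIV. f i (time_average x T i)) \<le> (\<Sum>i\<in>UNIV. (1 / real T) * (\<Sum>t=1..T. f i (x t i)))"
    by (intro sum_mono convex_time_average_le f_convex T)
  also have "\<dots> = (1 / real T) * (\<Sum>i\<in>UNIV. \<Sum>t=1..T. f i (x t i))" by (rule sum_distrib_left[symmetric])
  also have "(\<Sum>i\<in>UNIV. \<Sum>t=1..T. f i (x t i)) = (\<Sum>t=1..T. cost t)"
    unfolding cost_def by (rule sum.swap)
  finally show ?thesis .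
qed

text \<open>Jensen's inequality in each component of \<open>g\<close>, then monotonicity and
  positive homogeneity of the positive part.\<close>

lemma average_constr_le:
  assumes T: "T \<ge> 1"
  shows "norm (pos_part (\<Sum>i\<in>UNIV. g i (time_average x T i)))
    \<le> (1 / real T) * norm (pos_part (\<Sum>t=1..T. constr t))"
proof -
  have "(\<Sum>i\<in>UNIV. g i (time_average x T i)) $ k \<le> ((1 / real T) *\<^sub>R (\<Sum>t=1..T. constr t)) $ k" for k
  proof -
    have "(\<Sum>i\<in>UNIV. g i (time_average x T i) $ k) \<le> (\<Sum>i\<in>UNIV. (1 / real T) * (\<Sum>t=1..T. g i (x t i) $ k))"
      by (intro sum_mono convex_time_average_le[where h = "\<lambda>z. g _ z $ k"] g_convex T)
    also have "\<dots> = (1 / real T) * (\<Sum>i\<in>UNIV. \<Sum>t=1..T. g i (x t i) $ k)" by (rule sum_distrib_left[symmetric])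
    also have "(\<Sum>i\<in>UNIV. \<Sum>t=1..T. g i (x t i) $ k) = (\<Sum>t=1..T. constr t $ k)"
      unfolding constr_def sum_component by (rule sum.swap)
    finally show ?thesis by simp
  qed
  then have "norm (pos_part (\<Sum>i\<in>UNIV. g i (time_average x T i)))
      \<le> norm (pos_part ((1 / real T) *\<^sub>R (\<Sum>t=1..T. constr t)))" by (rule norm_pos_part_mono)
  also have "pos_part ((1 / real T) *\<^sub>R (\<Sum>t=1..T. constr t)) = (1 / real T) *\<^sub>R pos_part (\<Sum>t=1..T. constr t)"
    by (simp add: vec_eq_iff pos_part_component max_def divide_le_0_iff zero_le_divide_iff)
  finally show ?thesis by simp
qed

lemma cost_error_eq:
  "T \<ge> 1 \<Longrightarrow> cost_error f x z T = (1 / real T) * (\<Sum>t=1..T. cost t - agent_sum f z)"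
  by (simp add: cost_error_def cost_def sum_subtractf right_diff_distrib)

lemma cost_error_upper:
  assumes z: "z \<in> feasible_set X g"
  shows "\<exists>C\<ge>0. \<forall>T\<ge>1. cost_error f x z T \<le> C * real T powr (- 1/2 + 2 * \<kappa>)"
proof -
  obtain K where K: "K \<ge> 0" "\<And>T \<theta>. T \<ge> 1 \<Longrightarrow> (\<And>k. 0 \<le> \<theta> $ k) \<Longrightarrow> norm \<theta> \<le> 0 * p T \<Longrightarrow>
    (\<Sum>t=1..T. cost t - agent_sum f z) + \<theta> \<bullet> (\<Sum>t=1..T. constr t)
      - real CARD('n) / 2 * (norm \<theta>)\<^sup>2 * (\<Sum>t=1..T. \<beta> t) \<le> K * rate T"
    using regret_bound[OF z order_refl] by metis
  have "cost_error f x z T \<le> K * real T powr (- 1/2 + 2 * \<kappa>)" if T: "T \<ge> 1" for T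
  proof -
    have "(\<Sum>t=1..T. cost t - agent_sum f z) \<le> K * rate T" using K(2)[OF T, of 0] by simp
    then have "(1 / real T) * (\<Sum>t=1..T. cost t - agent_sum f z) \<le> (1 / real T) * (K * rate T)"
      by (intro mult_left_mono) auto
    also have "\<dots> = K * (rate T / real T)" by simp
    also have "rate T / real T = real T powr (- 1/2 + 2 * \<kappa>)"
      using powr_divide_self[OF T, of "1/2 + 2 * \<kappa>"] by (simp add: rate_def)
    finally show ?thesis by (simp only: cost_error_eq[OF T])
  qed
  then show ?thesis using K(1) by blast
qed

text \<open>Any \<open>\<rho>\<close> above both exponents is allowed, so that one argument serves
  both regimes; for \<open>T \<ge> 1\<close> the larger exponent gives the larger power.\<close>

lemma violation_and_cost_lower:
  assumes z: "z \<in> feasible_set X g" and l: "\<And>k. 0 \<le> l $ k"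
    "\<And>v. v \<in> prod_set X \<Longrightarrow> agent_sum f z \<le> agent_sum f v + l \<bullet> agent_sum g v"
    and \<rho>: "- \<kappa> \<le> \<rho>" "- 1/4 + \<kappa>/2 \<le> \<rho>"
  shows "\<exists>C>0. \<forall>T\<ge>1. norm (pos_part (\<Sum>i\<in>UNIV. g i (time_average x T i))) \<le> C * real T powr \<rho>
    \<and> - (C * real T powr \<rho>) \<le> cost_error f x z T"
proof -
  obtain C where C: "C \<ge> 0" "\<And>T. T \<ge> 1 \<Longrightarrow> norm (pos_part (\<Sum>t=1..T. constr t))
      \<le> C * (real T powr (1 - \<kappa>) + real T powr (3/4 + \<kappa>/2))"
    using constr_sum_bound(1)[OF z l] by blast
  have avg: "(1 / real T) * norm (pos_part (\<Sum>t=1..T. constr t)) \<le> (2 * C) * real T powr \<rho>" if T: "T \<ge> 1" for T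
  proof -
    have "(1 / real T) * norm (pos_part (\<Sum>t=1..T. constr t))
        \<le> (1 / real T) * (C * (real T powr (1 - \<kappa>) + real T powr (3/4 + \<kappa>/2)))"
      by (intro mult_left_mono C(2) T) auto
    also have "\<dots> = C * (real T powr (1 - \<kappa>) / real T + real T powr (3/4 + \<kappa>/2) / real T)"
      by (simp only: distrib_left times_divide_eq_right times_divide_eq_left mult_1 add_divide_distrib)
    also have "\<dots> = C * (real T powr (1 - \<kappa> - 1) + real T powr (3/4 + \<kappa>/2 - 1))"
      by (simp only: powr_divide_self[OF T])
    also have "\<dots> \<le> C * (real T powr \<rho> + real T powr \<rho>)"
      using C(1) T \<rho> by (intro mult_left_mono add_mono powr_mono) auto
    finally show ?thesis by simp
  qed
  define C' where "C' = 1 + 2 * C + norm l * (2 * C)"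
  have C': "2 * C \<le> C'" "norm l * (2 * C) \<le> C'" "0 < C'" using C(1) by (auto simp: C'_def add_pos_nonneg)
  have "norm (pos_part (\<Sum>i\<in>UNIV. g i (time_average x T i))) \<le> C' * real T powr \<rho>" if T: "T \<ge> 1" for T
    using order_trans[OF average_constr_le[OF T] avg[OF T]] mult_right_mono[OF C'(1), of "real T powr \<rho>"] by simp
  moreover have "- (C' * real T powr \<rho>) \<le> cost_error f x z T" if T: "T \<ge> 1" for T
  proof -
    have "- (C' * real T powr \<rho>) \<le> - (norm l * ((2 * C) * real T powr \<rho>))"
      using mult_right_mono[OF C'(2), of "real T powr \<rho>"] by (simp add: mult.assoc)
    also have "\<dots> \<le> - (norm l * ((1 / real T) * norm (pos_part (\<Sum>t=1..T. constr t))))"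
      by (intro le_imp_neg_le mult_left_mono avg T) auto
    also have "\<dots> = (1 / real T) * (- (norm l * norm (pos_part (\<Sum>t=1..T. constr t))))" by simp
    also have "\<dots> \<le> (1 / real T) * (\<Sum>t=1..T. cost t - agent_sum f z)"
      by (intro mult_left_mono constr_sum_bound(2)[OF z l T]) auto
    finally show ?thesis by (simp only: cost_error_eq[OF T])
  qed
  ultimately show ?thesis using C'(3) by blast
qed

end

theorem theorem2:
  fixes E :: "nat \<Rightarrow> ('n::finite \<times> 'n) set"
    and A :: "nat \<Rightarrow> real ^ 'n ^ 'n"
    and a :: real and Q :: nat
    and V X :: "'n \<Rightarrow> 'a::euclidean_space set"
    and f :: "'n \<Rightarrow> 'a \<Rightarrow> real"
    and g :: "'n \<Rightarrow> 'a \<Rightarrow> real ^ 'm::finite"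
    and Bf Cf :: real
    and \<kappa> :: real
    and w :: "nat \<Rightarrow> 'n \<Rightarrow> real"
    and x s :: "nat \<Rightarrow> 'n \<Rightarrow> 'a"
    and \<mu> y :: "nat \<Rightarrow> 'n \<Rightarrow> real ^ 'm"
    and xopt :: "'a ^ 'n"
  assumes graph: "adjacency_matrices E A"
    and N1: "0 < a" "a < 1"
      "\<And>t i j. A t $ i $ j > 0 \<Longrightarrow> A t $ i $ j \<ge> a"
      "\<And>t i. A t $ i $ i \<ge> a"
    and N2: "\<And>t j. (\<Sum>i\<in>UNIV. A t $ i $ j) = 1"
    and N3: "Q > 0" "\<And>t. t \<ge> 1 \<Longrightarrow> strongly_connected (\<Union>l\<in>{0..Q - 1}. E (t + l))"
    and spaces: "\<And>i. subspace (V i)" "\<And>i. X i \<subseteq> V i"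
    and feasible: "feasible_set X g \<noteq> {}"
    and P1: "\<And>i. convex_on (V i) (f i)" "\<And>i k. convex_on (V i) (\<lambda>z. g i z $ k)"
    and P2: "\<And>i. convex (X i)" "\<And>i. compact (X i)"
    and P3: "slater V X g"
    and P4: "Bf > 0" "Cf > 0"
      "\<And>i z. z \<in> X i \<Longrightarrow> \<bar>f i z\<bar> \<le> Bf"
      "\<And>i z z'. z \<in> X i \<Longrightarrow> z' \<in> X i \<Longrightarrow> \<bar>f i z - f i z'\<bar> \<le> Cf * norm (z - z')"
      "\<And>i z u. z \<in> X i \<Longrightarrow> u \<in> subdifferential (V i) (f i) z \<Longrightarrow> norm u \<le> Cf"
    and kappa: "0 < \<kappa>" "\<kappa> < 1 / 4"
    and run: "dopp_run V X f g A alpha_step (beta_step \<kappa>) w x \<mu> y s"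
    and optimal: "is_arg_min (agent_sum f) (\<lambda>z. z \<in> feasible_set X g) xopt"
  shows
    "bigO_plus_from 4
       (\<lambda>T. (\<Sum>i\<in>UNIV. f i (time_average x T i)) - agent_sum f xopt)
       (\<lambda>T. real T powr (- 1 / 2 + 2 * \<kappa>)) \<and>
     (\<kappa> \<le> 1 / 6 \<longrightarrow>
       bigOmega_from 4 (cost_error f x xopt) (\<lambda>T. - (real T powr (- \<kappa>)))) \<and>
     (1 / 6 \<le> \<kappa> \<longrightarrow>
       bigOmega_from 4 (cost_error f x xopt) (\<lambda>T. - (real T powr (- 1 / 4 + \<kappa> / 2)))) \<and>
     (\<kappa> \<le> 1 / 6 \<longrightarrow>
       bigO_from 4 (\<lambda>T. norm (pos_part (\<Sum>i\<in>UNIV. g i (time_average x T i))))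
         (\<lambda>T. real T powr (- \<kappa>))) \<and>
     (1 / 6 \<le> \<kappa> \<longrightarrow>
       bigO_from 4 (\<lambda>T. norm (pos_part (\<Sum>i\<in>UNIV. g i (time_average x T i))))
         (\<lambda>T. real T powr (- 1 / 4 + \<kappa> / 2)))"
proof -
  interpret dopp E A a Q w V X f g Cf \<kappa> x s \<mu> y
  proof
    show "w 0 i = 1" "w (Suc t) i = mix (A t) (w t) i" for t i
      using run by (auto simp: dopp_run_def)
  qed (fact assms)+
  have z: "xopt \<in> feasible_set X g"
    and opt: "\<And>v. v \<in> feasible_set X g \<Longrightarrow> agent_sum f xopt \<le> agent_sum f v"
    using optimal by (auto simp: is_arg_min_def not_less)
  obtain l where l: "\<And>k. 0 \<le> l $ k"
    "\<And>v. v \<in> prod_set X \<Longrightarrow> agent_sum f xopt \<le> agent_sum f v + l \<bullet> agent_sum g v"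
    using slater_multiplier[OF spaces(2) P2(1) P1 P3 opt] by blast
  have upper: "bigO_plus_from 4 (\<lambda>T. (\<Sum>i\<in>UNIV. f i (time_average x T i)) - agent_sum f xopt)
      (\<lambda>T. real T powr (- 1 / 2 + 2 * \<kappa>))"
  proof -
    obtain C where C: "C \<ge> 0" "\<And>T. T \<ge> 1 \<Longrightarrow> cost_error f x xopt T \<le> C * real T powr (- 1/2 + 2 * \<kappa>)"
      using cost_error_upper[OF z] by blast
    \<comment> \<open>The order relation asks for a positive constant, while \<open>C\<close> may be
      0.\<close>
    have "(\<Sum>i\<in>UNIV. f i (time_average x T i)) - agent_sum f xopt
        \<le> (C + 1) * real T powr (- 1 / 2 + 2 * \<kappa>)" if T: "T \<ge> 4" for T
    proof -
      have "(\<Sum>i\<in>UNIV. f i (time_average x T i)) - agent_sum f xopt \<le> cost_error f x xopt T"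
        using average_cost_le[of T] T by (simp add: cost_error_def cost_def)
      also have "\<dots> \<le> C * real T powr (- 1/2 + 2 * \<kappa>)" using C(2) T by simp
      finally show ?thesis by (simp add: distrib_right add_increasing2)
    qed
    then show ?thesis unfolding bigO_plus_from_def using C(1) by (intro exI[of _ "C + 1"]) auto
  qed
  have regime: "bigOmega_from 4 (cost_error f x xopt) (\<lambda>T. - (real T powr \<rho>)) \<and>
      bigO_from 4 (\<lambda>T. norm (pos_part (\<Sum>i\<in>UNIV. g i (time_average x T i)))) (\<lambda>T. real T powr \<rho>)"
    if \<rho>: "- \<kappa> \<le> \<rho>" "- 1/4 + \<kappa>/2 \<le> \<rho>" for \<rho>
  proof -
    obtain C where "C > 0" "\<And>T. T \<ge> 1 \<Longrightarrow> norm (pos_part (\<Sum>i\<in>UNIV. g i (time_average x T i))) \<le> C * real T powr \<rho>"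
      "\<And>T. T \<ge> 1 \<Longrightarrow> - (C * real T powr \<rho>) \<le> cost_error f x xopt T"
      using violation_and_cost_lower[OF z l \<rho>] by blast
    then show ?thesis unfolding bigOmega_from_def bigO_from_def by auto
  qed
  \<comment> \<open>The exponents cross at \<open>\<kappa> = 1/6\<close>, where both equal
    \<open>- 1/6\<close>; in each regime the larger one is an admissible
    \<open>\<rho>\<close>.\<close>
  have "- 1/4 + \<kappa>/2 \<le> - \<kappa>" if "\<kappa> \<le> 1/6" using that by simp
  moreover have "- \<kappa> \<le> - 1/4 + \<kappa>/2" if "1/6 \<le> \<kappa>" using that by simp
  ultimately show ?thesis using upper regime[of "- \<kappa>"] regime[of "- 1/4 + \<kappa>/2"] by simp
qed

end
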